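(* Let $Q$ be a finite quiver with at least one arrow, $B=kQ$, $R=R_Q$, and let $P$ be the graded quiver with the same vertices and arrows $P_1=Q_1\sqcup\{\widehat a\}_{a\in Q_1}$, $t(\widehat a)=t(a)$, $h(\widehat a)=h(a)$, $|a|=0$, $|\widehat a|=1$. Let $A=k\overline P$ be the graded path algebra of its weight $2$ double, with bi-symplectic form $\omega=\sum_{a\in Q_1}(da\,da^*+d\widehat a\,d\widehat a^* )$ of weight $2$, and let $S_0=\sum_{a\in Q_1}a^*\widehat a\in A^3$. Let $a,b,c\in Q_1$ be arrows and $p,q,r,s$ paths in $Q$ with $h(p)=t(a)$, $h(a)=t(q)$, $h(q)=t(b)$, $h(b)=t(r)$, $h(r)=t(c)$, $h(c)=t(s)$; put $$\phi:=s(dc)r(db)q(da)p\in\Omega^3_RB,\qquad \widehat\phi:=s\widehat c\,r\widehat b\,q\widehat a\,p\in A^3,\qquad S_{\widehat\phi}:=S_0+\widehat\phi .$$ Let $\{-,-\}_\omega=m\circ\{\!\{-,-\}\!\}_\omega$ be the bracket associated to the double bracket $\{\!\{-,-\}\!\}_\omega$. Then $$[\{S_{\widehat\phi},S_{\widehat\phi}\}_\omega]=0\iff d_{\mathrm{DR}}[\phi]=0\ \text{ in }\ \mathrm{DR}^4_RA,$$ where $[\,\cdot\,]$ denotes the class in the Karoubi–de Rham complex $\mathrm{DR}^\bullet_RA$ (so the left-hand class is in $\mathrm{DR}^0_RA=A/[A,A]$, graded commutators), and $\phi$ is regarded as an element of $\Omega^3_RA$ via $B\subset A$.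
   Context: $k$ is a field of characteristic $0$, $\otimes=\otimes_k$. All graded constructions follow the Koszul sign rule. Quivers: paths compose from right to left; an arrow $a$ has tail $t(a)$ and head $h(a)$; $R_Q$ is the algebra spanned by the trivial paths. The weight $2$ double $\overline P$ of a graded quiver $P$ is obtained by adding for each arrow $a\colon i\to j$ a reverse arrow $a^*\colon j\to i$ with $|a^*|=2-|a|$; so here $|a|=0$, $|a^*|=2$, $|\widehat a|=|\widehat a^*|=1$. $A^n$ is the weight $n$ part of $A$, and $m$ is multiplication. $\Omega^1_RA$ carries the universal $R$-linear derivation $d$; $\Omega^\bullet_RA=T_A\Omega^1_RA$, bigraded by weight $|\cdot|$ and form degree $\|\cdot\|$ with sign rule $(-1)^{|u||v|+\|u\|\|v\|}$; $\mathrm{DR}^\bullet_RA=\Omega^\bullet_RA/[\Omega^\bullet_RA,\Omega^\bullet_RA]$ (bigraded commutators) with induced differential $d_{\mathrm{DR}}$. $\mathbb{D}\mathrm{er}_RA=\mathrm{Der}_R(A,A\otimes A)$ for the outer structure $a(u\otimes v)b=au\otimes vb$. $\Theta\in\mathbb{D}\mathrm{er}_RA$ extends to a double derivation $i_\Theta$ of $\Omega^\bullet_RA$ of bidegree $(|\Theta|,-1)$ with $i_\Theta(a)=0$, $i_\Theta(da)=\Theta(a)$; with $i_\Theta\alpha=i_\Theta'\alpha\otimes i_\Theta''\alpha$, set $\iota_\Theta\alpha=\pm i''_\Theta(\alpha)i'_\Theta(\alpha)$ (bigraded Koszul sign). The form $\omega$ is bi-symplectic, i.e. closed with $\Theta\mapsto\iota_\Theta\omega$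 an isomorphism $\mathbb{D}\mathrm{er}_RA\to\Omega^1_RA$; $H_x\in\mathbb{D}\mathrm{er}_RA$ is defined by $\iota_{H_x}\omega=dx$, and $\{\!\{x,y\}\!\}_\omega:=H_x(y)$, a double Poisson bracket of weight $-2$. *)

theory Defs
  imports
    "Graph_Theory.Arc_Walk"
    "HOL-Library.Poly_Mapping"
    "HOL-Library.FuncSet"
begin

section \<open>Linear extension and scalar multiplication of finitely supported functions\<close>

definition pscale :: "'k::comm_ring_1 \<Rightarrow> ('p \<Rightarrow>\<^sub>0 'k) \<Rightarrow> ('p \<Rightarrow>\<^sub>0 'k)" where
  "pscale c t = Poly_Mapping.map ((*) c) t"

definition lin :: "('p \<Rightarrow> ('q \<Rightarrow>\<^sub>0 'k::comm_ring_1)) \<Rightarrow> ('p \<Rightarrow>\<^sub>0 'k) \<Rightarrow> ('q \<Rightarrow>\<^sub>0 'k)" where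
  "lin f t = (\<Sum>p\<in>Poly_Mapping.keys t. pscale (Poly_Mapping.lookup t p) (f p))"

definition koszul :: "int \<Rightarrow> 'k::comm_ring_1" where
  "koszul n = (if even n then 1 else - 1)"


section \<open>Path algebras\<close>

text \<open>A triple \<open>(v, [x\<^sub>n, \<dots>, x\<^sub>1], u)\<close> stands for the path \<open>x\<^sub>n\<cdots>x\<^sub>1\<close> with tail \<open>u\<close> and head \<open>v\<close>:
  paths compose from right to left, whereas walks in the library are read from left to right.\<close>

type_synonym ('v, 'e) path = "'v \<times> 'e list \<times> 'v"

abbreviation path_head :: "('v, 'e) path \<Rightarrow> 'v" where "path_head p \<equiv> fst p"
abbreviation path_word :: "('v, 'e) path \<Rightarrow> 'e list" where "path_word p \<equiv> fst (snd p)"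
abbreviation path_tail :: "('v, 'e) path \<Rightarrow> 'v" where "path_tail p \<equiv> snd (snd p)"

definition paths :: "('v, 'e) pre_digraph \<Rightarrow> ('v, 'e) path set" where
  "paths Q = {(v, xs, u). pre_digraph.awalk Q u (rev xs) v}"

type_synonym ('v, 'e, 'k) palg = "('v, 'e) path \<Rightarrow>\<^sub>0 'k"

definition path_algebra :: "('v, 'e) pre_digraph \<Rightarrow> ('v, 'e, 'k::comm_ring_1) palg set" where
  "path_algebra Q = {x. Poly_Mapping.keys x \<subseteq> paths Q}"

definition vertex_algebra :: "('v, 'e) pre_digraph \<Rightarrow> ('v, 'e, 'k::comm_ring_1) palg set" where
  "vertex_algebra Q = {x. Poly_Mapping.keys x \<subseteq> (\<lambda>v. (v, [], v)) ` verts Q}"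

definition basis :: "('v, 'e) path \<Rightarrow> ('v, 'e, 'k::comm_ring_1) palg" where
  "basis p = Poly_Mapping.single p 1"

definition arrow :: "('v, 'e) pre_digraph \<Rightarrow> 'e \<Rightarrow> ('v, 'e, 'k::comm_ring_1) palg" where
  "arrow Q x = basis (head Q x, [x], tail Q x)"

definition palg_one :: "('v, 'e) pre_digraph \<Rightarrow> ('v, 'e, 'k::comm_ring_1) palg" where
  "palg_one Q = (\<Sum>v\<in>verts Q. basis (v, [], v))"

definition path_mult :: "('v, 'e) path \<Rightarrow> ('v, 'e) path \<Rightarrow> ('v, 'e, 'k::comm_ring_1) palg" where
  "path_mult p q =
     (if path_tail p = path_head q
      then basis (path_head p, path_word p @ path_word q, path_tail q) else 0)"

definition palg_mult ::
  "('v, 'e, 'k::comm_ring_1) palg \<Rightarrow> ('v, 'e, 'k) palg \<Rightarrow> ('v, 'e, 'k) palg" (infixl \<open>\<star>\<close> 70) where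
  "x \<star> y = lin (\<lambda>p. lin (path_mult p) y) x"

text \<open>The linear map induced by a renaming of the arrows.\<close>

definition relabel :: "('e \<Rightarrow> 'f) \<Rightarrow> ('v, 'e, 'k::comm_ring_1) palg \<Rightarrow> ('v, 'f, 'k) palg" where
  "relabel f = lin (\<lambda>(v, xs, u). basis (v, map f xs, u))"


section \<open>Tensor squares over the ground field\<close>

type_synonym ('v, 'e, 'k) palg2 = "(('v, 'e) path \<times> ('v, 'e) path) \<Rightarrow>\<^sub>0 'k"

definition path_algebra2 :: "('v, 'e) pre_digraph \<Rightarrow> ('v, 'e, 'k::comm_ring_1) palg2 set" where
  "path_algebra2 Q = {t. Poly_Mapping.keys t \<subseteq> paths Q \<times> paths Q}"

definition tensor ::
  "('v, 'e, 'k::comm_ring_1) palg \<Rightarrow> ('v, 'e, 'k) palg \<Rightarrow> ('v, 'e, 'k) palg2" (infixl \<open>\<otimes>\<^sub>k\<close> 65) where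
  "x \<otimes>\<^sub>k y = lin (\<lambda>p. lin (\<lambda>q. Poly_Mapping.single (p, q) 1) y) x"

text \<open>The outer bimodule structure \<open>a (u \<otimes> v) b = a u \<otimes> v b\<close>.\<close>

definition outer_left ::
  "('v, 'e, 'k::comm_ring_1) palg \<Rightarrow> ('v, 'e, 'k) palg2 \<Rightarrow> ('v, 'e, 'k) palg2" where
  "outer_left a = lin (\<lambda>(p, q). (a \<star> basis p) \<otimes>\<^sub>k basis q)"

definition outer_right ::
  "('v, 'e, 'k::comm_ring_1) palg2 \<Rightarrow> ('v, 'e, 'k) palg \<Rightarrow> ('v, 'e, 'k) palg2" where
  "outer_right t b = lin (\<lambda>(p, q). basis p \<otimes>\<^sub>k (basis q \<star> b)) t"

definition mult2 :: "('v, 'e, 'k::comm_ring_1) palg2 \<Rightarrow> ('v, 'e, 'k) palg" where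
  "mult2 = lin (\<lambda>(p, q). basis p \<star> basis q)"

definition relabel2 :: "('e \<Rightarrow> 'f) \<Rightarrow> ('v, 'e, 'k::comm_ring_1) palg2 \<Rightarrow> ('v, 'f, 'k) palg2" where
  "relabel2 f = lin (\<lambda>(p, q). relabel f (basis p) \<otimes>\<^sub>k relabel f (basis q))"


section \<open>Bigradings by weight and form degree\<close>

text \<open>Graded quivers are the bigraded ones all of whose arrows have form degree \<open>0\<close>.\<close>

record ('v, 'e) bigraded_quiver =
  quiver :: "('v, 'e) pre_digraph"
  weight :: "'e \<Rightarrow> int"
  form_degree :: "'e \<Rightarrow> int"

definition path_weight :: "('v, 'e) bigraded_quiver \<Rightarrow> ('v, 'e) path \<Rightarrow> int" where
  "path_weight G p = sum_list (map (weight G) (path_word p))"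

definition path_form_degree :: "('v, 'e) bigraded_quiver \<Rightarrow> ('v, 'e) path \<Rightarrow> int" where
  "path_form_degree G p = sum_list (map (form_degree G) (path_word p))"

definition homogeneous ::
  "('v, 'e) bigraded_quiver \<Rightarrow> int \<Rightarrow> int \<Rightarrow> ('v, 'e, 'k::comm_ring_1) palg set" where
  "homogeneous G m n =
     {x \<in> path_algebra (quiver G).
        \<forall>p\<in>Poly_Mapping.keys x. path_weight G p = m \<and> path_form_degree G p = n}"

definition homogeneous2 ::
  "('v, 'e) bigraded_quiver \<Rightarrow> int \<Rightarrow> int \<Rightarrow> ('v, 'e, 'k::comm_ring_1) palg2 set" where
  "homogeneous2 G m n =
     {t \<in> path_algebra2 (quiver G). \<forall>(p, q)\<in>Poly_Mapping.keys t.
        path_weight G p + path_weight G q = m \<and>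
        path_form_degree G p + path_form_degree G q = n}"

definition weights :: "('v, 'e) bigraded_quiver \<Rightarrow> ('v, 'e, 'k::comm_ring_1) palg \<Rightarrow> int set" where
  "weights G x = path_weight G ` Poly_Mapping.keys x"

definition weight_part ::
  "('v, 'e) bigraded_quiver \<Rightarrow> int \<Rightarrow> ('v, 'e, 'k::comm_ring_1) palg \<Rightarrow> ('v, 'e, 'k) palg" where
  "weight_part G m = lin (\<lambda>p. if path_weight G p = m then basis p else 0)"

text \<open>Double derivations of bidegree \<open>(m, n)\<close>, relative to the span of the trivial paths.
  They are extensional functions on the path algebra, so that equality of double derivations
  is equality of functions.\<close>

definition double_derivations ::
  "('v, 'e) bigraded_quiver \<Rightarrow> int \<Rightarrow> int \<Rightarrow>
   (('v, 'e, 'k::comm_ring_1) palg \<Rightarrow> ('v, 'e, 'k) palg2) set" where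
  "double_derivations G m n =
     {\<Theta> \<in> path_algebra (quiver G) \<rightarrow>\<^sub>E path_algebra2 (quiver G).
        (\<forall>x\<in>path_algebra (quiver G). \<forall>y\<in>path_algebra (quiver G). \<Theta> (x + y) = \<Theta> x + \<Theta> y) \<and>
        (\<forall>c. \<forall>x\<in>path_algebra (quiver G). \<Theta> (pscale c x) = pscale c (\<Theta> x)) \<and>
        (\<forall>r\<in>vertex_algebra (quiver G). \<Theta> r = 0) \<and>
        (\<forall>i j. \<forall>x\<in>homogeneous G i j. \<Theta> x \<in> homogeneous2 G (i + m) (j + n)) \<and>
        (\<forall>i j. \<forall>x\<in>homogeneous G i j. \<forall>y\<in>path_algebra (quiver G).
           \<Theta> (x \<star> y) =
             outer_right (\<Theta> x) y + pscale (koszul (m * i + n * j)) (outer_left x (\<Theta> y)))}"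

text \<open>The map \<open>u \<otimes> v \<mapsto> \<plusminus> v u\<close> with the bigraded Koszul sign.\<close>

definition swap_mult ::
  "('v, 'e) bigraded_quiver \<Rightarrow> ('v, 'e, 'k::comm_ring_1) palg2 \<Rightarrow> ('v, 'e, 'k) palg" where
  "swap_mult G = lin (\<lambda>(p, q).
     pscale (koszul (path_weight G p * path_weight G q + path_form_degree G p * path_form_degree G q))
       (basis q \<star> basis p))"

definition commutator_space ::
  "('v, 'e) bigraded_quiver \<Rightarrow> ('v, 'e, 'k::comm_ring_1) palg set" where
  "commutator_space G = module.span pscale
     {u \<star> v - pscale (koszul (i * i' + j * j')) (v \<star> u) | u v i j i' j'.
        u \<in> homogeneous G i j \<and> v \<in> homogeneous G i' j'}"


section \<open>Noncommutative differential forms on a path algebra\<close>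

text \<open>For the path algebra \<open>A\<close> of a quiver, \<open>\<Omega>\<^sup>1\<^sub>R A\<close> is the \<open>A\<close>-bimodule freely generated, relative to
  the trivial paths, by one element \<open>dx : t(x) \<rightarrow> h(x)\<close> for every arrow \<open>x\<close>; hence
  \<open>T\<^sub>A \<Omega>\<^sup>1\<^sub>R A\<close> is the path algebra of the quiver with arrows \<open>Fn x = x\<close> and \<open>Dif x = dx\<close>.
  The universal properties are \<open>forms1_universal\<close> and \<open>forms_universal\<close> below.\<close>

datatype 'e form = Fn 'e | Dif 'e

primrec form_arrow :: "'e form \<Rightarrow> 'e" where
  "form_arrow (Fn x) = x"
| "form_arrow (Dif x) = x"

primrec dif_count :: "'e form \<Rightarrow> int" where
  "dif_count (Fn x) = 0"
| "dif_count (Dif x) = 1"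

definition form_quiver :: "('v, 'e) pre_digraph \<Rightarrow> ('v, 'e form) pre_digraph" where
  "form_quiver Q =
     \<lparr>verts = verts Q, arcs = Fn ` arcs Q \<union> Dif ` arcs Q,
      tail = tail Q \<circ> form_arrow, head = head Q \<circ> form_arrow\<rparr>"

definition forms :: "('v, 'e) bigraded_quiver \<Rightarrow> ('v, 'e form) bigraded_quiver" where
  "forms G =
     \<lparr>quiver = form_quiver (quiver G),
      weight = weight G \<circ> form_arrow, form_degree = dif_count\<rparr>"

abbreviation function_form ::
  "('v, 'e, 'k::comm_ring_1) palg \<Rightarrow> ('v, 'e form, 'k) palg" where
  "function_form \<equiv> relabel Fn"

text \<open>The derivation \<open>d\<close> of bidegree \<open>(0, 1)\<close>: it replaces each occurrence of a letter
  \<open>Fn x\<close> by \<open>Dif x\<close>, with the sign of moving \<open>d\<close> past the preceding letters.\<close>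

definition d_path :: "('v, 'e form) path \<Rightarrow> ('v, 'e form, 'k::comm_ring_1) palg" where
  "d_path p =
     (\<Sum>i<length (path_word p).
        case path_word p ! i of
          Fn x \<Rightarrow> pscale (koszul (sum_list (map dif_count (take i (path_word p)))))
                   (basis (path_head p, (path_word p)[i := Dif x], path_tail p))
        | Dif x \<Rightarrow> 0)"

definition d_form :: "('v, 'e form, 'k::comm_ring_1) palg \<Rightarrow> ('v, 'e form, 'k) palg" where
  "d_form = lin d_path"

abbreviation d_arrow :: "('v, 'e) pre_digraph \<Rightarrow> 'e \<Rightarrow> ('v, 'e form, 'k::comm_ring_1) palg" where
  "d_arrow Q x \<equiv> d_form (function_form (arrow Q x))"

text \<open>Elements of the Karoubi--de Rham complex are cosets of the commutator space.\<close>

definition DR_class ::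
  "('v, 'e) bigraded_quiver \<Rightarrow> ('v, 'e form, 'k::comm_ring_1) palg \<Rightarrow> ('v, 'e form, 'k) palg set" where
  "DR_class G \<alpha> = {\<beta> \<in> path_algebra (quiver (forms G)). \<beta> - \<alpha> \<in> commutator_space (forms G)}"

definition d_DR ::
  "('v, 'e) bigraded_quiver \<Rightarrow> ('v, 'e form, 'k::comm_ring_1) palg set \<Rightarrow> ('v, 'e form, 'k) palg set" where
  "d_DR G X = (\<Union>\<alpha>\<in>X. DR_class G (d_form \<alpha>))"


section \<open>The double bracket of a bi-symplectic form\<close>

text \<open>Here and below \<open>\<Theta>\<close> is a double derivation of weight \<open>m\<close>.\<close>

definition contraction2 ::
  "('v, 'e) bigraded_quiver \<Rightarrow> int \<Rightarrow> (('v, 'e, 'k::comm_ring_1) palg \<Rightarrow> ('v, 'e, 'k) palg2) \<Rightarrow>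
   ('v, 'e form, 'k) palg \<Rightarrow> ('v, 'e form, 'k) palg2" where
  "contraction2 G m \<Theta> =
     (THE i. i \<in> double_derivations (forms G) m (- 1) \<and>
        (\<forall>a\<in>path_algebra (quiver G).
           i (function_form a) = 0 \<and> i (d_form (function_form a)) = relabel2 Fn (\<Theta> a)))"

definition contraction ::
  "('v, 'e) bigraded_quiver \<Rightarrow> int \<Rightarrow> (('v, 'e, 'k::comm_ring_1) palg \<Rightarrow> ('v, 'e, 'k) palg2) \<Rightarrow>
   ('v, 'e form, 'k) palg \<Rightarrow> ('v, 'e form, 'k) palg" where
  "contraction G m \<Theta> \<alpha> = swap_mult (forms G) (contraction2 G m \<Theta> \<alpha>)"

text \<open>For \<open>\<omega>\<close> of weight \<open>N\<close> and \<open>x\<close> of weight \<open>m\<close>, the double derivation \<open>H\<^sub>x\<close> has weight \<open>m - N\<close>;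
  the double bracket is extended to all \<open>x\<close> by additivity.\<close>

definition hamiltonian ::
  "('v, 'e) bigraded_quiver \<Rightarrow> int \<Rightarrow> ('v, 'e form, 'k::comm_ring_1) palg \<Rightarrow> int \<Rightarrow> ('v, 'e, 'k) palg \<Rightarrow>
   ('v, 'e, 'k) palg \<Rightarrow> ('v, 'e, 'k) palg2" where
  "hamiltonian G N \<omega> m x =
     (THE H. H \<in> double_derivations G (m - N) 0 \<and>
        contraction G (m - N) H \<omega> = d_form (function_form x))"

definition double_bracket ::
  "('v, 'e) bigraded_quiver \<Rightarrow> int \<Rightarrow> ('v, 'e form, 'k::comm_ring_1) palg \<Rightarrow>
   ('v, 'e, 'k) palg \<Rightarrow> ('v, 'e, 'k) palg \<Rightarrow> ('v, 'e, 'k) palg2" where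
  "double_bracket G N \<omega> x y =
     (\<Sum>m\<in>weights G x. hamiltonian G N \<omega> m (weight_part G m x) y)"

definition bracket ::
  "('v, 'e) bigraded_quiver \<Rightarrow> int \<Rightarrow> ('v, 'e form, 'k::comm_ring_1) palg \<Rightarrow>
   ('v, 'e, 'k) palg \<Rightarrow> ('v, 'e, 'k) palg \<Rightarrow> ('v, 'e, 'k) palg" where
  "bracket G N \<omega> x y = mult2 (double_bracket G N \<omega> x y)"


section \<open>The quivers, the form and the potentials\<close>

datatype 'a hatted = Plain 'a | Hat 'a

primrec unhat :: "'a hatted \<Rightarrow> 'a" where
  "unhat (Plain a) = a"
| "unhat (Hat a) = a"

definition hat_quiver :: "('v, 'a) pre_digraph \<Rightarrow> ('v, 'a hatted) bigraded_quiver" where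
  "hat_quiver Q =
     \<lparr>quiver = \<lparr>verts = verts Q, arcs = Plain ` arcs Q \<union> Hat ` arcs Q,
               tail = tail Q \<circ> unhat, head = head Q \<circ> unhat\<rparr>,
      weight = case_hatted (\<lambda>_. 0) (\<lambda>_. 1), form_degree = (\<lambda>_. 0)\<rparr>"

datatype 'e doubled = Orig 'e | Star 'e

definition double_quiver :: "int \<Rightarrow> ('v, 'e) bigraded_quiver \<Rightarrow> ('v, 'e doubled) bigraded_quiver" where
  "double_quiver N G =
     \<lparr>quiver = \<lparr>verts = verts (quiver G), arcs = Orig ` arcs (quiver G) \<union> Star ` arcs (quiver G),
               tail = case_doubled (tail (quiver G)) (head (quiver G)),
               head = case_doubled (head (quiver G)) (tail (quiver G))\<rparr>,
      weight = case_doubled (weight G) (\<lambda>e. N - weight G e), form_degree = (\<lambda>_. 0)\<rparr>"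

definition Pbar :: "('v, 'a) pre_digraph \<Rightarrow> ('v, 'a hatted doubled) bigraded_quiver" where
  "Pbar Q = double_quiver 2 (hat_quiver Q)"

abbreviation a_arrow :: "'a \<Rightarrow> 'a hatted doubled" where "a_arrow a \<equiv> Orig (Plain a)"
abbreviation hat_arrow :: "'a \<Rightarrow> 'a hatted doubled" where "hat_arrow a \<equiv> Orig (Hat a)"
abbreviation star_arrow :: "'a \<Rightarrow> 'a hatted doubled" where "star_arrow a \<equiv> Star (Plain a)"
abbreviation hat_star_arrow :: "'a \<Rightarrow> 'a hatted doubled" where "hat_star_arrow a \<equiv> Star (Hat a)"

definition omega ::
  "('v, 'a) pre_digraph \<Rightarrow> ('v, 'a hatted doubled form, 'k::comm_ring_1) palg" where
  "omega Q =
     (let P = quiver (Pbar Q) in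
      \<Sum>a\<in>arcs Q. d_arrow P (a_arrow a) \<star> d_arrow P (star_arrow a)
              + d_arrow P (hat_arrow a) \<star> d_arrow P (hat_star_arrow a))"

definition S0 :: "('v, 'a) pre_digraph \<Rightarrow> ('v, 'a hatted doubled, 'k::comm_ring_1) palg" where
  "S0 Q = (\<Sum>a\<in>arcs Q. arrow (quiver (Pbar Q)) (star_arrow a) \<star> arrow (quiver (Pbar Q)) (hat_arrow a))"

definition phi ::
  "('v, 'a) pre_digraph \<Rightarrow> ('v, 'a) path \<Rightarrow> 'a \<Rightarrow> ('v, 'a) path \<Rightarrow> 'a \<Rightarrow> ('v, 'a) path \<Rightarrow> 'a \<Rightarrow>
   ('v, 'a) path \<Rightarrow> ('v, 'a form, 'k::comm_ring_1) palg" where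
  "phi Q s c r b q a p =
     function_form (basis s) \<star> d_arrow Q c \<star> function_form (basis r) \<star> d_arrow Q b \<star>
     function_form (basis q) \<star> d_arrow Q a \<star> function_form (basis p)"

definition phi_hat ::
  "('v, 'a) pre_digraph \<Rightarrow> ('v, 'a) path \<Rightarrow> 'a \<Rightarrow> ('v, 'a) path \<Rightarrow> 'a \<Rightarrow> ('v, 'a) path \<Rightarrow> 'a \<Rightarrow>
   ('v, 'a) path \<Rightarrow> ('v, 'a hatted doubled, 'k::comm_ring_1) palg" where
  "phi_hat Q s c r b q a p =
     (let P = quiver (Pbar Q); i = relabel a_arrow in
      i (basis s) \<star> arrow P (hat_arrow c) \<star> i (basis r) \<star> arrow P (hat_arrow b) \<star>
      i (basis q) \<star> arrow P (hat_arrow a) \<star> i (basis p))"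

text \<open>The map \<open>\<Omega>\<^sup>\<bullet>\<^sub>R B \<rightarrow> \<Omega>\<^sup>\<bullet>\<^sub>R A\<close> induced by the inclusion \<open>B \<subseteq> A\<close>.\<close>

abbreviation forms_inclusion ::
  "('v, 'a form, 'k::comm_ring_1) palg \<Rightarrow> ('v, 'a hatted doubled form, 'k) palg" where
  "forms_inclusion \<equiv> relabel (map_form a_arrow)"


section \<open>Universal properties of the forms\<close>


lemma lookup_pscale [simp]: "Poly_Mapping.lookup (pscale c t) p = c * Poly_Mapping.lookup t p"
  unfolding pscale_def by (simp add: Poly_Mapping.map.rep_eq when_def)

lemma pscale_add: "pscale c (s + t) = pscale c s + pscale c t"
  by (rule poly_mapping_eqI) (simp add: lookup_add algebra_simps)

lemma pscale_left_add: "pscale (c + c') t = pscale c t + pscale c' t"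
  by (rule poly_mapping_eqI) (simp add: lookup_add algebra_simps)

lemma pscale_pscale [simp]: "pscale c (pscale c' t) = pscale (c * c') t"
  by (rule poly_mapping_eqI) (simp add: algebra_simps)

lemma pscale_0 [simp]: "pscale 0 t = 0" "pscale c 0 = 0"
  by (auto intro: poly_mapping_eqI)

lemma pscale_1 [simp]: "pscale 1 t = t"
  by (auto intro: poly_mapping_eqI)

lemma pscale_sum: "pscale c (\<Sum>i\<in>I. f i) = (\<Sum>i\<in>I. pscale c (f i))"
  by (induction I rule: infinite_finite_induct) (auto simp: pscale_add)

lemma keys_pscale: "Poly_Mapping.keys (pscale c t) \<subseteq> Poly_Mapping.keys t"
  by (auto simp: in_keys_iff)

lemma single_eq_pscale: "Poly_Mapping.single p c = pscale c (Poly_Mapping.single p 1)"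
  by (rule poly_mapping_eqI) (simp add: lookup_single when_def)

lemma keys_sum_subset:
  assumes "\<And>i. i \<in> I \<Longrightarrow> Poly_Mapping.keys (f i) \<subseteq> S"
  shows "Poly_Mapping.keys (\<Sum>i\<in>I. f i) \<subseteq> S"
  using assms
proof (induction I rule: infinite_finite_induct)
  case (insert i I)
  then have "Poly_Mapping.keys (f i) \<subseteq> S" "Poly_Mapping.keys (sum f I) \<subseteq> S" by auto
  then show ?case using Poly_Mapping.keys_add[of "f i" "sum f I"] insert.hyps by auto
qed simp_all

definition addext :: "('p \<Rightarrow> 'k::comm_ring_1 \<Rightarrow> 'm::ab_group_add) \<Rightarrow> ('p \<Rightarrow>\<^sub>0 'k) \<Rightarrow> 'm" where
  "addext g t = (\<Sum>p\<in>Poly_Mapping.keys t. g p (Poly_Mapping.lookup t p))"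

lemma addext_superset:
  assumes "finite S" "Poly_Mapping.keys t \<subseteq> S" "\<And>p. p \<in> S \<Longrightarrow> g p 0 = 0"
  shows "addext g t = (\<Sum>p\<in>S. g p (Poly_Mapping.lookup t p))"
  unfolding addext_def using assms
  by (intro sum.mono_neutral_left) (auto simp: in_keys_iff)

lemma addext_add:
  assumes "\<And>p c c'. p \<in> Poly_Mapping.keys s \<union> Poly_Mapping.keys t \<Longrightarrow> g p (c + c') = g p c + g p c'"
  shows "addext g (s + t) = addext g s + addext g t"
proof -
  let ?S = "Poly_Mapping.keys s \<union> Poly_Mapping.keys t"
  have z: "g p 0 = 0" if "p \<in> ?S" for p using assms[OF that, of 0 0] by simp
  have "addext g (s + t) = (\<Sum>p\<in>?S. g p (Poly_Mapping.lookup (s + t) p))"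
    by (rule addext_superset) (use z Poly_Mapping.keys_add[of s t] in auto)
  also have "\<dots> = (\<Sum>p\<in>?S. g p (Poly_Mapping.lookup s p)) + (\<Sum>p\<in>?S. g p (Poly_Mapping.lookup t p))"
    by (simp add: lookup_add assms sum.distrib)
  also have "(\<Sum>p\<in>?S. g p (Poly_Mapping.lookup s p)) = addext g s"
    by (rule addext_superset[symmetric]) (use z in auto)
  also have "(\<Sum>p\<in>?S. g p (Poly_Mapping.lookup t p)) = addext g t"
    by (rule addext_superset[symmetric]) (use z in auto)
  finally show ?thesis .
qed

lemma addext_single: "g p 0 = 0 \<Longrightarrow> addext g (Poly_Mapping.single p c) = g p c"
  by (subst addext_superset[of "{p}"]) auto

lemma lin_addext: "lin f = addext (\<lambda>p c. pscale c (f p))"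
  by (simp add: fun_eq_iff lin_def addext_def)

lemma lin_add: "lin f (s + t) = lin f s + lin f t"
  by (simp add: lin_addext addext_add pscale_left_add)

lemma lin_0 [simp]: "lin f 0 = 0" by (simp add: lin_def)

lemma lin_single [simp]: "lin f (Poly_Mapping.single p c) = pscale c (f p)"
  by (simp add: lin_addext addext_single)

lemma lin_basis [simp]: "lin f (basis p) = f p"
  by (simp add: basis_def)

lemma lin_pscale: "lin f (pscale c t) = pscale c (lin f t)"
proof -
  have "lin f (pscale c t) = (\<Sum>p\<in>Poly_Mapping.keys t. pscale (Poly_Mapping.lookup (pscale c t) p) (f p))"
    unfolding lin_addext by (rule addext_superset) (auto simp: keys_pscale)
  also have "\<dots> = pscale c (lin f t)" by (simp add: lin_def pscale_sum)
  finally show ?thesis .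
qed

lemma lin_sum: "lin f (\<Sum>i\<in>I. g i) = (\<Sum>i\<in>I. lin f (g i))"
  by (induction I rule: infinite_finite_induct) (auto simp: lin_add)

lemma lin_zero_fun [simp]: "lin (\<lambda>p. 0) t = 0"
  by (simp add: lin_def)

lemma lin_add_fun: "lin (\<lambda>p. f p + g p) t = lin f t + lin g t"
  by (simp add: lin_def pscale_add sum.distrib)

lemma lin_pscale_fun: "lin (\<lambda>p. pscale c (f p)) t = pscale c (lin f t)"
  by (simp add: lin_def pscale_sum mult.commute)

lemma lin_cong: "(\<And>p. p \<in> Poly_Mapping.keys t \<Longrightarrow> f p = g p) \<Longrightarrow> lin f t = lin g t"
  by (simp add: lin_def)

lemma keys_lin:
  assumes "\<And>p. p \<in> Poly_Mapping.keys t \<Longrightarrow> Poly_Mapping.keys (f p) \<subseteq> S"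
  shows "Poly_Mapping.keys (lin f t) \<subseteq> S"
  unfolding lin_def by (intro keys_sum_subset order.trans[OF keys_pscale assms])

lemma palg_expand: "x = (\<Sum>p\<in>Poly_Mapping.keys x. pscale (Poly_Mapping.lookup x p) (basis p))"
proof (rule poly_mapping_eqI)
  fix q
  have "Poly_Mapping.lookup (\<Sum>p\<in>Poly_Mapping.keys x. pscale (Poly_Mapping.lookup x p) (basis p)) q
      = (\<Sum>p\<in>Poly_Mapping.keys x. if p = q then Poly_Mapping.lookup x q else 0)"
    unfolding lookup_sum lookup_pscale basis_def lookup_single when_def
    by (intro sum.cong) auto
  also have "\<dots> = Poly_Mapping.lookup x q" by (auto simp: in_keys_iff)
  finally show "Poly_Mapping.lookup x q = 
    Poly_Mapping.lookup (\<Sum>p\<in>Poly_Mapping.keys x. pscale (Poly_Mapping.lookup x p) (basis p)) q" ..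
qed

lemma palg_induct [consumes 1, case_names zero scale add]:
  assumes "Poly_Mapping.keys x \<subseteq> S" "P 0"
    and "\<And>c p. p \<in> S \<Longrightarrow> P (pscale c (basis p))"
    and "\<And>y z. Poly_Mapping.keys y \<subseteq> S \<Longrightarrow> Poly_Mapping.keys z \<subseteq> S \<Longrightarrow> P y \<Longrightarrow> P z \<Longrightarrow> P (y + z)"
  shows "P x"
proof -
  have "Poly_Mapping.keys (\<Sum>p\<in>I. pscale (Poly_Mapping.lookup x p) (basis p)) \<subseteq> S \<and>
        P (\<Sum>p\<in>I. pscale (Poly_Mapping.lookup x p) (basis p))" if "finite I" "I \<subseteq> S" for I
    using that
  proof (induction I rule: finite_induct)
    case empty then show ?case by (simp add: assms)
  next
    case (insert p I)
    have k: "Poly_Mapping.keys (pscale (Poly_Mapping.lookup x p) (basis p)) \<subseteq> S"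
      using keys_pscale[of _ "basis p"] insert.prems by (fastforce simp: basis_def)
    show ?case using insert k assms(3)[of p] assms(4)[OF k]
      by (auto dest!: subsetD[OF Poly_Mapping.keys_add])
  qed
  from this[of "Poly_Mapping.keys x"] show ?thesis using assms(1) palg_expand[of x] by simp
qed

lemma palg_mult_add_left: "(x + y) \<star> z = x \<star> z + y \<star> z"
  by (simp add: palg_mult_def lin_add)

lemma palg_mult_add_right: "x \<star> (y + z) = x \<star> y + x \<star> z"
  by (simp add: palg_mult_def lin_add lin_add_fun)

lemma palg_mult_pscale_left: "pscale c x \<star> y = pscale c (x \<star> y)"
  by (simp add: palg_mult_def lin_pscale)

lemma palg_mult_pscale_right: "x \<star> pscale c y = pscale c (x \<star> y)"
  by (simp add: palg_mult_def lin_pscale lin_pscale_fun)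

lemma palg_mult_0 [simp]: "0 \<star> x = 0" "x \<star> 0 = 0"
  by (simp_all add: palg_mult_def)

lemma palg_mult_basis [simp]: "basis p \<star> basis q = path_mult p q"
  by (simp add: palg_mult_def)

lemmas palg_mult_simps = palg_mult_add_left palg_mult_add_right palg_mult_pscale_left
  palg_mult_pscale_right

lemma palg_mult_sum_left: "(\<Sum>i\<in>I. f i) \<star> y = (\<Sum>i\<in>I. f i \<star> y)"
  by (induction I rule: infinite_finite_induct) (auto simp: palg_mult_add_left)

lemma palg_mult_sum_right: "y \<star> (\<Sum>i\<in>I. f i) = (\<Sum>i\<in>I. y \<star> f i)"
  by (induction I rule: infinite_finite_induct) (auto simp: palg_mult_add_right)

lemma path_mult_assoc: "path_mult p q \<star> basis r = basis p \<star> (path_mult q r :: ('v,'e,'k::comm_ring_1) palg)"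
  by (auto simp: path_mult_def)

lemma palg_mult_assoc: "(x \<star> y) \<star> z = x \<star> (y \<star> z)"
proof -
  have *: "(basis p \<star> basis q) \<star> z = basis p \<star> (basis q \<star> z)" for p q
    using subset_UNIV[of "Poly_Mapping.keys z"]
    by (induction z rule: palg_induct)
       (simp_all add: palg_mult_simps path_mult_assoc)
  have *: "(basis p \<star> y) \<star> z = basis p \<star> (y \<star> z)" for p
    using subset_UNIV[of "Poly_Mapping.keys y"]
    by (induction y rule: palg_induct)
       (simp_all add: palg_mult_simps * del: palg_mult_basis)
  show ?thesis
    using subset_UNIV[of "Poly_Mapping.keys x"]
    by (induction x rule: palg_induct) (simp_all add: palg_mult_simps *)
qed

lemma paths_Nil: "(v, [], u) \<in> paths Q \<longleftrightarrow> v = u \<and> u \<in> verts Q"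
  by (auto simp: paths_def pre_digraph.awalk_def pre_digraph.cas.simps)

lemma cas_append: "pre_digraph.cas Q u (xs @ ys) v \<longleftrightarrow>
    (\<exists>w. pre_digraph.cas Q u xs w \<and> pre_digraph.cas Q w ys v)"
  by (induction xs arbitrary: u) (auto simp: pre_digraph.cas.simps)

lemma awalk_append: 
  assumes "wf_digraph Q"
  shows "pre_digraph.awalk Q u (xs @ ys) v \<longleftrightarrow>
    (\<exists>w. pre_digraph.awalk Q u xs w \<and> pre_digraph.awalk Q w ys v)"
proof -
  interpret wf_digraph Q by fact
  show ?thesis by auto
qed

lemma paths_append:
  assumes "wf_digraph Q"
  shows "(v, xs @ ys, u) \<in> paths Q \<longleftrightarrow> (\<exists>w. (v, xs, w) \<in> paths Q \<and> (w, ys, u) \<in> paths Q)"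
  using awalk_append[OF assms] by (auto simp: paths_def)

lemma paths_single:
  assumes "wf_digraph Q"
  shows "(v, [x], u) \<in> paths Q \<longleftrightarrow> x \<in> arcs Q \<and> v = head Q x \<and> u = tail Q x"
  using wf_digraph.tail_in_verts[OF assms, of x]
  by (auto simp: paths_def pre_digraph.awalk_def pre_digraph.cas.simps)

lemma paths_Cons:
  assumes "wf_digraph Q"
  shows "(v, x # xs, u) \<in> paths Q \<longleftrightarrow>
    x \<in> arcs Q \<and> v = head Q x \<and> (tail Q x, xs, u) \<in> paths Q"
  using paths_append[OF assms, of v "[x]" xs u] by (auto simp: paths_single[OF assms])

lemma paths_verts:
  assumes "wf_digraph Q" "(v, xs, u) \<in> paths Q"
  shows "v \<in> verts Q" "u \<in> verts Q"
  using assms paths_append[OF assms(1), of v "[]" xs u] paths_append[OF assms(1), of v xs "[]" u]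
  by (auto simp: paths_Nil)

lemma path_algebra_0 [simp]: "0 \<in> path_algebra Q" by (simp add: path_algebra_def)

lemma path_algebra_add: "x \<in> path_algebra Q \<Longrightarrow> y \<in> path_algebra Q \<Longrightarrow> x + y \<in> path_algebra Q"
  using Poly_Mapping.keys_add[of x y] by (auto simp: path_algebra_def)

lemma path_algebra_pscale: "x \<in> path_algebra Q \<Longrightarrow> pscale c x \<in> path_algebra Q"
  using keys_pscale[of c x] by (auto simp: path_algebra_def)

lemma path_algebra_sum: "(\<And>i. i \<in> I \<Longrightarrow> f i \<in> path_algebra Q) \<Longrightarrow> (\<Sum>i\<in>I. f i) \<in> path_algebra Q"
  unfolding path_algebra_def using keys_sum_subset[of I f "paths Q"] by blast

lemma path_algebra_basis: "p \<in> paths Q \<Longrightarrow> basis p \<in> path_algebra Q"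
  by (simp add: path_algebra_def basis_def)

lemma path_algebra_mult:
  fixes x y :: "('v, 'e, 'c::comm_ring_1) palg"
  assumes "wf_digraph Q" "x \<in> path_algebra Q" "y \<in> path_algebra Q"
  shows "x \<star> y \<in> path_algebra Q"
proof -
  have "Poly_Mapping.keys (path_mult p q :: (_,_,'c) palg) \<subseteq> paths Q" if "p \<in> paths Q" "q \<in> paths Q" for p q
    using that paths_append[OF assms(1)] by (cases p; cases q) (auto simp: path_mult_def basis_def)
  then show ?thesis using assms(2,3)
    unfolding path_algebra_def palg_mult_def mem_Collect_eq by (intro keys_lin) blast
qed

lemma palg_one_in: "palg_one Q \<in> path_algebra Q"
  unfolding palg_one_def by (intro path_algebra_sum path_algebra_basis) (auto simp: paths_Nil)

lemma palg_one_left: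
  fixes x :: "('v, 'e, 'k::comm_ring_1) palg"
  assumes "fin_digraph Q" "x \<in> path_algebra Q"
  shows "palg_one Q \<star> x = x"
proof -
  interpret fin_digraph Q by fact
  have "palg_one Q \<star> basis (v, xs, u) = (basis (v, xs, u) :: (_, _, 'k) palg)" if "v \<in> verts Q" for v xs u
  proof -
    have "palg_one Q \<star> basis (v, xs, u) = (\<Sum>w\<in>verts Q. if w = v then basis (v, xs, u) else 0)"
      by (auto simp: palg_one_def palg_mult_sum_left path_mult_def intro!: sum.cong)
    then show ?thesis using that by simp
  qed
  then have *: "palg_one Q \<star> basis p = (basis p :: (_, _, 'k) palg)" if "p \<in> paths Q" for p
    using that paths_verts[OF wf_digraph] by (cases p) auto
  show ?thesis using assms(2) unfolding path_algebra_def mem_Collect_eq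
    by (induction x rule: palg_induct) (auto simp: palg_mult_simps *)
qed

lemma palg_one_right:
  fixes x :: "('v, 'e, 'k::comm_ring_1) palg"
  assumes "fin_digraph Q" "x \<in> path_algebra Q"
  shows "x \<star> palg_one Q = x"
proof -
  interpret fin_digraph Q by fact
  have "basis (v, xs, u) \<star> palg_one Q = (basis (v, xs, u) :: (_, _, 'k) palg)" if "u \<in> verts Q" for v xs u
  proof -
    have "basis (v, xs, u) \<star> palg_one Q = (\<Sum>w\<in>verts Q. if w = u then basis (v, xs, u) else 0)"
      by (auto simp: palg_one_def palg_mult_sum_right path_mult_def intro!: sum.cong)
    then show ?thesis using that by simp
  qed
  then have *: "basis p \<star> palg_one Q = (basis p :: (_, _, 'k) palg)" if "p \<in> paths Q" for p
    using that paths_verts[OF wf_digraph] by (cases p) auto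
  show ?thesis using assms(2) unfolding path_algebra_def mem_Collect_eq
    by (induction x rule: palg_induct) (auto simp: palg_mult_simps *)
qed

lemma relabel_basis [simp]: "relabel f (basis p) = basis (path_head p, map f (path_word p), path_tail p)"
  by (simp add: relabel_def split: prod.splits)

lemma relabel_add: "relabel f (x + y) = relabel f x + relabel f y"
  by (simp add: relabel_def lin_add)

lemma relabel_pscale: "relabel f (pscale c x) = pscale c (relabel f x)"
  by (simp add: relabel_def lin_pscale)

lemma relabel_0 [simp]: "relabel f 0 = 0"
  by (simp add: relabel_def)

lemma relabel_mult: "relabel f (x \<star> y) = relabel f x \<star> relabel f y"
proof -
  have *: "relabel f (basis p \<star> y) = relabel f (basis p) \<star> relabel f y" for p
    using subset_UNIV[of "Poly_Mapping.keys y"]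
    by (induction y rule: palg_induct)
       (auto simp: palg_mult_simps relabel_add relabel_pscale path_mult_def)
  show ?thesis
    using subset_UNIV[of "Poly_Mapping.keys x"]
    by (induction x rule: palg_induct)
       (simp_all add: palg_mult_simps relabel_add relabel_pscale * del: relabel_basis)
qed

lemma form_quiver_simps [simp]:
  "verts (form_quiver Q) = verts Q" "arcs (form_quiver Q) = Fn ` arcs Q \<union> Dif ` arcs Q"
  "tail (form_quiver Q) x = tail Q (form_arrow x)" "head (form_quiver Q) x = head Q (form_arrow x)"
  by (simp_all add: form_quiver_def)

lemma form_arrow_arcs: "x \<in> Fn ` A \<union> Dif ` A \<longleftrightarrow> form_arrow x \<in> A"
  by (cases x) auto

lemma fin_digraph_form_quiver: "fin_digraph Q \<Longrightarrow> fin_digraph (form_quiver Q)"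
  by (auto simp: fin_digraph_def wf_digraph_def fin_digraph_axioms_def)

lemma paths_form_quiver: 
  assumes "wf_digraph Q"
  shows "(v, xs, u) \<in> paths (form_quiver Q) \<longleftrightarrow> (v, map form_arrow xs, u) \<in> paths Q"
proof -
  have "wf_digraph (form_quiver Q)" using assms by (auto simp: wf_digraph_def)
  then show ?thesis using assms
    by (induction xs arbitrary: v)
       (auto simp: paths_Nil paths_Cons form_arrow_arcs simp del: Un_iff)
qed

lemma function_form_in:
  assumes "wf_digraph Q" "x \<in> path_algebra Q"
  shows "function_form x \<in> path_algebra (form_quiver Q)"
proof -
  have "(path_head p, map Fn (path_word p), path_tail p) \<in> paths (form_quiver Q)" if "p \<in> paths Q" for p
    using that by (cases p) (auto simp: paths_form_quiver[OF assms(1)] comp_def)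
  then show ?thesis using assms(2) unfolding path_algebra_def relabel_def
    by (auto intro!: keys_lin simp: basis_def)
qed


lemma koszul_add: "koszul (m + n) = koszul m * koszul n"
  by (auto simp: koszul_def)

lemma koszul_0 [simp]: "koszul 0 = 1" by (simp add: koszul_def)

lemma d_form_add: "d_form (x + y) = d_form x + d_form y"
  by (simp add: d_form_def lin_add)

lemma d_form_pscale: "d_form (pscale c x) = pscale c (d_form x)"
  by (simp add: d_form_def lin_pscale)

lemma d_form_0 [simp]: "d_form 0 = 0"
  by (simp add: d_form_def)

lemma d_form_basis [simp]: "d_form (basis p) = d_path p"
  by (simp add: d_form_def)

lemma d_path_Nil [simp]: "d_path (v, [], u) = 0"
  by (simp add: d_path_def)

lemma d_path_Cons:
  "d_path (v, x # xs, u) =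
     (case x of Fn y \<Rightarrow> basis (v, Dif y # xs, u) | Dif y \<Rightarrow> 0) +
     pscale (koszul (dif_count x)) (basis (v, [x], w) \<star> d_path (w, xs, u))"
proof -
  define t :: "nat \<Rightarrow> ('a, 'b form, 'c) palg" where "t = (\<lambda>i. case (x # xs) ! i of
          Fn y \<Rightarrow> pscale (koszul (sum_list (map dif_count (take i (x # xs)))))
                   (basis (v, (x # xs)[i := Dif y], u))
        | Dif y \<Rightarrow> 0)"
  have "d_path (v, x # xs, u) = (\<Sum>i<Suc (length xs). t i)"
    unfolding d_path_def t_def by (simp only: fst_conv snd_conv list.size add_Suc_right add_0_right)
  also have "\<dots> = t 0 + (\<Sum>i<length xs. t (Suc i))"
    by (rule sum.lessThan_Suc_shift)
  also have "t 0 = (case x of Fn y \<Rightarrow> basis (v, Dif y # xs, u) | Dif y \<Rightarrow> 0)"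
    by (simp add: t_def split: form.split)
  also have "(\<Sum>i<length xs. t (Suc i)) =
      pscale (koszul (dif_count x)) (basis (v, [x], w) \<star> d_path (w, xs, u))"
    unfolding d_path_def palg_mult_sum_right pscale_sum t_def
    by (intro sum.cong)
       (auto split: form.split simp: koszul_add palg_mult_pscale_right path_mult_def)
  finally show ?thesis .
qed

lemma d_path_append:
  "(d_path (v, xs @ ys, u) :: ('v, 'e form, 'k::comm_ring_1) palg) =
     d_path (v, xs, w) \<star> basis (w, ys, u) +
     pscale (koszul (sum_list (map dif_count xs))) (basis (v, xs, w) \<star> d_path (w, ys, u))"
proof (induction xs arbitrary: v)
  case Nil
  have "basis (v, [], w) \<star> d_path (w, ys, u) = (d_path (v, ys, u) :: (_, _, 'k) palg)"
    unfolding d_path_def palg_mult_sum_right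
    by (intro sum.cong)
       (auto split: form.split simp: palg_mult_pscale_right path_mult_def)
  then show ?case by simp
next
  case (Cons x xs)
  have 1: "basis (v, [x], w) \<star> (basis (w, xs, w) \<star> z) = basis (v, x # xs, w) \<star> z"
    for z :: "('v, 'e form, 'k) palg"
    by (simp flip: palg_mult_assoc) (simp add: path_mult_def)
  show ?case
    by (auto simp: d_path_Cons[of v x _ _ w] Cons[of w] palg_mult_simps pscale_add 1 koszul_add
        palg_mult_assoc path_mult_def split: form.split)
qed

text \<open>The map \<open>d\<close> is a derivation of bidegree \<open>(0, 1)\<close> vanishing on the trivial paths.\<close>

lemma d_form_leibniz:
  fixes x y :: "('v, 'e form, 'k::comm_ring_1) palg"
  assumes "\<And>p. p \<in> Poly_Mapping.keys x \<Longrightarrow> sum_list (map dif_count (path_word p)) = n"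
  shows "d_form (x \<star> y) = d_form x \<star> y + pscale (koszul n) (x \<star> d_form y)"
proof -
  have *: "d_form (basis p \<star> basis q) = d_form (basis p) \<star> basis q +
      pscale (koszul (sum_list (map dif_count (path_word p)))) (basis p \<star> (d_form (basis q) :: (_, _, 'k) palg))" for p q
  proof -
    obtain v xs w where p: "p = (v, xs, w)" by (cases p)
    obtain w' ys u where q: "q = (w', ys, u)" by (cases q)
    show ?thesis
    proof (cases "w = w'")
      case True then show ?thesis by (simp add: p q path_mult_def d_path_append[of v xs ys u w])
    next
      case False
      have "d_path (v, xs, w) \<star> basis (w', ys, u) = (0 :: (_, _, 'k) palg)"
        "basis (v, xs, w) \<star> d_path (w', ys, u) = (0 :: (_, _, 'k) palg)"
        using False unfolding d_path_def palg_mult_sum_left palg_mult_sum_right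
        by (auto intro!: sum.neutral split: form.split simp: palg_mult_simps path_mult_def)
      then show ?thesis using False by (simp add: p q path_mult_def)
    qed
  qed
  have *: "d_form (basis p \<star> y) = d_form (basis p) \<star> y +
      pscale (koszul (sum_list (map dif_count (path_word p)))) (basis p \<star> d_form y)" for p
    using subset_UNIV[of "Poly_Mapping.keys y"]
    by (induction y rule: palg_induct)
       (simp_all add: palg_mult_simps d_form_add d_form_pscale * pscale_add algebra_simps del: d_form_basis palg_mult_basis)
  have "Poly_Mapping.keys x \<subseteq> {p. sum_list (map dif_count (path_word p)) = n}"
    using assms by auto
  then show ?thesis
    by (induction x rule: palg_induct)
       (simp_all add: palg_mult_simps d_form_add d_form_pscale * pscale_add algebra_simps del: d_form_basis)
qed

lemma d_function_form_leibniz: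
  "d_form (function_form (x \<star> y)) =
     d_form (function_form x) \<star> function_form y + function_form x \<star> d_form (function_form y)"
proof -
  have "Poly_Mapping.keys (function_form x) \<subseteq> {p. sum_list (map dif_count (path_word p)) = 0}"
    unfolding relabel_def by (intro keys_lin) (auto simp: basis_def comp_def)
  then have "sum_list (map dif_count (path_word p)) = 0" if "p \<in> Poly_Mapping.keys (function_form x)" for p
    using that by auto
  from d_form_leibniz[OF this, of "function_form x"] show ?thesis
    by (simp add: relabel_mult)
qed

lemma d_vertex_algebra: 
  assumes "x \<in> vertex_algebra Q" shows "d_form (function_form x) = 0"
  using assms unfolding vertex_algebra_def mem_Collect_eq
  by (induction x rule: palg_induct)
     (auto simp: relabel_add relabel_pscale d_form_add d_form_pscale)

text \<open>The \<open>A\<close>-bimodule \<open>\<Omega>\<^sup>1\<^sub>R A\<close>, as the part of form degree \<open>1\<close>.\<close>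

definition one_forms :: "('v, 'e) pre_digraph \<Rightarrow> ('v, 'e form, 'k::comm_ring_1) palg set" where
  "one_forms Q = {\<alpha> \<in> path_algebra (form_quiver Q).
     \<forall>p\<in>Poly_Mapping.keys \<alpha>. sum_list (map dif_count (path_word p)) = 1}"

definition one_form_word :: "('v, 'e) pre_digraph \<Rightarrow> ('v, 'e form) path \<Rightarrow> bool" where
  "one_form_word Q p \<longleftrightarrow> (\<exists>v ys x zs u. p = (v, map Fn ys @ Dif x # map Fn zs, u) \<and>
     (v, ys, head Q x) \<in> paths Q \<and> x \<in> arcs Q \<and> (tail Q x, zs, u) \<in> paths Q)"

lemma dif_count_nonneg: "0 \<le> sum_list (map dif_count xs)"
proof (induction xs)
  case (Cons x xs) then show ?case by (cases x) auto
qed simp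

lemma dif_count_0: "sum_list (map dif_count xs) = 0 \<Longrightarrow> \<exists>zs. xs = map Fn zs"
proof (induction xs)
  case (Cons x xs)
  show ?case
  proof (cases x)
    case (Fn y)
    then obtain zs where "xs = map Fn zs" using Cons by auto
    then have "x # xs = map Fn (y # zs)" using Fn by simp
    then show ?thesis by (rule exI)
  next
    case (Dif y) then show ?thesis using Cons.prems dif_count_nonneg[of xs] by simp
  qed
qed simp

lemma dif_count_1: "sum_list (map dif_count xs) = 1 \<Longrightarrow> \<exists>ys x zs. xs = map Fn ys @ Dif x # map Fn zs"
proof (induction xs)
  case (Cons x xs)
  show ?case
  proof (cases x)
    case (Fn y)
    then obtain ys z zs where "xs = map Fn ys @ Dif z # map Fn zs" using Cons by auto
    then have "x # xs = map Fn (y # ys) @ Dif z # map Fn zs" using Fn by simp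
    then show ?thesis by blast
  next
    case (Dif y)
    then obtain zs where "xs = map Fn zs" using Cons.prems dif_count_0[of xs] by auto
    then have "x # xs = map Fn [] @ Dif y # map Fn zs" using Dif by simp
    then show ?thesis by blast
  qed
qed simp

lemma paths_form_word:
  assumes "wf_digraph Q"
  shows "(v, map Fn ys @ Dif x # map Fn zs, u) \<in> paths (form_quiver Q) \<longleftrightarrow>
     (v, ys, head Q x) \<in> paths Q \<and> x \<in> arcs Q \<and> (tail Q x, zs, u) \<in> paths Q"
  by (auto simp: paths_form_quiver[OF assms] comp_def paths_append[OF assms] paths_Cons[OF assms])

lemma one_forms_iff:
  assumes "wf_digraph Q"
  shows "\<alpha> \<in> one_forms Q \<longleftrightarrow> Poly_Mapping.keys \<alpha> \<subseteq> Collect (one_form_word Q)"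
proof -
  have "p \<in> paths (form_quiver Q) \<and> sum_list (map dif_count (path_word p)) = 1 \<longleftrightarrow> one_form_word Q p" for p
  proof
    assume a: "p \<in> paths (form_quiver Q) \<and> sum_list (map dif_count (path_word p)) = 1"
    obtain v xs u where p: "p = (v, xs, u)" by (cases p)
    from a p dif_count_1[of xs] obtain ys x zs where "xs = map Fn ys @ Dif x # map Fn zs" by auto
    then show "one_form_word Q p" using a p paths_form_word[OF assms] unfolding one_form_word_def by blast
  next
    assume "one_form_word Q p"
    then show "p \<in> paths (form_quiver Q) \<and> sum_list (map dif_count (path_word p)) = 1"
      by (auto simp: one_form_word_def paths_form_word[OF assms] comp_def)
  qed
  then have "{p \<in> paths (form_quiver Q). sum_list (map dif_count (path_word p)) = 1} = Collect (one_form_word Q)"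
    by (intro Collect_cong)
  then show ?thesis unfolding one_forms_def path_algebra_def by blast
qed

lemma one_forms_0 [simp]: "0 \<in> one_forms Q" by (simp add: one_forms_def)

lemma one_forms_add:
  assumes "wf_digraph Q" shows "\<alpha> \<in> one_forms Q \<Longrightarrow> \<beta> \<in> one_forms Q \<Longrightarrow> \<alpha> + \<beta> \<in> one_forms Q"
  using Poly_Mapping.keys_add[of \<alpha> \<beta>] by (auto simp: one_forms_iff[OF assms])

lemma one_forms_pscale:
  assumes "wf_digraph Q" shows "\<alpha> \<in> one_forms Q \<Longrightarrow> pscale c \<alpha> \<in> one_forms Q"
  using keys_pscale[of c \<alpha>] by (auto simp: one_forms_iff[OF assms])

lemma one_forms_basis:
  assumes "wf_digraph Q" shows "one_form_word Q p \<Longrightarrow> basis p \<in> one_forms Q"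
  by (auto simp: one_forms_iff[OF assms] basis_def)

lemma one_forms_mult:
  fixes \<alpha> :: "('v, 'e form, 'k::comm_ring_1) palg"
  assumes wf: "wf_digraph Q" and x: "x \<in> path_algebra Q" and \<alpha>: "\<alpha> \<in> one_forms Q"
  shows "function_form x \<star> \<alpha> \<in> one_forms Q" "\<alpha> \<star> function_form x \<in> one_forms Q"
proof -
  let ?d = "\<lambda>p::('v, 'e form) path. sum_list (map dif_count (path_word p))"
  have x': "function_form x \<in> path_algebra (form_quiver Q)" by (rule function_form_in[OF wf x])
  have fk: "Poly_Mapping.keys (function_form x) \<subseteq> {p. ?d p = 0}"
    unfolding relabel_def by (intro keys_lin) (auto simp: basis_def comp_def)
  have wf': "wf_digraph (form_quiver Q)" using wf by (auto simp: wf_digraph_def)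
  have ak: "Poly_Mapping.keys \<alpha> \<subseteq> {p. ?d p = 1}" "\<alpha> \<in> path_algebra (form_quiver Q)"
    using \<alpha> by (auto simp: one_forms_def)
  have pm: "Poly_Mapping.keys (path_mult p q :: (_,_,'k) palg) \<subseteq> {r. ?d r = 1}" if "?d p + ?d q = 1" for p q
    using that by (auto simp: path_mult_def basis_def)
  have "Poly_Mapping.keys (function_form x \<star> \<alpha>) \<subseteq> {p. ?d p = 1}"
    unfolding palg_mult_def by (intro keys_lin pm) (use fk ak in force)
  then show "function_form x \<star> \<alpha> \<in> one_forms Q"
    using path_algebra_mult[OF wf' x' ak(2)] by (auto simp: one_forms_def)
  have "Poly_Mapping.keys (\<alpha> \<star> function_form x) \<subseteq> {p. ?d p = 1}"
    unfolding palg_mult_def by (intro keys_lin pm) (use fk ak in force)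
  then show "\<alpha> \<star> function_form x \<in> one_forms Q"
    using path_algebra_mult[OF wf' ak(2) x'] by (auto simp: one_forms_def)
qed

lemma d_arrow_eq: "d_arrow Q x = basis (head Q x, [Dif x], tail Q x)"
  by (simp add: arrow_def d_path_def)

lemma function_form_arrow: "function_form (arrow Q x) = basis (head Q x, [Fn x], tail Q x)"
  by (simp add: arrow_def)

lemma arrow_in: "wf_digraph Q \<Longrightarrow> x \<in> arcs Q \<Longrightarrow> arrow Q x \<in> path_algebra Q"
  unfolding arrow_def by (intro path_algebra_basis) (auto simp: paths_single)

lemma d_arrow_in: "wf_digraph Q \<Longrightarrow> x \<in> arcs Q \<Longrightarrow> d_arrow Q x \<in> one_forms Q"
  unfolding d_arrow_eq by (intro one_forms_basis)
    (auto simp: one_form_word_def paths_Nil wf_digraph.tail_in_verts wf_digraph.head_in_verts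
      intro!: exI[of _ "[]"])

lemma basis_Cons: "basis (head Q x, x # xs, u) = arrow Q x \<star> basis (tail Q x, xs, u)"
  by (simp add: arrow_def path_mult_def)

lemma d_function_form_in:
  fixes x :: "('v, 'e, 'k::comm_ring_1) palg"
  assumes wf: "wf_digraph Q" and x: "x \<in> path_algebra Q"
  shows "d_form (function_form x) \<in> one_forms Q"
proof -
  have *: "d_form (function_form (basis (v, xs, u) :: (_, _, 'k) palg)) \<in> one_forms Q" if "(v, xs, u) \<in> paths Q" for v xs u
    using that
  proof (induction xs arbitrary: v)
    case (Cons x xs)
    then have x: "x \<in> arcs Q" "v = head Q x" "(tail Q x, xs, u) \<in> paths Q"
      by (auto simp: paths_Cons[OF wf])
    show ?case unfolding x(2) basis_Cons d_function_form_leibniz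
      using Cons.IH[OF x(3)] x(1)
      by (intro one_forms_add one_forms_mult wf d_arrow_in arrow_in path_algebra_basis x(3))
  qed simp
  show ?thesis using x unfolding path_algebra_def mem_Collect_eq
    by (induction x rule: palg_induct)
       (use * in \<open>auto simp: relabel_add relabel_pscale d_form_add d_form_pscale
          simp del: d_form_basis relabel_basis intro: one_forms_add[OF wf] one_forms_pscale[OF wf]\<close>)
qed


text \<open>Bimodules over the path algebra on which the ground field acts symmetrically.\<close>

definition path_bimodule ::
  "('v, 'e) pre_digraph \<Rightarrow> (('v, 'e, 'k::comm_ring_1) palg \<Rightarrow> 'm::ab_group_add \<Rightarrow> 'm) \<Rightarrow>
   ('m \<Rightarrow> ('v, 'e, 'k) palg \<Rightarrow> 'm) \<Rightarrow> bool" where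
  "path_bimodule Q l r \<longleftrightarrow>
     (\<forall>x\<in>path_algebra Q. \<forall>y\<in>path_algebra Q. \<forall>m n.
        l x (m + n) = l x m + l x n \<and> l (x + y) m = l x m + l y m \<and> l (x \<star> y) m = l x (l y m) \<and>
        r (m + n) x = r m x + r n x \<and> r m (x + y) = r m x + r m y \<and> r m (x \<star> y) = r (r m x) y \<and>
        l x (r m y) = r (l x m) y) \<and>
     (\<forall>m. l (palg_one Q) m = m \<and> r m (palg_one Q) = m) \<and>
     (\<forall>c m. l (pscale c (palg_one Q)) m = r m (pscale c (palg_one Q)))"

lemma keys_one: "Poly_Mapping.keys (palg_one Q) \<subseteq> (\<lambda>v. (v, [], v)) ` verts Q"
  unfolding palg_one_def by (intro keys_sum_subset) (auto simp: basis_def)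

text \<open>The derivation \<open>d : A \<rightarrow> \<Omega>\<^sup>1\<^sub>R A\<close> is universal among the \<open>R\<close>-linear derivations
  of \<open>A\<close> into a bimodule.\<close>

theorem forms1_universal:
  fixes Q :: "('v, 'e) pre_digraph"
    and l :: "('v, 'e, 'k::comm_ring_1) palg \<Rightarrow> 'm::ab_group_add \<Rightarrow> 'm"
    and \<delta> :: "('v, 'e, 'k) palg \<Rightarrow> 'm"
  assumes fin: "fin_digraph Q" and bim: "path_bimodule Q l r"
    and \<delta>_add: "\<And>x y. x \<in> path_algebra Q \<Longrightarrow> y \<in> path_algebra Q \<Longrightarrow> \<delta> (x + y) = \<delta> x + \<delta> y"
    and \<delta>_mult: "\<And>x y. x \<in> path_algebra Q \<Longrightarrow> y \<in> path_algebra Q \<Longrightarrow>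
        \<delta> (x \<star> y) = r (\<delta> x) y + l x (\<delta> y)"
    and \<delta>_vertex: "\<And>x. x \<in> vertex_algebra Q \<Longrightarrow> \<delta> x = 0"
  shows "\<exists>!f. f \<in> extensional (one_forms Q) \<and>
     (\<forall>\<alpha>\<in>one_forms Q. \<forall>\<beta>\<in>one_forms Q. f (\<alpha> + \<beta>) = f \<alpha> + f \<beta>) \<and>
     (\<forall>x\<in>path_algebra Q. \<forall>\<alpha>\<in>one_forms Q.
        f (function_form x \<star> \<alpha>) = l x (f \<alpha>) \<and> f (\<alpha> \<star> function_form x) = r (f \<alpha>) x) \<and>
     (\<forall>x\<in>path_algebra Q. f (d_form (function_form x)) = \<delta> x)"
    (is "\<exists>!f. ?P f")
proof -
  let ?A = "path_algebra Q :: ('v, 'e, 'k) palg set"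
  have wf: "wf_digraph Q" using fin by (simp add: fin_digraph_def)
  note A_closed = path_algebra_add path_algebra_pscale path_algebra_mult[OF wf] palg_one_in
  have B: "l x (m + n) = l x m + l x n" "l (x + y) m = l x m + l y m" "l (x \<star> y) m = l x (l y m)"
       "r (m + n) x = r m x + r n x" "r m (x + y) = r m x + r m y" "r m (x \<star> y) = r (r m x) y"
       "l x (r m y) = r (l x m) y" "l (palg_one Q) m = m" "r m (palg_one Q) = m"
       "l (pscale c (palg_one Q)) m = r m (pscale c (palg_one Q))"
    if "x \<in> ?A" "y \<in> ?A" for x y m n c
    using bim that unfolding path_bimodule_def by blast+
  have l0: "l x 0 = 0" "l 0 m = 0" "r 0 x = 0" "r m 0 = 0" if "x \<in> ?A" for x m
    using B(1)[OF that that, of 0 0] B(2)[of 0 0 m] B(4)[OF that that, of 0 0] B(5)[of 0 0 m] by auto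
  have sc_in: "pscale c (palg_one Q) \<in> ?A" for c
    by (intro path_algebra_pscale palg_one_in)
  have scl: "l (pscale c x) m = l (pscale c (palg_one Q)) (l x m)" if "x \<in> ?A" for c x m
  proof -
    have "pscale c x = pscale c (palg_one Q) \<star> x"
      by (simp add: palg_mult_simps palg_one_left[OF fin that])
    then show ?thesis using B(3) that A_closed by metis
  qed
  have scr: "r m (pscale c x) = l (pscale c (palg_one Q)) (r m x)" if "x \<in> ?A" for c x m
  proof -
    have "pscale c x = pscale c (palg_one Q) \<star> x"
      by (simp add: palg_mult_simps palg_one_left[OF fin that])
    then have "r m (pscale c x) = r (r m (pscale c (palg_one Q))) x" using B(6) that A_closed by metis
    also have "\<dots> = r (l (pscale c (palg_one Q)) m) x" using B(10)[OF that that] by simp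
    finally show ?thesis using B(7) that A_closed by metis
  qed
  have \<delta>_scale: "\<delta> (pscale c x) = l (pscale c (palg_one Q)) (\<delta> x)" if "x \<in> ?A" for c x
  proof -
    have "pscale c (palg_one Q :: ('v,'e,'k) palg) \<in> vertex_algebra Q"
      using keys_one[of Q] keys_pscale[of c "palg_one Q"] by (auto simp: vertex_algebra_def)
    then have "\<delta> (pscale c (palg_one Q)) = 0" by (rule \<delta>_vertex)
    moreover have "pscale c x = pscale c (palg_one Q) \<star> x"
      by (simp add: palg_mult_simps palg_one_left[OF fin that])
    ultimately show ?thesis using \<delta>_mult[OF path_algebra_pscale[OF palg_one_in] that, of c] l0[OF that] by simp
  qed

  define pre post :: "'e form list \<Rightarrow> 'e list" and mid :: "'e form list \<Rightarrow> 'e" where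
    "pre xs = map form_arrow (takeWhile (\<lambda>y. dif_count y = 0) xs)"
    and "post xs = map form_arrow (tl (dropWhile (\<lambda>y. dif_count y = 0) xs))"
    and "mid xs = form_arrow (hd (dropWhile (\<lambda>y. dif_count y = 0) xs))" for xs
  have word: "pre (map Fn ys @ Dif x # map Fn zs) = ys" "post (map Fn ys @ Dif x # map Fn zs) = zs"
     "mid (map Fn ys @ Dif x # map Fn zs) = x" for ys x zs
    by (auto simp: pre_def post_def mid_def takeWhile_append dropWhile_append comp_def)
  define g :: "('v, 'e form) path \<Rightarrow> 'm" where
    "g = (\<lambda>(v, xs, u). l (basis (v, pre xs, head Q (mid xs)))
            (r (\<delta> (arrow Q (mid xs))) (basis (tail Q (mid xs), post xs, u))))"
  have g: "g (v, map Fn ys @ Dif x # map Fn zs, u) =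
      l (basis (v, ys, head Q x)) (r (\<delta> (arrow Q x)) (basis (tail Q x, zs, u)))" for v ys x zs u
    by (simp add: g_def word)
  define f where "f = restrict (addext (\<lambda>p c. l (pscale c (palg_one Q)) (g p))) (one_forms Q)"
  have sc_add: "l (pscale (c + c') (palg_one Q)) m = l (pscale c (palg_one Q)) m + l (pscale c' (palg_one Q)) m"
    for c c' m using B(2) A_closed by (metis pscale_left_add)
  have sc0: "l (pscale 0 (palg_one Q)) m = 0" for m using l0(2)[of 0 m] by simp
  have sc_mult: "l (pscale (c * c') (palg_one Q)) m = l (pscale c (palg_one Q)) (l (pscale c' (palg_one Q)) m)"
    for c c' m
  proof -
    have "pscale (c * c') (palg_one Q) = pscale c (palg_one Q) \<star> pscale c' (palg_one Q)"
      by (simp add: palg_mult_simps palg_one_left[OF fin palg_one_in] mult.commute)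
    then show ?thesis using B(3) A_closed by metis
  qed
  have f_add: "f (\<alpha> + \<beta>) = f \<alpha> + f \<beta>" if "\<alpha> \<in> one_forms Q" "\<beta> \<in> one_forms Q" for \<alpha> \<beta>
    using that one_forms_add[OF wf that] unfolding f_def restrict_apply
    by (simp add: addext_add sc_add)
  have f0: "f 0 = 0" using f_add[of 0 0] by simp
  have f_basis: "f (pscale c (basis p)) = l (pscale c (palg_one Q)) (g p)" if "one_form_word Q p" for c p
    using one_forms_pscale[OF wf one_forms_basis[OF wf that], of c] unfolding f_def restrict_apply
    using addext_single[of "\<lambda>p c. l (pscale c (palg_one Q)) (g p)" p c, OF sc0]
    by (simp add: basis_def flip: single_eq_pscale)
  have f_basis1: "f (basis p) = g p" if "one_form_word Q p" for p
    using f_basis[OF that, of 1] B(8)[of 0 0] by simp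
  have f_scale: "f (pscale c \<alpha>) = l (pscale c (palg_one Q)) (f \<alpha>)" if "\<alpha> \<in> one_forms Q" for c \<alpha>
    using that unfolding one_forms_iff[OF wf]
  proof (induction \<alpha> rule: palg_induct)
    case zero show ?case using f0 l0(1)[OF sc_in] by simp
  next
    case (scale c' p) then show ?case by (simp add: f_basis sc_mult)
  next
    case (add y z)
    then have "y \<in> one_forms Q" "z \<in> one_forms Q" by (auto simp: one_forms_iff[OF wf])
    then show ?case using add(3,4) B(1)[OF sc_in sc_in]
      by (simp add: pscale_add f_add one_forms_pscale[OF wf])
  qed
  have sc_comm: "l x (l (pscale c (palg_one Q)) m) = l (pscale c (palg_one Q)) (l x m)"
    "r (l (pscale c (palg_one Q)) m) x = l (pscale c (palg_one Q)) (r m x)" if "x \<in> ?A" for x c m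
  proof -
    have "l x (l (pscale c (palg_one Q)) m) = l (x \<star> pscale c (palg_one Q)) m"
      using B(3) that A_closed by metis
    also have "x \<star> pscale c (palg_one Q) = pscale c x"
      by (simp add: palg_mult_simps palg_one_right[OF fin that])
    finally show "l x (l (pscale c (palg_one Q)) m) = l (pscale c (palg_one Q)) (l x m)"
      using scl[OF that] by simp
    show "r (l (pscale c (palg_one Q)) m) x = l (pscale c (palg_one Q)) (r m x)"
      using B(7) that A_closed by metis
  qed
  have b_in: "basis p \<in> ?A" if "p \<in> paths Q" for p by (rule path_algebra_basis[OF that])
  have fl_basis: "f (function_form (basis p) \<star> basis w) = l (basis p) (g w)"
    if p: "p \<in> paths Q" and w: "one_form_word Q w" for p w
  proof -
    obtain v' as t where pe: "p = (v', as, t)" by (cases p)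
    obtain v ys x zs u where we: "w = (v, map Fn ys @ Dif x # map Fn zs, u)"
      and wp: "(v, ys, head Q x) \<in> paths Q" "x \<in> arcs Q" "(tail Q x, zs, u) \<in> paths Q"
      using w unfolding one_form_word_def by blast
    have ll: "l (basis p) (g w) = l (path_mult p (v, ys, head Q x)) (r (\<delta> (arrow Q x)) (basis (tail Q x, zs, u)))"
      unfolding we g using B(3)[OF b_in[OF p] b_in[OF wp(1)]] by simp
    show ?thesis
    proof (cases "t = v")
      case True
      have "(v', as @ ys, head Q x) \<in> paths Q" using p wp True pe paths_append[OF wf] by blast
      then have ow: "one_form_word Q (v', map Fn (as @ ys) @ Dif x # map Fn zs, u)"
        using wp unfolding one_form_word_def by blast
      have e: "function_form (basis p) \<star> basis w = basis (v', map Fn (as @ ys) @ Dif x # map Fn zs, u)"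
        using True by (simp add: pe we path_mult_def)
      show ?thesis unfolding e f_basis1[OF ow] g ll using True by (simp add: pe path_mult_def)
    next
      case False
      then show ?thesis unfolding ll using l0(2)[of 0] by (simp add: pe we path_mult_def f0)
    qed
  qed
  have fr_basis: "f (basis w \<star> function_form (basis p)) = r (g w) (basis p)"
    if p: "p \<in> paths Q" and w: "one_form_word Q w" for p w
  proof -
    obtain t as u' where pe: "p = (t, as, u')" by (cases p)
    obtain v ys x zs u where we: "w = (v, map Fn ys @ Dif x # map Fn zs, u)"
      and wp: "(v, ys, head Q x) \<in> paths Q" "x \<in> arcs Q" "(tail Q x, zs, u) \<in> paths Q"
      using w unfolding one_form_word_def by blast
    have ll: "r (g w) (basis p) = l (basis (v, ys, head Q x)) (r (\<delta> (arrow Q x)) (path_mult (tail Q x, zs, u) p))"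
      unfolding we g using B(6)[OF b_in[OF wp(3)] b_in[OF p]] B(7)[OF b_in[OF wp(1)] b_in[OF p]] by simp
    show ?thesis
    proof (cases "t = u")
      case True
      have "(tail Q x, zs @ as, u') \<in> paths Q" using p wp True pe paths_append[OF wf] by blast
      then have ow: "one_form_word Q (v, map Fn ys @ Dif x # map Fn (zs @ as), u')"
        using wp unfolding one_form_word_def by blast
      have e: "basis w \<star> function_form (basis p) = basis (v, map Fn ys @ Dif x # map Fn (zs @ as), u')"
        using True by (simp add: pe we path_mult_def)
      show ?thesis unfolding e f_basis1[OF ow] g ll using True by (simp add: pe path_mult_def)
    next
      case False
      then show ?thesis unfolding ll using l0(4)[of 0] l0(1)[OF b_in[OF wp(1)]]
        by (auto simp: pe we path_mult_def f0)
    qed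
  qed
  have fl: "f (function_form x \<star> \<alpha>) = l x (f \<alpha>)" if x: "x \<in> ?A" and \<alpha>: "\<alpha> \<in> one_forms Q" for x \<alpha>
  proof -
    have *: "f (function_form (basis p) \<star> \<alpha>) = l (basis p) (f \<alpha>)" if p: "p \<in> paths Q" for p
      using \<alpha> unfolding one_forms_iff[OF wf]
    proof (induction \<alpha> rule: palg_induct)
      case zero then show ?case using l0(1)[OF b_in[OF p]] by (simp add: f0)
    next
      case (scale c w)
      then have w: "one_form_word Q w" by simp
      have "function_form (basis p :: (_, _, 'k) palg) \<star> basis w \<in> one_forms Q"
        by (intro one_forms_mult wf b_in p one_forms_basis w)
      then show ?case
        using fl_basis[OF p w] sc_comm(1)[OF b_in[OF p]]
        by (simp add: palg_mult_pscale_right f_scale f_basis[OF w] del: palg_mult_basis relabel_basis)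
    next
      case (add y z)
      then have yz: "y \<in> one_forms Q" "z \<in> one_forms Q" by (auto simp: one_forms_iff[OF wf])
      then show ?case using add(3,4) B(1)[OF b_in[OF p] b_in[OF p]] one_forms_mult(1)[OF wf b_in[OF p]]
        by (simp add: palg_mult_add_right f_add del: relabel_basis)
    qed
    show ?thesis using x unfolding path_algebra_def mem_Collect_eq
    proof (induction x rule: palg_induct)
      case zero then show ?case using l0(2)[of 0] by (simp add: f0)
    next
      case (scale c p)
      then show ?case using *[OF scale] scl[OF b_in[OF scale]] one_forms_mult(1)[OF wf b_in[OF scale] \<alpha>]
        by (simp add: relabel_pscale palg_mult_pscale_left f_scale del: relabel_basis)
    next
      case (add y z)
      then have yz: "y \<in> ?A" "z \<in> ?A" by (auto simp: path_algebra_def)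
      show ?case using add(3,4) B(2)[OF yz] one_forms_mult(1)[OF wf yz(1) \<alpha>] one_forms_mult(1)[OF wf yz(2) \<alpha>]
        by (simp add: relabel_add palg_mult_add_left f_add)
    qed
  qed
  have fr: "f (\<alpha> \<star> function_form x) = r (f \<alpha>) x" if x: "x \<in> ?A" and \<alpha>: "\<alpha> \<in> one_forms Q" for x \<alpha>
  proof -
    have *: "f (\<alpha> \<star> function_form (basis p)) = r (f \<alpha>) (basis p)" if p: "p \<in> paths Q" for p
      using \<alpha> unfolding one_forms_iff[OF wf]
    proof (induction \<alpha> rule: palg_induct)
      case zero then show ?case using l0(3)[OF b_in[OF p]] by (simp add: f0)
    next
      case (scale c w)
      then have w: "one_form_word Q w" by simp
      have "basis w \<star> function_form (basis p :: (_, _, 'k) palg) \<in> one_forms Q"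
        by (intro one_forms_mult wf b_in p one_forms_basis w)
      then show ?case
        using fr_basis[OF p w] sc_comm(2)[OF b_in[OF p]]
        by (simp add: palg_mult_pscale_left f_scale f_basis[OF w] del: palg_mult_basis relabel_basis)
    next
      case (add y z)
      then have yz: "y \<in> one_forms Q" "z \<in> one_forms Q" by (auto simp: one_forms_iff[OF wf])
      then show ?case using add(3,4) B(4)[OF b_in[OF p] b_in[OF p]] one_forms_mult(2)[OF wf b_in[OF p]]
        by (simp add: palg_mult_add_left f_add del: relabel_basis)
    qed
    show ?thesis using x unfolding path_algebra_def mem_Collect_eq
    proof (induction x rule: palg_induct)
      case zero then show ?case using l0(4)[of 0] by (simp add: f0)
    next
      case (scale c p)
      then show ?case using *[OF scale] scr[OF b_in[OF scale]] one_forms_mult(2)[OF wf b_in[OF scale] \<alpha>]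
        by (simp add: relabel_pscale palg_mult_pscale_right f_scale del: relabel_basis)
    next
      case (add y z)
      then have yz: "y \<in> ?A" "z \<in> ?A" by (auto simp: path_algebra_def)
      show ?case using add(3,4) B(5)[OF yz] one_forms_mult(2)[OF wf yz(1) \<alpha>] one_forms_mult(2)[OF wf yz(2) \<alpha>]
        by (simp add: relabel_add palg_mult_add_right f_add)
    qed
  qed
  have fd_arrow: "f (d_arrow Q x) = \<delta> (arrow Q x)" if x: "x \<in> arcs Q" for x
  proof -
    have hv: "(head Q x, [], head Q x) \<in> paths Q" "(tail Q x, [], tail Q x) \<in> paths Q"
      using x wf by (auto simp: paths_Nil wf_digraph.tail_in_verts wf_digraph.head_in_verts)
    have ow: "one_form_word Q (head Q x, map Fn [] @ Dif x # map Fn [], tail Q x)"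
      unfolding one_form_word_def using x hv by blast
    have "f (d_arrow Q x) = g (head Q x, map Fn [] @ Dif x # map Fn [], tail Q x)"
      using f_basis1[OF ow] unfolding d_arrow_eq by simp
    also have "\<dots> = l (basis (head Q x, [], head Q x)) (r (\<delta> (arrow Q x)) (basis (tail Q x, [], tail Q x)))"
      by (rule g)
    also have "\<dots> = \<delta> (arrow Q x)"
    proof -
      have va: "basis (head Q x, [], head Q x) \<in> (vertex_algebra Q :: ('v, 'e, 'k) palg set)"
        "basis (tail Q x, [], tail Q x) \<in> (vertex_algebra Q :: ('v, 'e, 'k) palg set)"
        using hv by (auto simp: vertex_algebra_def basis_def paths_Nil)
      have e: "(arrow Q x :: (_, _, 'k) palg) = basis (head Q x, [], head Q x) \<star> (arrow Q x \<star> basis (tail Q x, [], tail Q x))"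
        by (simp add: arrow_def path_mult_def)
      have a: "arrow Q x \<in> ?A" by (rule arrow_in[OF wf x])
      have "\<delta> (arrow Q x \<star> basis (tail Q x, [], tail Q x)) = r (\<delta> (arrow Q x)) (basis (tail Q x, [], tail Q x))"
        using \<delta>_mult[OF a b_in[OF hv(2)]] \<delta>_vertex[OF va(2)] l0(1)[OF a] by simp
      then show ?thesis
        using \<delta>_mult[OF b_in[OF hv(1)], of "arrow Q x \<star> basis (tail Q x, [], tail Q x)"]
          \<delta>_vertex[OF va(1)] l0(3) path_algebra_mult[OF wf a b_in[OF hv(2)]] by (simp flip: e)
    qed
    finally show ?thesis .
  qed
  have fd_basis: "f (d_form (function_form (basis (v, xs, u)))) = \<delta> (basis (v, xs, u))"
    if "(v, xs, u) \<in> paths Q" for v xs u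
    using that
  proof (induction xs arbitrary: v)
    case Nil
    then have "basis (v, [], u) \<in> (vertex_algebra Q :: ('v, 'e, 'k) palg set)"
      by (auto simp: vertex_algebra_def basis_def paths_Nil)
    then show ?case using \<delta>_vertex by (simp add: f0)
  next
    case (Cons x xs)
    then have x: "x \<in> arcs Q" "v = head Q x" "(tail Q x, xs, u) \<in> paths Q"
      by (auto simp: paths_Cons[OF wf])
    have a: "arrow Q x \<in> ?A" by (rule arrow_in[OF wf x(1)])
    have o1: "d_arrow Q x \<in> (one_forms Q :: ('v, 'e form, 'k) palg set)" by (rule d_arrow_in[OF wf x(1)])
    have o2: "d_form (function_form (basis (tail Q x, xs, u) :: (_, _, 'k) palg)) \<in> one_forms Q"
      by (rule d_function_form_in[OF wf b_in[OF x(3)]])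
    show ?case unfolding x(2) basis_Cons d_function_form_leibniz
      by (simp only: f_add one_forms_mult[OF wf _ o1] one_forms_mult[OF wf _ o2] a b_in[OF x(3)]
          fl[OF a o2] fr[OF b_in[OF x(3)] o1] Cons.IH[OF x(3)] fd_arrow[OF x(1)] \<delta>_mult)
  qed
  have fd: "f (d_form (function_form x)) = \<delta> x" if x: "x \<in> ?A" for x
    using x unfolding path_algebra_def mem_Collect_eq
  proof (induction x rule: palg_induct)
    case zero
    have "\<delta> 0 = 0" by (rule \<delta>_vertex) (simp add: vertex_algebra_def)
    then show ?case by (simp add: f0)
  next
    case (scale c p)
    then show ?case using fd_basis[of "fst p" "fst (snd p)" "snd (snd p)"]
        d_function_form_in[OF wf b_in[OF scale]] \<delta>_scale[OF b_in[OF scale]]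
      by (simp add: relabel_pscale d_form_pscale f_scale del: d_form_basis relabel_basis)
  next
    case (add y z)
    then have yz: "y \<in> ?A" "z \<in> ?A" by (auto simp: path_algebra_def)
    show ?case using add(3,4) \<delta>_add[OF yz] d_function_form_in[OF wf yz(1)] d_function_form_in[OF wf yz(2)]
      by (simp add: relabel_add d_form_add f_add)
  qed
  have Pf: "?P f"
    using f_add fl fr fd by (auto simp: f_def)
  moreover have "h = f" if h: "?P h" for h
  proof (rule extensionalityI[of _ "one_forms Q"])
    show "h \<in> extensional (one_forms Q)" using h by blast
    show "f \<in> extensional (one_forms Q)" by (simp add: f_def)
    have h_add: "h (\<alpha> + \<beta>) = h \<alpha> + h \<beta>" if "\<alpha> \<in> one_forms Q" "\<beta> \<in> one_forms Q" for \<alpha> \<beta>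
      using h that by blast
    have h0: "h 0 = 0" using h_add[of 0 0] by simp
    fix \<alpha> :: "('v, 'e form, 'k) palg" assume "\<alpha> \<in> one_forms Q"
    then show "h \<alpha> = f \<alpha>" unfolding one_forms_iff[OF wf]
    proof (induction \<alpha> rule: palg_induct)
      case zero show ?case by (simp add: h0 f0)
    next
      case (add y z)
      then have "y \<in> one_forms Q" "z \<in> one_forms Q" by (auto simp: one_forms_iff[OF wf])
      then show ?case using add by (simp add: h_add f_add)
    next
      case (scale c w)
      then obtain v ys x zs u where we: "w = (v, map Fn ys @ Dif x # map Fn zs, u)"
        and wp: "(v, ys, head Q x) \<in> paths Q" "x \<in> arcs Q" "(tail Q x, zs, u) \<in> paths Q"
        unfolding one_form_word_def by blast
      have e: "pscale c (basis w) = function_form (pscale c (basis (v, ys, head Q x))) \<star>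
          (d_arrow Q x \<star> function_form (basis (tail Q x, zs, u)))"
        unfolding d_arrow_eq by (simp add: we path_mult_def relabel_pscale palg_mult_simps)
      have o1: "d_arrow Q x \<in> (one_forms Q :: ('v, 'e form, 'k) palg set)" by (rule d_arrow_in[OF wf wp(2)])
      have o2: "d_arrow Q x \<star> function_form (basis (tail Q x, zs, u)) \<in> (one_forms Q :: ('v, 'e form, 'k) palg set)"
        by (rule one_forms_mult(2)[OF wf b_in[OF wp(3)] o1])
      have i: "pscale c (basis (v, ys, head Q x)) \<in> ?A" by (rule path_algebra_pscale[OF b_in[OF wp(1)]])
      have u: "k (pscale c (basis w)) = l (pscale c (basis (v, ys, head Q x))) (r (\<delta> (arrow Q x)) (basis (tail Q x, zs, u)))"
        if k: "?P k" for k
      proof -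
        have "k (pscale c (basis w)) = l (pscale c (basis (v, ys, head Q x)))
           (k (d_arrow Q x \<star> function_form (basis (tail Q x, zs, u))))"
          unfolding e using k i o2 by blast
        also have "k (d_arrow Q x \<star> function_form (basis (tail Q x, zs, u))) =
            r (k (d_arrow Q x)) (basis (tail Q x, zs, u))"
          using k o1 b_in[OF wp(3)] by blast
        also have "k (d_arrow Q x) = \<delta> (arrow Q x)"
          using k arrow_in[OF wf wp(2)] by blast
        finally show ?thesis .
      qed
      show ?case using u[OF h] u[OF Pf] by simp
    qed
  qed
  ultimately show ?thesis by (rule ex1I)
qed


lemma relabel_sum: "relabel f (\<Sum>i\<in>I. g i) = (\<Sum>i\<in>I. relabel f (g i))"
  by (simp add: relabel_def lin_sum)

lemma function_form_one: "function_form (palg_one Q) = palg_one (form_quiver Q)"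
  by (simp add: palg_one_def relabel_sum)

text \<open>The algebra of forms has the universal property of the tensor algebra \<open>T\<^sub>A \<Omega>\<^sup>1\<^sub>R A\<close>.\<close>

theorem forms_universal:
  fixes Q :: "('v, 'e) pre_digraph"
    and \<psi>0 :: "('v, 'e, 'k::comm_ring_1) palg \<Rightarrow> 'c::ring_1"
    and \<psi>1 :: "('v, 'e form, 'k) palg \<Rightarrow> 'c"
  assumes fin: "fin_digraph Q"
    and add0: "\<And>x y. x \<in> path_algebra Q \<Longrightarrow> y \<in> path_algebra Q \<Longrightarrow> \<psi>0 (x + y) = \<psi>0 x + \<psi>0 y"
    and mult0: "\<And>x y. x \<in> path_algebra Q \<Longrightarrow> y \<in> path_algebra Q \<Longrightarrow> \<psi>0 (x \<star> y) = \<psi>0 x * \<psi>0 y"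
    and one0: "\<psi>0 (palg_one Q) = 1"
    and add1: "\<And>\<alpha> \<beta>. \<alpha> \<in> one_forms Q \<Longrightarrow> \<beta> \<in> one_forms Q \<Longrightarrow> \<psi>1 (\<alpha> + \<beta>) = \<psi>1 \<alpha> + \<psi>1 \<beta>"
    and left1: "\<And>x \<alpha>. x \<in> path_algebra Q \<Longrightarrow> \<alpha> \<in> one_forms Q \<Longrightarrow>
        \<psi>1 (function_form x \<star> \<alpha>) = \<psi>0 x * \<psi>1 \<alpha>"
    and right1: "\<And>x \<alpha>. x \<in> path_algebra Q \<Longrightarrow> \<alpha> \<in> one_forms Q \<Longrightarrow>
        \<psi>1 (\<alpha> \<star> function_form x) = \<psi>1 \<alpha> * \<psi>0 x"
  shows "\<exists>!\<Psi>. \<Psi> \<in> extensional (path_algebra (form_quiver Q)) \<and>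
     (\<forall>\<alpha>\<in>path_algebra (form_quiver Q). \<forall>\<beta>\<in>path_algebra (form_quiver Q).
        \<Psi> (\<alpha> + \<beta>) = \<Psi> \<alpha> + \<Psi> \<beta> \<and> \<Psi> (\<alpha> \<star> \<beta>) = \<Psi> \<alpha> * \<Psi> \<beta>) \<and>
     (\<forall>x\<in>path_algebra Q. \<Psi> (function_form x) = \<psi>0 x) \<and>
     (\<forall>\<alpha>\<in>one_forms Q. \<Psi> \<alpha> = \<psi>1 \<alpha>)"
    (is "\<exists>!\<Psi>. ?P \<Psi>")
proof -
  let ?A = "path_algebra Q :: ('v, 'e, 'k) palg set"
  let ?W = "path_algebra (form_quiver Q) :: ('v, 'e form, 'k) palg set"
  have wf: "wf_digraph Q" using fin by (simp add: fin_digraph_def)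
  have finF: "fin_digraph (form_quiver Q)" by (rule fin_digraph_form_quiver[OF fin])
  have wfF: "wf_digraph (form_quiver Q)" using finF by (simp add: fin_digraph_def)
  have b_in: "basis p \<in> ?A" if "p \<in> paths Q" for p by (rule path_algebra_basis[OF that])
  have bF_in: "basis p \<in> ?W" if "p \<in> paths (form_quiver Q)" for p by (rule path_algebra_basis[OF that])
  have z0: "\<psi>0 0 = 0" using add0[of 0 0] by simp
  have z1: "\<psi>1 0 = 0" using add1[of 0 0] by simp
  have vin: "basis (v, [], v) \<in> ?A" if "v \<in> verts Q" for v
    using that by (intro b_in) (simp add: paths_Nil)
  have ht: "head Q x \<in> verts Q" "tail Q x \<in> verts Q" if "x \<in> arcs Q" for x
    using that wf by (auto simp: wf_digraph.tail_in_verts wf_digraph.head_in_verts)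

  define sc where "sc c = \<psi>0 (pscale c (palg_one Q))" for c
  have sc_in: "pscale c (palg_one Q) \<in> ?A" for c
    by (intro path_algebra_pscale palg_one_in)
  have sc_add: "sc (c + c') = sc c + sc c'" for c c'
    using add0[OF sc_in sc_in] by (simp add: sc_def pscale_left_add)
  have sc_0: "sc 0 = 0" by (simp add: sc_def z0)
  have sc_1: "sc 1 = 1" by (simp add: sc_def one0)
  have sc0: "\<psi>0 (pscale c x) = sc c * \<psi>0 x" "\<psi>0 (pscale c x) = \<psi>0 x * sc c" if "x \<in> ?A" for c x
    using mult0[OF sc_in that, of c] mult0[OF that sc_in, of c]
    by (simp_all add: sc_def palg_mult_simps palg_one_left[OF fin that] palg_one_right[OF fin that])
  have sc_mult: "sc (c * c') = sc c * sc c'" for c c'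
    using sc0(1)[OF sc_in, of c c'] by (simp add: sc_def)
  have oW: "one_forms Q \<subseteq> ?W" by (auto simp: one_forms_def)
  have sc1: "\<psi>1 (pscale c \<alpha>) = sc c * \<psi>1 \<alpha>" "\<psi>1 (pscale c \<alpha>) = \<psi>1 \<alpha> * sc c"
    if "\<alpha> \<in> one_forms Q" for c \<alpha>
    using left1[OF sc_in that, of c] right1[OF sc_in that, of c] subsetD[OF oW that]
    by (simp_all add: sc_def palg_mult_simps relabel_pscale function_form_one
        palg_one_left[OF finF] palg_one_right[OF finF])

  define L where "L y = (case y of Fn x \<Rightarrow> \<psi>0 (arrow Q x) | Dif x \<Rightarrow> \<psi>1 (d_arrow Q x))" for y
  define V where "V xs u = foldr (\<lambda>y m. L y * m) xs (\<psi>0 (basis (u, [], u)))" for xs u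
  have V: "V [] u = \<psi>0 (basis (u, [], u))" "V (y # ys) u = L y * V ys u" for y ys u
    by (simp_all add: V_def)
  have L_left: "\<psi>0 (basis (v, [], v)) * L y = (if v = head Q (form_arrow y) then L y else 0)"
    if "v \<in> verts Q" "form_arrow y \<in> arcs Q" for v y
  proof (cases y)
    case (Fn x)
    then show ?thesis using that mult0[OF vin[OF that(1)] arrow_in[OF wf, of x]]
      by (auto simp: L_def arrow_def path_mult_def z0)
  next
    case (Dif x)
    then show ?thesis using that left1[OF vin[OF that(1)] d_arrow_in[OF wf, of x]]
      by (auto simp: L_def d_arrow_eq path_mult_def z1 simp del: relabel_basis)
         (auto simp: L_def d_arrow_eq path_mult_def z1)
  qed
  have V_left: "\<psi>0 (basis (v', [], v')) * V xs u = (if v' = v then V xs u else 0)"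
    if "(v, xs, u) \<in> paths (form_quiver Q)" "v' \<in> verts Q" for v v' xs u
  proof (cases xs)
    case Nil
    then show ?thesis using that mult0[OF vin[OF that(2)] vin[of u]]
      by (auto simp: V paths_Nil path_mult_def z0)
  next
    case (Cons y ys)
    then have "form_arrow y \<in> arcs Q" "v = head Q (form_arrow y)"
      using that(1) by (auto simp: paths_Cons[OF wfF])
    then show ?thesis using L_left[OF that(2)] by (simp add: Cons V flip: mult.assoc)
  qed
  have V_mult: "V xs w * V ys u = (if w = w' then V (xs @ ys) u else 0)"
    if "(v, xs, w) \<in> paths (form_quiver Q)" "(w', ys, u) \<in> paths (form_quiver Q)" for v xs w w' ys u
    using that(1)
  proof (induction xs arbitrary: v)
    case Nil
    then show ?case using V_left[OF that(2), of w] by (auto simp: V paths_Nil)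
  next
    case (Cons x xs)
    then have "(tail (form_quiver Q) x, xs, w) \<in> paths (form_quiver Q)"
      by (auto simp: paths_Cons[OF wfF])
    from Cons.IH[OF this] show ?case by (simp add: V mult.assoc)
  qed
  have L_sc: "L y * sc c = sc c * L y" if "form_arrow y \<in> arcs Q" for y c
  proof (cases y)
    case (Fn x)
    then show ?thesis using that sc0[OF arrow_in[OF wf, of x], of c] by (simp add: L_def)
  next
    case (Dif x)
    then show ?thesis using that sc1[OF d_arrow_in[OF wf, of x], of c] by (simp add: L_def)
  qed
  have V_sc: "V xs u * sc c = sc c * V xs u" if "(v, xs, u) \<in> paths (form_quiver Q)" for v xs u c
    using that
  proof (induction xs arbitrary: v)
    case Nil
    then show ?case using sc0[OF vin[of u], of c] by (simp add: V paths_Nil)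
  next
    case (Cons x xs)
    then have x: "form_arrow x \<in> arcs Q" "(tail (form_quiver Q) x, xs, u) \<in> paths (form_quiver Q)"
      by (auto simp: paths_Cons[OF wfF])
    have "V (x # xs) u * sc c = L x * (sc c * V xs u)" using Cons.IH[OF x(2)] by (simp add: V mult.assoc)
    also have "\<dots> = sc c * V (x # xs) u" using L_sc[OF x(1)] by (simp add: V flip: mult.assoc)
    finally show ?case .
  qed

  define f where "f = restrict (addext (\<lambda>p c. sc c * V (path_word p) (path_tail p))) ?W"
  have f_add: "f (\<alpha> + \<beta>) = f \<alpha> + f \<beta>" if "\<alpha> \<in> ?W" "\<beta> \<in> ?W" for \<alpha> \<beta>
    using that path_algebra_add[OF that] unfolding f_def restrict_apply
    by (simp add: addext_add sc_add distrib_right)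
  have f0: "f 0 = 0" using f_add[of 0 0] by simp
  have f_basis: "f (pscale c (basis (v, xs, u))) = sc c * V xs u"
    if "(v, xs, u) \<in> paths (form_quiver Q)" for c v xs u
    using path_algebra_pscale[OF bF_in[OF that], of c] unfolding f_def restrict_apply
    by (simp add: basis_def flip: single_eq_pscale) (simp add: addext_single sc_0)
  have f_basis1: "f (basis (v, xs, u)) = V xs u" if "(v, xs, u) \<in> paths (form_quiver Q)" for v xs u
    using f_basis[OF that, of 1] by (simp add: sc_1)
  have f_mult_basis: "f (pscale c (basis p) \<star> pscale c' (basis q)) = f (pscale c (basis p)) * f (pscale c' (basis q))"
    if pq: "p \<in> paths (form_quiver Q)" "q \<in> paths (form_quiver Q)" for c p c' q
  proof -
    obtain v xs w where p: "p = (v, xs, w)" by (cases p)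
    obtain w' ys u where q: "q = (w', ys, u)" by (cases q)
    note pq' = pq[unfolded p q]
    have "f (pscale c (basis p)) * f (pscale c' (basis q)) = sc c * (V xs w * sc c') * V ys u"
      by (simp add: p q f_basis[OF pq'(1)] f_basis[OF pq'(2)] mult.assoc)
    also have "\<dots> = sc (c * c') * (V xs w * V ys u)"
      by (simp add: V_sc[OF pq'(1)] sc_mult mult.assoc)
    also have "\<dots> = f (pscale c (basis p) \<star> pscale c' (basis q))"
    proof (cases "w = w'")
      case True
      then have "(v, xs @ ys, u) \<in> paths (form_quiver Q)" using pq' paths_append[OF wfF] by blast
      then show ?thesis using True V_mult[OF pq'] f_basis[of v "xs @ ys" u "c * c'"]
        by (simp add: p q palg_mult_simps path_mult_def mult.commute)
    next
      case False
      then show ?thesis using V_mult[OF pq'] by (simp add: p q palg_mult_simps path_mult_def f0)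
    qed
    finally show ?thesis ..
  qed
  have f_mult: "f (\<alpha> \<star> \<beta>) = f \<alpha> * f \<beta>" if "\<alpha> \<in> ?W" "\<beta> \<in> ?W" for \<alpha> \<beta>
    using that(1) unfolding path_algebra_def mem_Collect_eq
  proof (induction \<alpha> rule: palg_induct)
    case zero then show ?case by (simp add: f0)
  next
    case (add y z)
    then have yz: "y \<in> ?W" "z \<in> ?W" by (auto simp: path_algebra_def)
    then show ?case using add(3,4) that(2)
      by (simp add: palg_mult_add_left f_add path_algebra_mult[OF wfF] distrib_right)
  next
    case (scale c p)
    have pin: "pscale c (basis p) \<in> ?W" by (rule path_algebra_pscale[OF bF_in[OF scale]])
    show ?case using that(2) unfolding path_algebra_def mem_Collect_eq
    proof (induction \<beta> rule: palg_induct)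
      case zero then show ?case by (simp add: f0)
    next
      case (scale c' q) then show ?case by (intro f_mult_basis \<open>p \<in> paths (form_quiver Q)\<close>)
    next
      case (add y z)
      then have yz: "y \<in> ?W" "z \<in> ?W" by (auto simp: path_algebra_def)
      then show ?case using add(3,4) pin
        by (simp add: palg_mult_add_right f_add path_algebra_mult[OF wfF] distrib_left)
    qed
  qed
  have V_fn: "V (map Fn xs) u = \<psi>0 (basis (v, xs, u))" if "(v, xs, u) \<in> paths Q" for v xs u
    using that
  proof (induction xs arbitrary: v)
    case Nil then show ?case by (simp add: V paths_Nil)
  next
    case (Cons x xs)
    then have x: "x \<in> arcs Q" "v = head Q x" "(tail Q x, xs, u) \<in> paths Q"
      by (auto simp: paths_Cons[OF wf])
    show ?case unfolding x(2) basis_Cons mult0[OF arrow_in[OF wf x(1)] b_in[OF x(3)]]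
      using Cons.IH[OF x(3)] by (simp add: V L_def)
  qed
  have f_fn: "f (function_form x) = \<psi>0 x" if "x \<in> ?A" for x
    using that unfolding path_algebra_def mem_Collect_eq
  proof (induction x rule: palg_induct)
    case zero then show ?case by (simp add: f0 z0)
  next
    case (scale c p)
    obtain v xs u where p: "p = (v, xs, u)" by (cases p)
    have "(v, map Fn xs, u) \<in> paths (form_quiver Q)"
      using scale by (simp add: p paths_form_quiver[OF wf] comp_def)
    from f_basis[OF this, of c] show ?case
      using scale V_fn[of v xs u] sc0(1)[OF b_in[OF scale], of c] by (simp add: p relabel_pscale)
  next
    case (add y z)
    then have yz: "y \<in> ?A" "z \<in> ?A" by (auto simp: path_algebra_def)
    then show ?case using add(3,4) by (simp add: relabel_add f_add add0 function_form_in[OF wf])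
  qed
  have V_word: "V (map Fn ys @ Dif x # map Fn zs) u = \<psi>1 (basis (v, map Fn ys @ Dif x # map Fn zs, u))"
    if "(v, ys, head Q x) \<in> paths Q" "x \<in> arcs Q" "(tail Q x, zs, u) \<in> paths Q" for v ys x zs u
    using that(1)
  proof (induction ys arbitrary: v)
    case Nil
    have "basis (head Q x, Dif x # map Fn zs, u) = d_arrow Q x \<star> function_form (basis (tail Q x, zs, u) :: (_, _, 'k) palg)"
      unfolding d_arrow_eq by (simp add: path_mult_def)
    then show ?case using Nil right1[OF b_in[OF that(3)] d_arrow_in[OF wf that(2)]] V_fn[OF that(3)]
      by (simp add: V L_def paths_Nil del: relabel_basis)
  next
    case (Cons y ys)
    then have y: "y \<in> arcs Q" "v = head Q y" "(tail Q y, ys, head Q x) \<in> paths Q"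
      by (auto simp: paths_Cons[OF wf])
    have e: "basis (v, map Fn (y # ys) @ Dif x # map Fn zs, u) =
      function_form (arrow Q y :: (_, _, 'k) palg) \<star> basis (tail Q y, map Fn ys @ Dif x # map Fn zs, u)"
      unfolding function_form_arrow by (simp add: path_mult_def y)
    have "one_form_word Q (tail Q y, map Fn ys @ Dif x # map Fn zs, u)"
      using y(3) that(2,3) unfolding one_form_word_def by blast
    from left1[OF arrow_in[OF wf y(1)] one_forms_basis[OF wf this]]
    show ?case unfolding e using Cons.IH[OF y(3)] by (simp add: V L_def)
  qed
  have f_one: "f \<alpha> = \<psi>1 \<alpha>" if "\<alpha> \<in> one_forms Q" for \<alpha>
    using that unfolding one_forms_iff[OF wf]
  proof (induction \<alpha> rule: palg_induct)
    case zero then show ?case by (simp add: f0 z1)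
  next
    case (scale c w)
    then have ow: "one_form_word Q w" by simp
    then obtain v ys x zs u where we: "w = (v, map Fn ys @ Dif x # map Fn zs, u)"
      and wp: "(v, ys, head Q x) \<in> paths Q" "x \<in> arcs Q" "(tail Q x, zs, u) \<in> paths Q"
      unfolding one_form_word_def by blast
    have "(v, map Fn ys @ Dif x # map Fn zs, u) \<in> paths (form_quiver Q)"
      using wp paths_form_word[OF wf] by blast
    from f_basis[OF this, of c] show ?case
      using V_word[OF wp] sc1(1)[OF one_forms_basis[OF wf ow], of c] by (simp add: we)
  next
    case (add y z)
    then have yz: "y \<in> one_forms Q" "z \<in> one_forms Q" by (auto simp: one_forms_iff[OF wf])
    then have "y \<in> ?W" "z \<in> ?W" using oW by auto
    then show ?case using add(3,4) yz by (simp add: f_add add1)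
  qed
  have Pf: "?P f"
    using f_add f_mult f_fn f_one by (auto simp: f_def)
  moreover have "h = f" if h: "?P h" for h
  proof (rule extensionalityI[of _ ?W])
    show "h \<in> extensional ?W" using h by blast
    show "f \<in> extensional ?W" by (simp add: f_def)
    have h_add: "h (\<alpha> + \<beta>) = h \<alpha> + h \<beta>" "h (\<alpha> \<star> \<beta>) = h \<alpha> * h \<beta>" if "\<alpha> \<in> ?W" "\<beta> \<in> ?W" for \<alpha> \<beta>
      using h that by blast+
    have h_fn: "h (function_form x) = f (function_form x)" if "x \<in> ?A" for x
      using h Pf that by metis
    have h_one: "h \<alpha> = f \<alpha>" if "\<alpha> \<in> one_forms Q" for \<alpha>
      using h Pf that by metis
    have h_basis: "h (basis (v, xs, u)) = f (basis (v, xs, u))"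
      if "(v, xs, u) \<in> paths (form_quiver Q)" for v xs u
      using that
    proof (induction xs arbitrary: v)
      case Nil
      then have "basis (v, [], u) = function_form (basis (v, [], u))" "basis (v, [], u) \<in> ?A"
        using vin by (auto simp: paths_Nil)
      then show ?case using h_fn by metis
    next
      case (Cons y ys)
      then have y: "form_arrow y \<in> arcs Q" "v = head Q (form_arrow y)"
        "(tail Q (form_arrow y), ys, u) \<in> paths (form_quiver Q)"
        by (auto simp: paths_Cons[OF wfF])
      let ?y = "basis (v, [y], tail Q (form_arrow y)) :: ('v, 'e form, 'k) palg"
      have e: "basis (v, y # ys, u) = ?y \<star> basis (tail Q (form_arrow y), ys, u)"
        by (simp add: path_mult_def)
      have "(v, [y], tail Q (form_arrow y)) \<in> paths (form_quiver Q)"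
        using y by (cases y) (auto simp: paths_single[OF wfF])
      then have yin: "?y \<in> ?W" by (rule bF_in)
      have "h ?y = f ?y"
      proof (cases y)
        case (Fn x)
        then show ?thesis using h_fn[OF arrow_in[OF wf, of x]] y unfolding function_form_arrow by simp
      next
        case (Dif x)
        then show ?thesis using h_one[OF d_arrow_in[OF wf, of x]] y unfolding d_arrow_eq by simp
      qed
      then show ?case unfolding e h_add(2)[OF yin bF_in[OF y(3)]] f_mult[OF yin bF_in[OF y(3)]]
        using Cons.IH[OF y(3)] by simp
    qed
    fix \<alpha> :: "('v, 'e form, 'k) palg" assume "\<alpha> \<in> ?W"
    then show "h \<alpha> = f \<alpha>" unfolding path_algebra_def mem_Collect_eq
    proof (induction \<alpha> rule: palg_induct)
      case zero show ?case using h_add(1)[of 0 0] by (simp add: f0)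
    next
      case (add y z)
      then have "y \<in> ?W" "z \<in> ?W" by (auto simp: path_algebra_def)
      then show ?case using add by (simp add: h_add f_add)
    next
      case (scale c p)
      have e: "pscale c (basis p) = function_form (pscale c (palg_one Q)) \<star> basis p"
        by (simp add: relabel_pscale function_form_one palg_mult_pscale_left
            palg_one_left[OF finF bF_in[OF scale]])
      have i: "function_form (pscale c (palg_one Q)) \<in> ?W" by (rule function_form_in[OF wf sc_in])
      show ?case unfolding e h_add(2)[OF i bF_in[OF scale]] f_mult[OF i bF_in[OF scale]]
        using h_fn[OF sc_in, of c] h_basis[of "fst p" "fst (snd p)" "snd (snd p)"] scale by simp
    qed
  qed
  ultimately show ?thesis by (rule ex1I)
qed

end

theory Submission
  imports Defs
begin

text \<open>A double derivation of a path algebra is freely determined by its values on the arrows, so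
  \<open>H\<^sub>x\<close> can be read off from \<open>dx\<close>: its value on an arrow is a signed sum over the occurrences of
  the dual arrow in \<open>x\<close>. For \<open>S = S\<^sub>0 + \<phi>\<close>, with \<open>\<phi>\<close> a path of weight \<open>3\<close> in the arrows
  \<open>a\<close> and \<open>\<^bold>a = Hat a\<close>, the derivation \<open>\<delta> = m \<circ> H\<^sub>S\<close> sends \<open>a\<close> to \<open>\<^bold>a\<close> and \<open>\<^bold>a\<close> to \<open>0\<close>, while
  \<open>\<Sum> \<delta>(a\<^sup>*) \<^bold>a\<close> is a sum of cyclic rotations of the terms of \<open>\<delta>(\<phi>)\<close>. Hence \<open>{S, S}\<close> equals
  \<open>2 \<delta>(\<phi>)\<close> up to graded commutators. Finally \<open>\<^bold>a \<leftrightarrow> da\<close> turns \<open>\<delta>(\<phi>)\<close> into the exterior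
  derivative of the form; it exchanges weight and form degree, in which the sign rule is symmetric,
  and therefore preserves graded commutators.\<close>

text \<open>\<open>contraction2\<close> and \<open>hamiltonian\<close> are definite descriptions, so
  every computation with the bracket rests on existence and uniqueness proofs. Forms on a path
  algebra are again a path algebra, hence both descriptions reduce to one freeness statement, used
  for A and for its forms. There a value on an arrow has to lie in the corner given by head and tail
  of that arrow, which is what linearity over R amounts to.

  The two halves of {S, S} might as well cancel: each rotation costs a Koszul sign, and it is the
  oddness of the total weight 3 that makes the halves add up.

  The exchange of \<open>Hat a\<close> and da does not extend to a bijection of all letters, since
  a* has weight 2 whereas no letter has form degree 2. Letters without a chosen partner are
  therefore sent to 0. The resulting map is still multiplicative, so commutators survive, and it is
  inverse to itself on the words at hand; one map thus gives both directions, although vanishing is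
  tested in the forms on A and not on B.\<close>

section \<open>Linear algebra of finitely supported functions\<close>

text \<open>\<open>commutator_space\<close> is defined by \<open>module.span pscale\<close>; this
  supplies the closure and induction rules of spans.\<close>

interpretation pm: module "pscale :: 'k::comm_ring_1 \<Rightarrow> ('p \<Rightarrow>\<^sub>0 'k) \<Rightarrow> _"
  by unfold_locales (simp_all add: pscale_add pscale_left_add)

lemma lin_single_id: "lin (\<lambda>p. Poly_Mapping.single p 1) t = t"
proof (rule poly_mapping_eqI)
  fix q
  have "Poly_Mapping.lookup (lin (\<lambda>p. Poly_Mapping.single p 1) t) q =
      (\<Sum>p\<in>Poly_Mapping.keys t. if p = q then Poly_Mapping.lookup t q else 0)"
    unfolding lin_def lookup_sum lookup_pscale
    by (intro sum.cong) (auto simp: lookup_single when_def)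
  then show "Poly_Mapping.lookup (lin (\<lambda>p. Poly_Mapping.single p 1) t) q = Poly_Mapping.lookup t q"
    by (auto simp: in_keys_iff)
qed

lemma lin_lin: "lin f (lin g t) = lin (\<lambda>p. lin f (g p)) t"
  unfolding lin_def[of g] lin_sum lin_pscale by (simp add: lin_def)

lemma lin_diff: "lin f (s - t) = lin f s - lin f t"
  using lin_add[of f "s - t" t] by (simp add: algebra_simps)

text \<open>Counterpart of \<open>palg_induct\<close> for arbitrary index types: tensors are indexed
  by pairs of paths.\<close>

lemma pm_induct [case_names zero single add]:
  fixes t :: "'p \<Rightarrow>\<^sub>0 'k::comm_ring_1"
  assumes "P 0" and "\<And>p c. P (pscale c (Poly_Mapping.single p 1))"
    and "\<And>s t. P s \<Longrightarrow> P t \<Longrightarrow> P (s + t)"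
  shows "P t"
proof -
  have "P (\<Sum>p\<in>I. pscale (Poly_Mapping.lookup t p) (Poly_Mapping.single p 1))" if "finite I" for I
    using that by (induction I rule: finite_induct) (auto intro: assms)
  from this[OF finite_keys[of t]] show ?thesis
    using lin_single_id[of t] unfolding lin_def by simp
qed

text \<open>Nothing collides with \<open>h p\<close>, so a coefficient survives a signed renaming of
  basis vectors. Uniqueness of the Hamiltonian derivation is read off in this way.\<close>

lemma lookup_lin_inj:
  assumes "inj_on h (insert p (Poly_Mapping.keys t))"
  shows "Poly_Mapping.lookup (lin (\<lambda>q. pscale (\<sigma> q) (Poly_Mapping.single (h q) 1)) t) (h p)
       = \<sigma> p * Poly_Mapping.lookup t p"
proof -
  have "Poly_Mapping.lookup (lin (\<lambda>q. pscale (\<sigma> q) (Poly_Mapping.single (h q) 1)) t) (h p)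
      = (\<Sum>q\<in>Poly_Mapping.keys t. if q = p then \<sigma> p * Poly_Mapping.lookup t p else 0)"
    unfolding lin_def lookup_sum lookup_pscale
    using assms by (intro sum.cong) (auto simp: lookup_single when_def inj_on_def)
  also have "\<dots> = \<sigma> p * Poly_Mapping.lookup t p"
    by (auto simp: in_keys_iff)
  finally show ?thesis .
qed

lemma koszul_mult_self [simp]: "koszul n * koszul n = 1"
  by (simp add: koszul_def)

lemma koszul_mult_self_left: "koszul n * (koszul n * x) = x"
  by (simp add: koszul_def)


section \<open>The outer bimodule structure\<close>

lemma tensor_basis [simp]: "basis p \<otimes>\<^sub>k basis q = Poly_Mapping.single (p, q) 1"
  by (simp add: tensor_def)

lemma tensor_0 [simp]: "0 \<otimes>\<^sub>k y = 0" "x \<otimes>\<^sub>k 0 = 0"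
  by (simp_all add: tensor_def)

lemma tensor_add: "(x + y) \<otimes>\<^sub>k z = (x \<otimes>\<^sub>k z) + (y \<otimes>\<^sub>k z)" "x \<otimes>\<^sub>k (y + z) = (x \<otimes>\<^sub>k y) + (x \<otimes>\<^sub>k z)"
  by (simp_all add: tensor_def lin_add lin_add_fun)

lemma tensor_pscale: "pscale c x \<otimes>\<^sub>k y = pscale c (x \<otimes>\<^sub>k y)" "x \<otimes>\<^sub>k pscale c y = pscale c (x \<otimes>\<^sub>k y)"
  by (simp_all add: tensor_def lin_pscale lin_pscale_fun)

lemma lin_add_fun_pair:
  "lin (\<lambda>(p, q). f p q + g p q) t = lin (\<lambda>(p, q). f p q) t + lin (\<lambda>(p, q). g p q) t"
  by (simp add: case_prod_unfold lin_add_fun)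

lemma lin_pscale_fun_pair: "lin (\<lambda>(p, q). pscale c (f p q)) t = pscale c (lin (\<lambda>(p, q). f p q) t)"
  by (simp add: case_prod_unfold lin_pscale_fun)

lemma outer_left_add:
  "outer_left (a + b) t = outer_left a t + outer_left b t"
  "outer_left a (s + t) = outer_left a s + outer_left a t"
  by (simp_all add: outer_left_def palg_mult_simps tensor_add lin_add_fun_pair lin_add)

lemma outer_left_pscale:
  "outer_left (pscale c a) t = pscale c (outer_left a t)"
  "outer_left a (pscale c t) = pscale c (outer_left a t)"
  by (simp_all add: outer_left_def palg_mult_simps tensor_pscale lin_pscale_fun_pair lin_pscale)

lemma outer_right_add:
  "outer_right t (a + b) = outer_right t a + outer_right t b"
  "outer_right (s + t) a = outer_right s a + outer_right t a"
  by (simp_all add: outer_right_def palg_mult_simps tensor_add lin_add_fun_pair lin_add)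

lemma outer_right_pscale:
  "outer_right t (pscale c a) = pscale c (outer_right t a)"
  "outer_right (pscale c t) a = pscale c (outer_right t a)"
  by (simp_all add: outer_right_def palg_mult_simps tensor_pscale lin_pscale_fun_pair lin_pscale)

lemma outer_0 [simp]: "outer_left 0 t = 0" "outer_left a 0 = 0" "outer_right t 0 = 0" "outer_right 0 a = 0"
  using outer_left_pscale[of 0] outer_right_pscale[of _ 0] by (auto simp: outer_left_def outer_right_def case_prod_unfold)

lemma outer_left_single:
  "outer_left (basis r) (Poly_Mapping.single (p, q) 1) =
     (if path_tail r = path_head p
      then Poly_Mapping.single ((path_head r, path_word r @ path_word p, path_tail p), q) 1 else 0)"
  by (simp add: outer_left_def path_mult_def)

lemma outer_right_single:
  "outer_right (Poly_Mapping.single (p, q) 1) (basis r) =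
     (if path_tail q = path_head r
      then Poly_Mapping.single (p, (path_head q, path_word q @ path_word r, path_tail r)) 1 else 0)"
  by (simp add: outer_right_def path_mult_def)

lemma mult2_single: "mult2 (Poly_Mapping.single (p, q) 1) = path_mult p q"
  by (simp add: mult2_def)

lemma mult2_add: "mult2 (s + t) = mult2 s + mult2 t"
  by (simp add: mult2_def lin_add)

lemma mult2_pscale: "mult2 (pscale c t) = pscale c (mult2 t)"
  by (simp add: mult2_def lin_pscale)

lemma mult2_0 [simp]: "mult2 0 = 0"
  by (simp add: mult2_def)

lemma mult2_sum: "mult2 (\<Sum>i\<in>I. f i) = (\<Sum>i\<in>I. mult2 (f i))"
  by (simp add: mult2_def lin_sum)

lemma relabel2_single:
  "relabel2 f (Poly_Mapping.single (p, q) 1) =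
     Poly_Mapping.single ((path_head p, map f (path_word p), path_tail p),
       (path_head q, map f (path_word q), path_tail q)) 1"
  by (simp add: relabel2_def)

lemma relabel2_add: "relabel2 f (s + t) = relabel2 f s + relabel2 f t"
  by (simp add: relabel2_def lin_add)

lemma relabel2_pscale: "relabel2 f (pscale c t) = pscale c (relabel2 f t)"
  by (simp add: relabel2_def lin_pscale)

lemma relabel2_0 [simp]: "relabel2 f 0 = 0"
  by (simp add: relabel2_def)

lemmas outer_linear = outer_left_add outer_left_pscale outer_right_add outer_right_pscale
  palg_mult_simps mult2_add mult2_pscale relabel2_add relabel2_pscale relabel_add relabel_pscale

lemma basis_single: "Poly_Mapping.single p (1::'k::comm_ring_1) = (basis p)" for p :: "('v, 'e) path"
  by (simp add: basis_def)

lemma outer_left_mult: "outer_left (a \<star> b) t = outer_left a (outer_left b t)"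
proof (induction t rule: pm_induct)
  case t: (single pq c)
  obtain p q where pq [simp]: "pq = (p, q)" by (cases pq)
  show ?case
  proof (induction a rule: pm_induct)
    case a: (single r d)
    show ?case
      by (induction b rule: pm_induct)
        (auto simp: outer_linear pscale_add mult_ac outer_left_single basis_single path_mult_def)
  qed (auto simp: outer_linear pscale_add)
qed (auto simp: outer_linear pscale_add)

lemma outer_right_mult: "outer_right t (a \<star> b) = outer_right (outer_right t a) b"
proof (induction t rule: pm_induct)
  case t: (single pq c)
  obtain p q where pq [simp]: "pq = (p, q)" by (cases pq)
  show ?case
  proof (induction a rule: pm_induct)
    case a: (single r d)
    show ?case
      by (induction b rule: pm_induct)
        (auto simp: outer_linear pscale_add mult_ac outer_right_single basis_single path_mult_def)
  qed (auto simp: outer_linear pscale_add)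
qed (auto simp: outer_linear pscale_add)

lemma outer_left_right: "outer_left a (outer_right t b) = outer_right (outer_left a t) b"
proof (induction t rule: pm_induct)
  case t: (single pq c)
  obtain p q where pq [simp]: "pq = (p, q)" by (cases pq)
  show ?case
  proof (induction a rule: pm_induct)
    case a: (single r d)
    show ?case
      by (induction b rule: pm_induct)
        (auto simp: outer_linear pscale_add mult_ac outer_left_single outer_right_single basis_single)
  qed (auto simp: outer_linear pscale_add)
qed (auto simp: outer_linear pscale_add)

lemma mult2_outer_left: "mult2 (outer_left a t) = a \<star> mult2 t"
proof (induction t rule: pm_induct)
  case t: (single pq c)
  obtain p q where pq [simp]: "pq = (p, q)" by (cases pq)
  show ?case
    by (induction a rule: pm_induct)
      (auto simp: outer_linear pscale_add mult_ac outer_left_single basis_single mult2_single path_mult_def)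
qed (auto simp: outer_linear pscale_add)

lemma mult2_outer_right: "mult2 (outer_right t a) = mult2 t \<star> a"
proof (induction t rule: pm_induct)
  case t: (single pq c)
  obtain p q where pq [simp]: "pq = (p, q)" by (cases pq)
  show ?case
    by (induction a rule: pm_induct)
      (auto simp: outer_linear pscale_add mult_ac outer_right_single basis_single mult2_single path_mult_def)
qed (auto simp: outer_linear pscale_add)

lemma relabel2_outer_left: "relabel2 f (outer_left a t) = outer_left (relabel f a) (relabel2 f t)"
proof (induction t rule: pm_induct)
  case t: (single pq c)
  obtain p q where pq [simp]: "pq = (p, q)" by (cases pq)
  show ?case
    by (induction a rule: pm_induct)
      (auto simp: outer_linear pscale_add mult_ac outer_left_single basis_single relabel2_single)
qed (auto simp: outer_linear pscale_add)

lemma relabel2_outer_right: "relabel2 f (outer_right t a) = outer_right (relabel2 f t) (relabel f a)"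
proof (induction t rule: pm_induct)
  case t: (single pq c)
  obtain p q where pq [simp]: "pq = (p, q)" by (cases pq)
  show ?case
    by (induction a rule: pm_induct)
      (auto simp: outer_linear pscale_add mult_ac outer_right_single basis_single relabel2_single)
qed (auto simp: outer_linear pscale_add)

text \<open>The index set of the bihomogeneous part of \<open>e\<^sub>v A \<otimes> A e\<^sub>u\<close>.\<close>

definition corners :: "('v, 'e) bigraded_quiver \<Rightarrow> 'v \<Rightarrow> 'v \<Rightarrow> int \<Rightarrow> int \<Rightarrow> (('v, 'e) path \<times> ('v, 'e) path) set" where
  "corners G v u i j = {(p, q). p \<in> paths (quiver G) \<and> q \<in> paths (quiver G) \<and>
     path_head p = v \<and> path_tail q = u \<and> path_weight G p + path_weight G q = i \<and>
     path_form_degree G p + path_form_degree G q = j}"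

lemma outer_left_corners:
  assumes "wf_digraph (quiver G)" "Poly_Mapping.keys t \<subseteq> corners G w u i j" "(v, xs, w) \<in> paths (quiver G)"
  shows "Poly_Mapping.keys (outer_left (basis (v, xs, w)) t) \<subseteq>
     corners G v u (sum_list (map (weight G) xs) + i) (sum_list (map (form_degree G) xs) + j)"
  unfolding outer_left_def
  using assms(2,3) paths_append[OF assms(1), of v xs]
  by (intro keys_lin) (auto simp: corners_def path_mult_def path_weight_def path_form_degree_def dest!: subsetD)

lemma outer_right_corners:
  assumes "wf_digraph (quiver G)" "Poly_Mapping.keys t \<subseteq> corners G v w i j" "(w, xs, u) \<in> paths (quiver G)"
  shows "Poly_Mapping.keys (outer_right t (basis (w, xs, u))) \<subseteq>
     corners G v u (i + sum_list (map (weight G) xs)) (j + sum_list (map (form_degree G) xs))"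
  unfolding outer_right_def
  using assms(2,3) paths_append[OF assms(1), of _ _ xs u]
  by (intro keys_lin) (fastforce simp: corners_def path_mult_def path_weight_def path_form_degree_def dest!: subsetD)

text \<open>All left tensor factors start from the same vertex w on their head side, so a path with
  another tail annihilates them and the trivial path at w acts as a unit.\<close>

lemma outer_left_idem:
  assumes "Poly_Mapping.keys t \<subseteq> corners G w u i j"
  shows "outer_left (basis (v, xs, w')) t = (if w' = w then outer_left (basis (v, xs, w)) t else 0)"
    and "outer_left (basis (w, [], w)) t = t"
proof -
  have h: "path_head p = w" if "(p, q) \<in> Poly_Mapping.keys t" for p q
    using that assms by (auto simp: corners_def)
  show "outer_left (basis (v, xs, w')) t = (if w' = w then outer_left (basis (v, xs, w)) t else 0)"
    using h unfolding outer_left_def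
    by (auto simp: lin_def path_mult_def intro!: sum.neutral)
  have "outer_left (basis (w, [], w)) t = lin (\<lambda>p. Poly_Mapping.single p 1) t"
    unfolding outer_left_def using h
    by (intro lin_cong) (auto simp: path_mult_def basis_single)
  then show "outer_left (basis (w, [], w)) t = t" by (simp add: lin_single_id)
qed

lemma outer_right_idem:
  assumes "Poly_Mapping.keys t \<subseteq> corners G v w i j"
  shows "w' \<noteq> w \<Longrightarrow> outer_right t (basis (w', xs, u)) = 0"
    and "outer_right t (basis (w, [], w)) = t"
proof -
  have h: "path_tail q = w" if "(p, q) \<in> Poly_Mapping.keys t" for p q
    using that assms by (auto simp: corners_def)
  show "w' \<noteq> w \<Longrightarrow> outer_right t (basis (w', xs, u)) = 0"
    using h unfolding outer_right_def
    by (auto simp: lin_def path_mult_def intro!: sum.neutral)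
  have "outer_right t (basis (w, [], w)) = lin (\<lambda>p. Poly_Mapping.single p 1) t"
    unfolding outer_right_def using h
    by (intro lin_cong) (auto simp: path_mult_def basis_single)
  then show "outer_right t (basis (w, [], w)) = t" by (simp add: lin_single_id)
qed


section \<open>Double derivations of path algebras\<close>

abbreviation bisign :: "('v, 'e) bigraded_quiver \<Rightarrow> int \<Rightarrow> int \<Rightarrow> 'e list \<Rightarrow> 'k::comm_ring_1" where
  "bisign G m n xs \<equiv> koszul (m * sum_list (map (weight G) xs) + n * sum_list (map (form_degree G) xs))"

text \<open>The graded Leibniz rule unrolled from the leftmost letter. Words satisfy no relations,
  so the unrolled rule can serve as a definition. The tail u is carried along because an empty word
  does not know its vertex.\<close>

primrec derivation_word ::
  "('v, 'e) bigraded_quiver \<Rightarrow> int \<Rightarrow> int \<Rightarrow> ('e \<Rightarrow> ('v, 'e, 'k::comm_ring_1) palg2) \<Rightarrow>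
   'e list \<Rightarrow> 'v \<Rightarrow> ('v, 'e, 'k) palg2" where
  "derivation_word G m n \<theta> [] u = 0"
| "derivation_word G m n \<theta> (x # xs) u =
     outer_right (\<theta> x) (basis (tail (quiver G) x, xs, u)) +
     pscale (bisign G m n [x]) (outer_left (arrow (quiver G) x) (derivation_word G m n \<theta> xs u))"

definition derivation_ext ::
  "('v, 'e) bigraded_quiver \<Rightarrow> int \<Rightarrow> int \<Rightarrow> ('e \<Rightarrow> ('v, 'e, 'k::comm_ring_1) palg2) \<Rightarrow>
   ('v, 'e, 'k) palg \<Rightarrow> ('v, 'e, 'k) palg2" where
  "derivation_ext G m n \<theta> =
     restrict (lin (\<lambda>(v, xs, u). derivation_word G m n \<theta> xs u)) (path_algebra (quiver G))"

lemma corners_paths: "corners G v u i j \<subseteq> paths (quiver G) \<times> paths (quiver G)"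
  by (auto simp: corners_def)

lemma keys_add_subset:
  "Poly_Mapping.keys s \<subseteq> K \<Longrightarrow> Poly_Mapping.keys t \<subseteq> K \<Longrightarrow> Poly_Mapping.keys (s + t) \<subseteq> K"
  using Poly_Mapping.keys_add[of s t] by blast

lemma derivation_word_corners:
  assumes wf: "wf_digraph (quiver G)"
    and \<theta>: "\<And>x. x \<in> arcs (quiver G) \<Longrightarrow> Poly_Mapping.keys (\<theta> x) \<subseteq>
        corners G (head (quiver G) x) (tail (quiver G) x) (weight G x + m) (form_degree G x + n)"
  shows "(v, xs, u) \<in> paths (quiver G) \<Longrightarrow> Poly_Mapping.keys (derivation_word G m n \<theta> xs u) \<subseteq>
     corners G v u (sum_list (map (weight G) xs) + m) (sum_list (map (form_degree G) xs) + n)"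
proof (induction xs arbitrary: v)
  case (Cons x xs)
  then have x: "x \<in> arcs (quiver G)" "v = head (quiver G) x" "(tail (quiver G) x, xs, u) \<in> paths (quiver G)"
    by (auto simp: paths_Cons[OF wf])
  have "Poly_Mapping.keys (outer_right (\<theta> x) (basis (tail (quiver G) x, xs, u))) \<subseteq>
      corners G v u (sum_list (map (weight G) (x # xs)) + m) (sum_list (map (form_degree G) (x # xs)) + n)"
    using outer_right_corners[OF wf \<theta>[OF x(1)] x(3)] by (simp add: x(2) algebra_simps)
  moreover have "Poly_Mapping.keys (outer_left (arrow (quiver G) x) (derivation_word G m n \<theta> xs u)) \<subseteq>
      corners G v u (sum_list (map (weight G) (x # xs)) + m) (sum_list (map (form_degree G) (x # xs)) + n)"
    using outer_left_corners[OF wf Cons.IH[OF x(3)], of v "[x]"] x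
    by (simp add: arrow_def paths_single[OF wf] algebra_simps)
  ultimately show ?case
    unfolding derivation_word.simps by (intro keys_add_subset order.trans[OF keys_pscale])
qed simp

text \<open>The recursion only cuts a word after its first letter; here the cut is moved letter by
  letter to any position. The signs multiply because \<open>koszul\<close> is multiplicative, and
  the left and right outer actions commute.\<close>

lemma derivation_word_append:
  assumes wf: "wf_digraph (quiver G)"
    and \<theta>: "\<And>x. x \<in> arcs (quiver G) \<Longrightarrow> Poly_Mapping.keys (\<theta> x) \<subseteq>
        corners G (head (quiver G) x) (tail (quiver G) x) (weight G x + m) (form_degree G x + n)"
    and ys: "(w, ys, u) \<in> paths (quiver G)"
  shows "(v, xs, w) \<in> paths (quiver G) \<Longrightarrow>
     derivation_word G m n \<theta> (xs @ ys) u =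
       outer_right (derivation_word G m n \<theta> xs w) (basis (w, ys, u)) +
       pscale (bisign G m n xs) (outer_left (basis (v, xs, w)) (derivation_word G m n \<theta> ys u))"
proof (induction xs arbitrary: v)
  case Nil
  then show ?case
    using outer_left_idem(2)[OF derivation_word_corners[OF wf \<theta> ys]] by (simp add: paths_Nil)
next
  case (Cons x xs)
  then have x: "x \<in> arcs (quiver G)" "v = head (quiver G) x" "(tail (quiver G) x, xs, w) \<in> paths (quiver G)"
    by (auto simp: paths_Cons[OF wf])
  have b: "basis (tail (quiver G) x, xs @ ys, u) = basis (tail (quiver G) x, xs, w) \<star> basis (w, ys, u)"
    by (simp add: path_mult_def)
  show ?case
    unfolding append_Cons derivation_word.simps Cons.IH[OF x(3)] b x(2) basis_Cons
    by (simp add: outer_right_mult outer_left_mult outer_linear pscale_add outer_left_right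
        koszul_add distrib_left mult_ac del: palg_mult_basis)
qed

lemma keys_lin_subset:
  assumes "Poly_Mapping.keys x \<subseteq> S" and "\<And>p. p \<in> S \<Longrightarrow> Poly_Mapping.keys (f p) \<subseteq> T"
  shows "Poly_Mapping.keys (lin f x) \<subseteq> T"
  using assms by (intro keys_lin) blast

text \<open>Existence half of freeness. The corner condition on the values is also necessary, by
  \<open>double_derivation_arrow_corners\<close>.\<close>

lemma derivation_ext_double_derivation:
  fixes \<theta> :: "'e \<Rightarrow> ('v, 'e, 'k::comm_ring_1) palg2"
  assumes wf: "wf_digraph (quiver G)"
    and \<theta>: "\<And>x. x \<in> arcs (quiver G) \<Longrightarrow> Poly_Mapping.keys (\<theta> x) \<subseteq>
        corners G (head (quiver G) x) (tail (quiver G) x) (weight G x + m) (form_degree G x + n)"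
  shows "derivation_ext G m n \<theta> \<in> double_derivations G m n"
proof -
  let ?A = "path_algebra (quiver G) :: ('v, 'e, 'k) palg set"
  define D :: "('v, 'e) path \<Rightarrow> ('v, 'e, 'k) palg2" where "D = (\<lambda>(v, xs, u). derivation_word G m n \<theta> xs u)"
  have Dp: "Poly_Mapping.keys (D p) \<subseteq> corners G (path_head p) (path_tail p) (path_weight G p + m) (path_form_degree G p + n)"
    if "p \<in> paths (quiver G)" for p
    using that derivation_word_corners[OF wf \<theta>] by (cases p) (simp add: D_def path_weight_def path_form_degree_def)
  have ext: "derivation_ext G m n \<theta> x = lin D x" if "x \<in> ?A" for x
    using that by (simp add: derivation_ext_def D_def)
  have hA: "homogeneous G i j \<subseteq> ?A" for i j by (auto simp: homogeneous_def)
  have in2: "lin D x \<in> path_algebra2 (quiver G)" if "x \<in> ?A" for x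
    using that unfolding path_algebra2_def path_algebra_def mem_Collect_eq
    by (elim keys_lin_subset) (rule order.trans[OF Dp corners_paths])
  have vert: "lin D r = 0" if "r \<in> vertex_algebra (quiver G)" for r
    using that unfolding lin_def vertex_algebra_def by (auto simp: D_def intro!: sum.neutral)
  have hom: "lin D x \<in> homogeneous2 G (i + m) (j + n)" if "x \<in> homogeneous G i j" for i j x
  proof -
    have "Poly_Mapping.keys (lin D x) \<subseteq> {(p, q). path_weight G p + path_weight G q = i + m \<and>
           path_form_degree G p + path_form_degree G q = j + n}"
    proof (intro keys_lin order.trans[OF Dp])
      fix p assume "p \<in> Poly_Mapping.keys x"
      then show "p \<in> paths (quiver G)"
        "corners G (path_head p) (path_tail p) (path_weight G p + m) (path_form_degree G p + n) \<subseteq>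
         {(p, q). path_weight G p + path_weight G q = i + m \<and> path_form_degree G p + path_form_degree G q = j + n}"
        using that by (auto simp: homogeneous_def path_algebra_def corners_def)
    qed
    then show ?thesis using in2[OF subsetD[OF hA that]] by (auto simp: homogeneous2_def)
  qed
  have basis_leibniz: "lin D (basis p \<star> basis q) = outer_right (D p) (basis q) +
      pscale (koszul (m * path_weight G p + n * path_form_degree G p)) (outer_left (basis p) (D q))"
    if p: "p \<in> paths (quiver G)" and q: "q \<in> paths (quiver G)" for p q
  proof -
    obtain v xs w where pe: "p = (v, xs, w)" by (cases p)
    obtain w' ys u where qe: "q = (w', ys, u)" by (cases q)
    show ?thesis
    proof (cases "w = w'")
      case True
      then show ?thesis
        using derivation_word_append[OF wf \<theta>, where v=v and w=w and xs=xs and ys=ys and u=u] p q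
        by (simp add: pe qe path_mult_def D_def path_weight_def path_form_degree_def)
    next
      \<comment> \<open>The product of non-composable paths is 0, so both Leibniz terms have to
        vanish. They do because \<open>D p\<close> and \<open>D q\<close> lie in the corners of p
        and q.\<close>
      case False
      then show ?thesis
        using outer_left_idem(1)[OF Dp[OF q], of v xs w] outer_right_idem(1)[OF Dp[OF p], of w' ys u]
        by (simp add: pe qe path_mult_def)
    qed
  qed
  have leibniz: "lin D (x \<star> y) = outer_right (lin D x) y + pscale (koszul (m * i + n * j)) (outer_left x (lin D y))"
    if x: "x \<in> homogeneous G i j" and y: "y \<in> ?A" for i j x y
  proof -
    have *: "lin D (basis p \<star> y) = outer_right (D p) y + pscale (koszul (m * i + n * j)) (outer_left (basis p) (lin D y))"
      if "p \<in> paths (quiver G)" "path_weight G p = i" "path_form_degree G p = j" for p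
      using y unfolding path_algebra_def mem_Collect_eq
    proof (induction y rule: palg_induct)
      case (scale c q)
      then show ?case using that
        by (simp add: outer_linear lin_pscale basis_leibniz pscale_add mult_ac del: palg_mult_basis)
    qed (simp_all add: outer_linear lin_add pscale_add)
    have "Poly_Mapping.keys x \<subseteq> {p \<in> paths (quiver G). path_weight G p = i \<and> path_form_degree G p = j}"
      using x by (auto simp: homogeneous_def path_algebra_def)
    then show ?thesis
    proof (induction x rule: palg_induct)
      case (scale c p)
      then show ?case using *[of p] by (simp add: outer_linear lin_pscale pscale_add mult_ac)
    qed (simp_all add: outer_linear lin_add pscale_add)
  qed
  have vA: "vertex_algebra (quiver G) \<subseteq> ?A"
    unfolding vertex_algebra_def path_algebra_def by (force simp: paths_Nil)
  show ?thesis
    unfolding double_derivations_def mem_Collect_eq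
  proof (intro conjI ballI allI)
    show "derivation_ext G m n \<theta> \<in> ?A \<rightarrow>\<^sub>E path_algebra2 (quiver G)"
      using in2 by (auto simp: ext PiE_iff) (simp add: derivation_ext_def)
  next
    fix x y :: "('v, 'e, 'k) palg" assume "x \<in> ?A" "y \<in> ?A"
    then show "derivation_ext G m n \<theta> (x + y) = derivation_ext G m n \<theta> x + derivation_ext G m n \<theta> y"
      by (simp add: ext path_algebra_add lin_add)
  next
    fix c and x :: "('v, 'e, 'k) palg" assume "x \<in> ?A"
    then show "derivation_ext G m n \<theta> (pscale c x) = pscale c (derivation_ext G m n \<theta> x)"
      by (simp add: ext path_algebra_pscale lin_pscale)
  next
    fix r :: "('v, 'e, 'k) palg" assume "r \<in> vertex_algebra (quiver G)"
    then show "derivation_ext G m n \<theta> r = 0" using vA by (simp add: ext subset_iff vert)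
  next
    fix i j and x :: "('v, 'e, 'k) palg" assume "x \<in> homogeneous G i j"
    then show "derivation_ext G m n \<theta> x \<in> homogeneous2 G (i + m) (j + n)"
      using hA hom by (simp add: ext subset_iff)
  next
    fix i j and x y :: "('v, 'e, 'k) palg" assume x: "x \<in> homogeneous G i j" and y: "y \<in> ?A"
    then have "x \<in> ?A" using hA by blast
    then show "derivation_ext G m n \<theta> (x \<star> y) = outer_right (derivation_ext G m n \<theta> x) y +
        pscale (koszul (m * i + n * j)) (outer_left x (derivation_ext G m n \<theta> y))"
      using leibniz[OF x y] y by (simp add: ext path_algebra_mult[OF wf])
  qed
qed

lemma basis_homogeneous:
  "p \<in> paths (quiver G) \<Longrightarrow> basis p \<in> homogeneous G (path_weight G p) (path_form_degree G p)"
  by (simp add: homogeneous_def path_algebra_basis) (simp add: basis_def)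

lemma arrow_homogeneous:
  fixes G :: "('v, 'e) bigraded_quiver"
  assumes "wf_digraph (quiver G)" "x \<in> arcs (quiver G)"
  shows "(arrow (quiver G) x :: ('v, 'e, 'k::comm_ring_1) palg) \<in> homogeneous G (weight G x) (form_degree G x)"
proof -
  let ?p = "(head (quiver G) x, [x], tail (quiver G) x)"
  have "(basis ?p :: ('v, 'e, 'k) palg) \<in> homogeneous G (path_weight G ?p) (path_form_degree G ?p)"
    using assms by (intro basis_homogeneous) (simp add: paths_single)
  then show ?thesis by (simp add: arrow_def path_weight_def path_form_degree_def)
qed

section \<open>Double derivations are determined by their values on arrows\<close>

context
  fixes G :: "('v, 'e) bigraded_quiver" and m n :: int
    and \<Theta> :: "('v, 'e, 'k::comm_ring_1) palg \<Rightarrow> ('v, 'e, 'k) palg2"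
  assumes wf: "wf_digraph (quiver G)" and \<Theta>: "\<Theta> \<in> double_derivations G m n"
begin

lemma double_derivation_add:
  "x \<in> path_algebra (quiver G) \<Longrightarrow> y \<in> path_algebra (quiver G) \<Longrightarrow> \<Theta> (x + y) = \<Theta> x + \<Theta> y"
  using \<Theta> by (simp add: double_derivations_def)

lemma double_derivation_pscale: "x \<in> path_algebra (quiver G) \<Longrightarrow> \<Theta> (pscale c x) = pscale c (\<Theta> x)"
  using \<Theta> by (simp add: double_derivations_def)

lemma double_derivation_vertex: "v \<in> verts (quiver G) \<Longrightarrow> \<Theta> (basis (v, [], v)) = 0"
  using \<Theta> by (simp add: double_derivations_def vertex_algebra_def basis_def)

lemma double_derivation_0: "\<Theta> 0 = 0"
  using \<Theta> by (simp add: double_derivations_def vertex_algebra_def)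

lemma double_derivation_leibniz:
  "x \<in> homogeneous G i j \<Longrightarrow> y \<in> path_algebra (quiver G) \<Longrightarrow>
   \<Theta> (x \<star> y) = outer_right (\<Theta> x) y + pscale (koszul (m * i + n * j)) (outer_left x (\<Theta> y))"
  using \<Theta> by (simp add: double_derivations_def)

lemma double_derivation_hom: "x \<in> homogeneous G i j \<Longrightarrow> \<Theta> x \<in> homogeneous2 G (i + m) (j + n)"
  using \<Theta> by (auto simp: double_derivations_def)

lemma double_derivation_sum:
  "(\<And>i. i \<in> I \<Longrightarrow> f i \<in> path_algebra (quiver G)) \<Longrightarrow> \<Theta> (\<Sum>i\<in>I. f i) = (\<Sum>i\<in>I. \<Theta> (f i))"
  by (induction I rule: infinite_finite_induct)
    (simp_all add: double_derivation_0 double_derivation_add path_algebra_sum)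

lemma double_derivation_arrow_mult:
  "x \<in> arcs (quiver G) \<Longrightarrow> y \<in> path_algebra (quiver G) \<Longrightarrow>
   \<Theta> (arrow (quiver G) x \<star> y) = outer_right (\<Theta> (arrow (quiver G) x)) y +
     pscale (bisign G m n [x]) (outer_left (arrow (quiver G) x) (\<Theta> y))"
  using double_derivation_leibniz[OF arrow_homogeneous[OF wf]] by simp

text \<open>An arrow satisfies x = e x e' with e, e' the trivial paths at its head and tail. Since
  \<Theta> kills trivial paths, the Leibniz rule gives \<Theta>(x) = e \<Theta>(x) e'.\<close>

lemma double_derivation_arrow_corners:
  assumes x: "x \<in> arcs (quiver G)"
  shows "Poly_Mapping.keys (\<Theta> (arrow (quiver G) x)) \<subseteq>
    corners G (head (quiver G) x) (tail (quiver G) x) (weight G x + m) (form_degree G x + n)"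
proof -
  let ?x = "arrow (quiver G) x :: ('v, 'e, 'k) palg"
  have ht: "head (quiver G) x \<in> verts (quiver G)" "tail (quiver G) x \<in> verts (quiver G)"
    using x wf by (auto simp: wf_digraph.tail_in_verts wf_digraph.head_in_verts)
  have e: "basis (v, [], v) \<in> homogeneous G 0 0" "(basis (v, [], v) :: ('v, 'e, 'k) palg) \<in> path_algebra (quiver G)" if "v \<in> verts (quiver G)" for v
    using basis_homogeneous[of "(v, [], v)"] that
    by (auto simp: paths_Nil path_weight_def path_form_degree_def intro: path_algebra_basis)
  have xA: "?x \<in> path_algebra (quiver G)" by (rule arrow_in[OF wf x])
  have "?x = basis (head (quiver G) x, [], head (quiver G) x) \<star> ?x"
    "?x = ?x \<star> basis (tail (quiver G) x, [], tail (quiver G) x)"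
    by (simp_all add: arrow_def path_mult_def)
  then have l: "\<Theta> ?x = outer_left (basis (head (quiver G) x, [], head (quiver G) x)) (\<Theta> ?x)"
    and r: "\<Theta> ?x = outer_right (\<Theta> ?x) (basis (tail (quiver G) x, [], tail (quiver G) x))"
    using double_derivation_leibniz[OF e(1)[OF ht(1)] xA] double_derivation_arrow_mult[OF x e(2)[OF ht(2)]]
    by (simp_all add: double_derivation_vertex ht)
  have "Poly_Mapping.keys (\<Theta> ?x) \<subseteq> {(p, q). path_head p = head (quiver G) x}"
    by (subst l, unfold outer_left_def) (auto intro!: keys_lin simp: path_mult_def split: if_splits)
  moreover have "Poly_Mapping.keys (\<Theta> ?x) \<subseteq> {(p, q). path_tail q = tail (quiver G) x}"
    by (subst r, unfold outer_right_def) (auto intro!: keys_lin simp: path_mult_def split: if_splits)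
  ultimately show ?thesis
    using double_derivation_hom[OF arrow_homogeneous[OF wf x]]
    by (auto simp: homogeneous2_def path_algebra2_def corners_def)
qed

text \<open>Uniqueness half of freeness: the Leibniz rule peels off one arrow at a time, down to a
  trivial path, where \<Theta> vanishes. Extensionality turns agreement on the algebra into equality
  of functions.\<close>

lemma double_derivation_eq_ext:
  "\<Theta> = derivation_ext G m n (\<lambda>x. \<Theta> (arrow (quiver G) x))"
proof (rule extensionalityI[of _ "path_algebra (quiver G)"])
  let ?D = "\<lambda>(v, xs, u). derivation_word G m n (\<lambda>x. \<Theta> (arrow (quiver G) x)) xs u"
  show "\<Theta> \<in> extensional (path_algebra (quiver G))" using \<Theta> by (auto simp: double_derivations_def PiE_iff)
  show "derivation_ext G m n (\<lambda>x. \<Theta> (arrow (quiver G) x)) \<in> extensional (path_algebra (quiver G))"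
    by (simp add: derivation_ext_def)
  have *: "\<Theta> (basis (v, xs, u)) = derivation_word G m n (\<lambda>x. \<Theta> (arrow (quiver G) x)) xs u"
    if "(v, xs, u) \<in> paths (quiver G)" for v xs u
    using that
  proof (induction xs arbitrary: v)
    case Nil
    then show ?case by (auto simp: paths_Nil double_derivation_vertex)
  next
    case (Cons x xs)
    then have x: "x \<in> arcs (quiver G)" "v = head (quiver G) x" "(tail (quiver G) x, xs, u) \<in> paths (quiver G)"
      by (auto simp: paths_Cons[OF wf])
    show ?case unfolding x(2) basis_Cons
      by (simp add: double_derivation_arrow_mult[OF x(1) path_algebra_basis[OF x(3)]] Cons.IH[OF x(3)])
  qed
  fix x :: "('v, 'e, 'k) palg" assume "x \<in> path_algebra (quiver G)"
  then have "\<Theta> x = lin ?D x" unfolding path_algebra_def mem_Collect_eq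
  proof (induction x rule: palg_induct)
    case (scale c p)
    then show ?case using * by (cases p) (simp add: double_derivation_pscale path_algebra_basis lin_pscale)
  next
    case (add y z)
    then show ?case by (simp add: double_derivation_add path_algebra_def lin_add)
  qed (simp add: double_derivation_0)
  then show "\<Theta> x = derivation_ext G m n (\<lambda>x. \<Theta> (arrow (quiver G) x)) x"
    using \<open>x \<in> path_algebra (quiver G)\<close> by (simp add: derivation_ext_def)
qed

end

lemma derivation_ext_arrow:
  fixes \<theta> :: "'e \<Rightarrow> ('v, 'e, 'k::comm_ring_1) palg2"
  assumes wf: "wf_digraph (quiver G)" and x: "x \<in> arcs (quiver G)"
    and \<theta>: "Poly_Mapping.keys (\<theta> x) \<subseteq> corners G (head (quiver G) x) (tail (quiver G) x) i j"
  shows "derivation_ext G m n \<theta> (arrow (quiver G) x) = \<theta> x"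
proof -
  have "arrow (quiver G) x \<in> (path_algebra (quiver G) :: ('v, 'e, 'k) palg set)"
    by (rule arrow_in[OF wf x])
  then show ?thesis
    using outer_right_idem(2)[OF \<theta>] unfolding derivation_ext_def by (simp add: arrow_def)
qed

lemma derivation_ext_cong:
  assumes wf: "wf_digraph (quiver G)" and "\<And>x. x \<in> arcs (quiver G) \<Longrightarrow> \<theta> x = \<theta>' x"
  shows "derivation_ext G m n \<theta> = derivation_ext G m n \<theta>'"
proof -
  have "derivation_word G m n \<theta> xs u = derivation_word G m n \<theta>' xs u"
    if "(v, xs, u) \<in> paths (quiver G)" for v xs u
    using that by (induction xs arbitrary: v) (auto simp: paths_Cons[OF wf] assms(2))
  then show ?thesis unfolding derivation_ext_def
    by (intro restrict_ext lin_cong) (auto simp: path_algebra_def)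
qed


section \<open>Contraction of forms with a double derivation\<close>

lemma quiver_forms [simp]:
  "quiver (forms G) = form_quiver (quiver G)" "weight (forms G) x = weight G (form_arrow x)"
  "form_degree (forms G) x = dif_count x"
  by (simp_all add: forms_def)

lemma wf_form_quiver: "wf_digraph Q \<Longrightarrow> wf_digraph (form_quiver Q)"
  by (auto simp: wf_digraph_def)

lemma form_arrow_comp_Fn [simp]: "form_arrow \<circ> Fn = id" "dif_count \<circ> Fn = (\<lambda>_. 0)"
  by auto

lemma path_weight_Fn [simp]:
  "path_weight (forms G) (v, map Fn xs, u) = path_weight G (v', xs, u')"
  "path_form_degree (forms G) (v, map Fn xs, u) = 0"
  by (simp_all add: path_weight_def path_form_degree_def comp_def)

lemma d_arrow_eq_arrow: "d_arrow Q x = arrow (form_quiver Q) (Dif x)"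
  by (simp add: d_arrow_eq arrow_def[of "form_quiver Q"])

lemma function_form_arrow_eq: "function_form (arrow Q x) = arrow (form_quiver Q) (Fn x)"
  by (simp add: arrow_def)

lemma relabel2_Fn_corners:
  assumes wf: "wf_digraph (quiver G)" and t: "Poly_Mapping.keys t \<subseteq> corners G v u i j"
  shows "Poly_Mapping.keys (relabel2 Fn t) \<subseteq> corners (forms G) v u i 0"
  unfolding relabel2_def
proof (rule keys_lin_subset[OF t], clarify)
  fix a xs b c ys d k
  assume "((a, xs, b), (c, ys, d)) \<in> corners G v u i j"
    and "k \<in> Poly_Mapping.keys (relabel Fn (basis (a, xs, b)) \<otimes>\<^sub>k relabel Fn (basis (c, ys, d)))"
  then show "k \<in> corners (forms G) v u i 0"
    by (auto simp: corners_def paths_form_quiver[OF wf] path_weight_def path_form_degree_def comp_def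
        split: if_splits)
qed

context
  fixes G :: "('v, 'e) bigraded_quiver" and m :: int
    and \<Theta> :: "('v, 'e, 'k::comm_ring_1) palg \<Rightarrow> ('v, 'e, 'k) palg2"
  assumes wf: "wf_digraph (quiver G)" and \<Theta>: "\<Theta> \<in> double_derivations G m 0"
begin

text \<open>Justifies the definite description. On the path algebra with letters \<open>Fn x\<close>
  and \<open>Dif x\<close>, freeness yields exactly one double derivation that is 0 on x and
  \<Theta>(x) on dx; it then has the required values on all a and da.\<close>

lemma contraction2_double_derivation: "contraction2 G m \<Theta> \<in> double_derivations (forms G) m (- 1)"
  and contraction2_d_arrow: "x \<in> arcs (quiver G) \<Longrightarrow>
     contraction2 G m \<Theta> (d_arrow (quiver G) x) = relabel2 Fn (\<Theta> (arrow (quiver G) x))"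
proof -
  let ?Q = "quiver G" and ?A = "path_algebra (quiver G) :: ('v, 'e, 'k) palg set"
  define \<psi> where "\<psi> = case_form (\<lambda>_. 0) (\<lambda>x. relabel2 Fn (\<Theta> (arrow (quiver G) x)))"
  define I where "I = derivation_ext (forms G) m (- 1) \<psi>"
  have wfF: "wf_digraph (quiver (forms G))" using wf by (simp add: wf_form_quiver)
  have \<psi>: "Poly_Mapping.keys (\<psi> y) \<subseteq> corners (forms G) (head (quiver (forms G)) y) (tail (quiver (forms G)) y)
      (weight (forms G) y + m) (form_degree (forms G) y + - 1)" if "y \<in> arcs (quiver (forms G))" for y
  proof -
    have "form_arrow y \<in> arcs ?Q" using that by auto
    from relabel2_Fn_corners[OF wf double_derivation_arrow_corners[OF wf \<Theta> this]]
    show ?thesis by (cases y) (simp_all add: \<psi>_def)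
  qed
  have i: "I \<in> double_derivations (forms G) m (- 1)"
    unfolding I_def by (rule derivation_ext_double_derivation[OF wfF \<psi>])
  have arr: "I (arrow (form_quiver ?Q) y) = \<psi> y" if "y \<in> arcs (form_quiver ?Q)" for y
    using derivation_ext_arrow[where \<theta> = \<psi>, OF wfF _ \<psi>] that by (simp add: I_def)
  note mult = double_derivation_arrow_mult[OF wfF i, unfolded quiver_forms(1)]
  have ffA: "function_form x \<in> path_algebra (form_quiver ?Q)" if "x \<in> ?A" for x
    by (rule function_form_in[OF wf that])
  have dA: "d_form (function_form x) \<in> path_algebra (form_quiver ?Q)" if "x \<in> ?A" for x
    using d_function_form_in[OF wf that] by (simp add: one_forms_def)
  have word: "I (function_form (basis (v, xs, u))) = 0 \<and>
      I (d_form (function_form (basis (v, xs, u)))) = relabel2 Fn (\<Theta> (basis (v, xs, u)))"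
    if "(v, xs, u) \<in> paths ?Q" for v xs u
    using that
  proof (induction xs arbitrary: v)
    case Nil
    then show ?case
      using double_derivation_vertex[OF wfF i] double_derivation_0[OF wfF i] double_derivation_vertex[OF wf \<Theta>]
      by (auto simp: paths_Nil)
  next
    case (Cons x xs)
    then have x: "x \<in> arcs ?Q" "v = head ?Q x" "(tail ?Q x, xs, u) \<in> paths ?Q"
      by (auto simp: paths_Cons[OF wf])
    have x': "Fn x \<in> arcs (form_quiver ?Q)" "Dif x \<in> arcs (form_quiver ?Q)" using x by auto
    have b: "basis (tail ?Q x, xs, u) \<in> ?A" by (rule path_algebra_basis[OF x(3)])
    have wx: "arrow (form_quiver ?Q) y \<star> z \<in> path_algebra (form_quiver ?Q)"
      if "y \<in> arcs (form_quiver ?Q)" "z \<in> path_algebra (form_quiver ?Q)" for y z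
      using that wfF by (intro path_algebra_mult arrow_in) simp_all
    note IH = Cons.IH[OF x(3)]
    have arrs: "I (arrow (form_quiver ?Q) (Fn x)) = 0"
      "I (arrow (form_quiver ?Q) (Dif x)) = relabel2 Fn (\<Theta> (arrow ?Q x))"
      using arr[OF x'(1)] arr[OF x'(2)] by (simp_all add: \<psi>_def)
    have "I (function_form (basis (v, x # xs, u))) = 0"
      unfolding x(2) basis_Cons relabel_mult function_form_arrow_eq
      by (subst mult[OF x'(1) ffA[OF b]]) (use IH arrs in \<open>simp del: relabel_basis\<close>)
    \<comment> \<open>Both sides obey the same recursion along the word, by d(xy) = (dx) y + x (dy).
      The signs match since x has form degree 0, so \<open>I\<close> passes it with the sign of
      \<Theta>.\<close>
    moreover have "I (d_form (function_form (basis (v, x # xs, u)))) = relabel2 Fn (\<Theta> (basis (v, x # xs, u)))"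
      unfolding x(2) basis_Cons d_function_form_leibniz d_arrow_eq_arrow
      unfolding function_form_arrow_eq
        double_derivation_arrow_mult[OF wf \<Theta> x(1) b]
        double_derivation_add[OF wfF i, unfolded quiver_forms(1), OF wx[OF x'(2) ffA[OF b]] wx[OF x'(1) dA[OF b]]]
        mult[OF x'(2) ffA[OF b]] mult[OF x'(1) dA[OF b]]
      using IH arrs
      by (simp add: relabel2_add relabel2_pscale relabel2_outer_left relabel2_outer_right
          function_form_arrow_eq del: relabel_basis d_form_basis)
    ultimately show ?case by blast
  qed
  have all: "I (function_form x) = 0 \<and> I (d_form (function_form x)) = relabel2 Fn (\<Theta> x)" if x: "x \<in> ?A" for x
    using x unfolding path_algebra_def mem_Collect_eq
  proof (induction x rule: palg_induct)
    case zero
    then show ?case using double_derivation_0[OF wfF i] double_derivation_0[OF wf \<Theta>] by simp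
  next
    case (scale c p)
    have p: "basis p \<in> ?A" by (rule path_algebra_basis[OF scale])
    obtain v xs u where pe: "p = (v, xs, u)" by (cases p)
    show ?case
      using word[of v xs u] scale double_derivation_pscale[OF wfF i, unfolded quiver_forms(1), OF ffA[OF p]]
        double_derivation_pscale[OF wfF i, unfolded quiver_forms(1), OF dA[OF p]] double_derivation_pscale[OF wf \<Theta> p]
      by (simp add: relabel_pscale d_form_pscale relabel2_pscale pe del: relabel_basis d_form_basis)
  next
    case (add y z)
    then have yz: "y \<in> ?A" "z \<in> ?A" by (auto simp: path_algebra_def)
    show ?case
      using add(3,4) double_derivation_add[OF wfF i, unfolded quiver_forms(1), OF ffA[OF yz(1)] ffA[OF yz(2)]]
        double_derivation_add[OF wfF i, unfolded quiver_forms(1), OF dA[OF yz(1)] dA[OF yz(2)]]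
        double_derivation_add[OF wf \<Theta> yz]
      by (simp add: relabel_add d_form_add relabel2_add)
  qed
  have uniq: "j = I" if j: "j \<in> double_derivations (forms G) m (- 1)"
    and ja: "\<forall>a\<in>?A. j (function_form a) = 0 \<and> j (d_form (function_form a)) = relabel2 Fn (\<Theta> a)" for j
  proof -
    have "j (arrow (quiver (forms G)) y) = \<psi> y" if "y \<in> arcs (quiver (forms G))" for y
    proof -
      have a: "form_arrow y \<in> arcs ?Q" using that by auto
      show ?thesis using bspec[OF ja arrow_in[OF wf a]]
        by (cases y) (simp_all add: \<psi>_def d_arrow_eq_arrow flip: function_form_arrow_eq)
    qed
    then show ?thesis
      unfolding I_def by (subst double_derivation_eq_ext[OF wfF j]) (rule derivation_ext_cong[OF wfF])
  qed
  have eq: "contraction2 G m \<Theta> = I"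
    unfolding contraction2_def using i all uniq by (intro the_equality) blast+
  show "contraction2 G m \<Theta> \<in> double_derivations (forms G) m (- 1)"
    using i eq by simp
  show "contraction2 G m \<Theta> (d_arrow ?Q x) = relabel2 Fn (\<Theta> (arrow ?Q x))" if "x \<in> arcs ?Q"
    unfolding eq using all[OF arrow_in[OF wf that]] by blast
qed

end

text \<open>One tensor factor is a function, so the product of the form degrees is 0 and only
  weights enter the sign. The corner condition makes q (df) p composable.\<close>

lemma swap_mult_outer_right:
  assumes "Poly_Mapping.keys t \<subseteq> corners G v w i j" and "tail (quiver G) f = v" "head (quiver G) f = w"
  shows "swap_mult (forms G) (outer_right (relabel2 Fn t) (arrow (form_quiver (quiver G)) (Dif f))) =
    lin (\<lambda>(p, q). pscale (koszul (path_weight G p * (path_weight G q + weight G f)))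
      (basis (path_head q, map Fn (path_word q) @ Dif f # map Fn (path_word p), path_tail p))) t"
proof -
  have "swap_mult (forms G) (outer_right (relabel2 Fn t) b) =
      lin (\<lambda>pq. swap_mult (forms G) (outer_right (relabel2 Fn (Poly_Mapping.single pq 1)) b)) t" for b
    by (simp add: swap_mult_def outer_right_def relabel2_def lin_lin)
  then show ?thesis
    using assms
    by (auto intro!: lin_cong simp: relabel2_single outer_right_single arrow_def swap_mult_def
        path_weight_def path_form_degree_def comp_def corners_def path_mult_def dest!: subsetD)
qed

lemma swap_mult_outer_left:
  assumes "Poly_Mapping.keys t \<subseteq> corners G v w i j" and "tail (quiver G) f = v" "head (quiver G) f = w"
  shows "swap_mult (forms G) (outer_left (arrow (form_quiver (quiver G)) (Dif f)) (relabel2 Fn t)) =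
    lin (\<lambda>(p, q). pscale (koszul ((weight G f + path_weight G p) * path_weight G q))
      (basis (path_head q, map Fn (path_word q) @ Dif f # map Fn (path_word p), path_tail p))) t"
proof -
  have "swap_mult (forms G) (outer_left b (relabel2 Fn t)) =
      lin (\<lambda>pq. swap_mult (forms G) (outer_left b (relabel2 Fn (Poly_Mapping.single pq 1)))) t" for b
    by (simp add: swap_mult_def outer_left_def relabel2_def lin_lin)
  then show ?thesis
    using assms
    by (auto intro!: lin_cong simp: relabel2_single outer_left_single arrow_def swap_mult_def
        path_weight_def path_form_degree_def comp_def corners_def path_mult_def dest!: subsetD)
qed


section \<open>Hamiltonian double derivations on the double of a quiver\<close>

primrec dual :: "'e doubled \<Rightarrow> 'e doubled" where
  "dual (Orig e) = Star e"
| "dual (Star e) = Orig e"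

lemma dual_dual [simp]: "dual (dual f) = f"
  by (cases f) simp_all

lemma dual_in_image [simp]: "dual f \<in> Orig ` A \<longleftrightarrow> f \<in> Star ` A" "dual f \<in> Star ` A \<longleftrightarrow> f \<in> Orig ` A"
  by (cases f; auto)+

lemma double_quiver_simps [simp]:
  "verts (quiver (double_quiver N H)) = verts (quiver H)"
  "arcs (quiver (double_quiver N H)) = Orig ` arcs (quiver H) \<union> Star ` arcs (quiver H)"
  "tail (quiver (double_quiver N H)) (Orig e) = tail (quiver H) e"
  "tail (quiver (double_quiver N H)) (Star e) = head (quiver H) e"
  "head (quiver (double_quiver N H)) (Orig e) = head (quiver H) e"
  "head (quiver (double_quiver N H)) (Star e) = tail (quiver H) e"
  "weight (double_quiver N H) (Orig e) = weight H e"
  "weight (double_quiver N H) (Star e) = N - weight H e"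
  "form_degree (double_quiver N H) = (\<lambda>_. 0)"
  by (simp_all add: double_quiver_def)

lemma dual_simps [simp]:
  "head (quiver (double_quiver N H)) (dual f) = tail (quiver (double_quiver N H)) f"
  "tail (quiver (double_quiver N H)) (dual f) = head (quiver (double_quiver N H)) f"
  "weight (double_quiver N H) (dual f) = N - weight (double_quiver N H) f"
  by (cases f; auto)+

lemma wf_double_quiver: "wf_digraph (quiver H) \<Longrightarrow> wf_digraph (quiver (double_quiver N H))"
  by (auto simp: wf_digraph_def)

text \<open>The form \<open>omega\<close> over an arbitrary graded quiver; plain and hatted arrows
  then need no separate treatment.\<close>

definition darboux_form ::
  "int \<Rightarrow> ('v, 'e) bigraded_quiver \<Rightarrow> ('v, 'e doubled form, 'k::comm_ring_1) palg" where
  "darboux_form N H = (\<Sum>e\<in>arcs (quiver H).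
     d_arrow (quiver (double_quiver N H)) (Orig e) \<star> d_arrow (quiver (double_quiver N H)) (Star e))"

definition pair_sign ::
  "('v, 'e doubled) bigraded_quiver \<Rightarrow> int \<Rightarrow> 'e doubled \<Rightarrow>
   ('v, 'e doubled) path \<times> ('v, 'e doubled) path \<Rightarrow> 'k::comm_ring_1" where
  "pair_sign G m f = (\<lambda>(p, q). case f of
      Orig e \<Rightarrow> - koszul (m * weight G f + (weight G f + path_weight G p) * path_weight G q)
    | Star e \<Rightarrow> koszul (path_weight G p * (path_weight G q + weight G f)))"

lemma pair_sign_self [simp]: "pair_sign G m f pq * pair_sign G m f pq = 1"
  by (simp add: pair_sign_def case_prod_unfold split: doubled.split)

text \<open>The word q (df) p. Its only differential marks the cut, so f and both subwords can be
  recovered; p and q themselves can be recovered once the head of p and the tail of q are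
  known.\<close>

definition flip :: "'f \<Rightarrow> ('v, 'f) path \<times> ('v, 'f) path \<Rightarrow> ('v, 'f form) path" where
  "flip f = (\<lambda>(p, q). (path_head q, map Fn (path_word q) @ Dif f # map Fn (path_word p), path_tail p))"

definition flip_lin ::
  "('v, 'e doubled) bigraded_quiver \<Rightarrow> int \<Rightarrow> 'e doubled \<Rightarrow>
   ('v, 'e doubled, 'k::comm_ring_1) palg2 \<Rightarrow> ('v, 'e doubled form, 'k) palg" where
  "flip_lin G m f = lin (\<lambda>pq. pscale (pair_sign G m f pq) (basis (flip f pq)))"

lemma swap_mult_linear:
  "swap_mult G (s + t) = swap_mult G s + swap_mult G t" "swap_mult G (pscale c t) = pscale c (swap_mult G t)"
  by (simp_all add: swap_mult_def lin_add lin_pscale)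

lemma swap_mult_sum: "swap_mult G (\<Sum>i\<in>I. f i) = (\<Sum>i\<in>I. swap_mult G (f i))"
  by (simp add: swap_mult_def lin_sum)

lemma koszul_minus_1: "koszul (n - 1) = - koszul n"
  by (simp add: koszul_def)

text \<open>Each product of two differentials gives two terms, one for each factor that is
  contracted. Indexing a term by the differential that survives turns them into one sum over all
  arrows of the double.\<close>

lemma contraction_darboux_form:
  fixes \<Theta> :: "('v, 'e doubled, 'k::comm_ring_1) palg \<Rightarrow> _"
  assumes wfH: "wf_digraph (quiver H)" and fin: "finite (arcs (quiver H))"
    and G: "G = double_quiver N H" and \<Theta>: "\<Theta> \<in> double_derivations G m 0"
  shows "contraction G m \<Theta> (darboux_form N H) =
    (\<Sum>f\<in>arcs (quiver G). flip_lin G m f (\<Theta> (arrow (quiver G) (dual f))))"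
proof -
  let ?F = "form_quiver (quiver G)"
  have wf: "wf_digraph (quiver G)" unfolding G by (rule wf_double_quiver[OF wfH])
  have wfF: "wf_digraph (quiver (forms G))" using wf by (simp add: wf_form_quiver)
  note i = contraction2_double_derivation[OF wf \<Theta>]
  have dA: "arrow ?F (Dif f) \<in> path_algebra ?F" if "f \<in> arcs (quiver G)" for f
    using that wfF by (intro arrow_in) auto
  have pA: "arrow ?F (Dif (Orig e)) \<star> arrow ?F (Dif (Star e)) \<in> path_algebra ?F" if "e \<in> arcs (quiver H)" for e
    using that wfF by (intro path_algebra_mult dA) (auto simp: G)
  have "swap_mult (forms G) (contraction2 G m \<Theta> (arrow ?F (Dif (Orig e)) \<star> arrow ?F (Dif (Star e)))) =
      flip_lin G m (Star e) (\<Theta> (arrow (quiver G) (Orig e))) + flip_lin G m (Orig e) (\<Theta> (arrow (quiver G) (Star e)))"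
    if e: "e \<in> arcs (quiver H)" for e
  proof -
    have a: "Orig e \<in> arcs (quiver G)" "Star e \<in> arcs (quiver G)" using e by (auto simp: G)
    have a': "Dif (Orig e) \<in> arcs (quiver (forms G))" using a by auto
    note k = double_derivation_arrow_corners[OF wf \<Theta>]
    have "contraction2 G m \<Theta> (arrow ?F (Dif (Orig e)) \<star> arrow ?F (Dif (Star e))) =
        outer_right (relabel2 Fn (\<Theta> (arrow (quiver G) (Orig e)))) (arrow ?F (Dif (Star e))) +
        pscale (- koszul (m * weight G (Orig e)))
          (outer_left (arrow ?F (Dif (Orig e))) (relabel2 Fn (\<Theta> (arrow (quiver G) (Star e)))))"
      using double_derivation_arrow_mult[OF wfF i a', unfolded quiver_forms(1), OF dA[OF a(2)]]
        contraction2_d_arrow[OF wf \<Theta> a(1)] contraction2_d_arrow[OF wf \<Theta> a(2)]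
      by (simp add: d_arrow_eq_arrow koszul_minus_1)
    moreover have "swap_mult (forms G) (outer_right (relabel2 Fn (\<Theta> (arrow (quiver G) (Orig e)))) (arrow ?F (Dif (Star e)))) =
        flip_lin G m (Star e) (\<Theta> (arrow (quiver G) (Orig e)))"
      by (subst swap_mult_outer_right[OF k[OF a(1)]])
        (auto simp: G flip_lin_def flip_def pair_sign_def case_prod_unfold)
    moreover have "pscale (- koszul (m * weight G (Orig e)))
        (swap_mult (forms G) (outer_left (arrow ?F (Dif (Orig e))) (relabel2 Fn (\<Theta> (arrow (quiver G) (Star e)))))) =
        flip_lin G m (Orig e) (\<Theta> (arrow (quiver G) (Star e)))"
      by (subst swap_mult_outer_left[OF k[OF a(2)]])
        (auto simp: G flip_lin_def flip_def pair_sign_def case_prod_unfold koszul_add mult_ac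
          simp flip: lin_pscale_fun)
    ultimately show ?thesis by (simp only: swap_mult_linear)
  qed
  then have "contraction G m \<Theta> (darboux_form N H) = (\<Sum>e\<in>arcs (quiver H).
      flip_lin G m (Star e) (\<Theta> (arrow (quiver G) (Orig e))) + flip_lin G m (Orig e) (\<Theta> (arrow (quiver G) (Star e))))"
    unfolding contraction_def darboux_form_def d_arrow_eq_arrow G[symmetric]
    by (subst double_derivation_sum[OF wfF i, unfolded quiver_forms(1)]) (simp_all add: pA swap_mult_sum)
  also have "\<dots> = (\<Sum>f\<in>arcs (quiver G). flip_lin G m f (\<Theta> (arrow (quiver G) (dual f))))"
    unfolding G double_quiver_simps
    by (subst sum.union_disjoint) (auto simp: fin sum.reindex inj_on_def sum.distrib add.commute)
  finally show ?thesis .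
qed

lemma form_word_eq_iff:
  "map Fn xs @ Dif f # map Fn ys = map Fn xs' @ Dif f' # map Fn ys' \<longleftrightarrow> xs = xs' \<and> f = f' \<and> ys = ys'"
proof (induction xs arbitrary: xs')
  case Nil
  show ?case by (cases xs') (auto simp: inj_map_eq_map inj_def)
next
  case (Cons x xs)
  then show ?case by (cases xs') auto
qed

text \<open>Words with different differentials differ, so the summands have disjoint supports and
  each coefficient belongs to a single f.\<close>

lemma lookup_flip_sum:
  fixes t :: "'e doubled \<Rightarrow> ('v, 'e doubled, 'k::comm_ring_1) palg2"
  assumes fin: "finite F" and f: "f \<in> F"
    and t: "\<And>f. f \<in> F \<Longrightarrow> Poly_Mapping.keys (t f) \<subseteq> corners G (\<eta> f) (\<tau> f) (i f) (j f)"
    and p: "path_head p = \<eta> f" and q: "path_tail q = \<tau> f"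
  shows "Poly_Mapping.lookup (\<Sum>f\<in>F. flip_lin G m f (t f)) (flip f (p, q)) =
     pair_sign G m f (p, q) * Poly_Mapping.lookup (t f) (p, q)"
proof -
  have "Poly_Mapping.lookup (flip_lin G m f' (t f')) (flip f (p, q)) = 0" if "f' \<in> F" "f' \<noteq> f" for f'
  proof -
    have "Poly_Mapping.keys (flip_lin G m f' (t f')) \<subseteq> range (flip f')"
      unfolding flip_lin_def using keys_pscale by (intro keys_lin) (fastforce simp: basis_def)
    moreover have "flip f (p, q) \<notin> range (flip f')"
      using that by (auto simp: flip_def form_word_eq_iff)
    ultimately have "flip f (p, q) \<notin> Poly_Mapping.keys (flip_lin G m f' (t f'))" by blast
    then show ?thesis by (simp add: in_keys_iff)
  qed
  then have "Poly_Mapping.lookup (\<Sum>f\<in>F. flip_lin G m f (t f)) (flip f (p, q)) =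
      Poly_Mapping.lookup (flip_lin G m f (t f)) (flip f (p, q))"
    unfolding lookup_sum by (subst sum.remove[OF fin f]) simp
  also have "\<dots> = pair_sign G m f (p, q) * Poly_Mapping.lookup (t f) (p, q)"
    unfolding flip_lin_def basis_def
  proof (rule lookup_lin_inj)
    have "inj_on (flip f) {(p, q). path_head p = \<eta> f \<and> path_tail q = \<tau> f}"
      by (auto simp: inj_on_def flip_def form_word_eq_iff)
    then show "inj_on (flip f) (insert (p, q) (Poly_Mapping.keys (t f)))"
      by (rule inj_on_subset) (use t[OF f] p q in \<open>auto simp: corners_def\<close>)
  qed
  finally show ?thesis .
qed

lemma lin_sum_fun: "(\<Sum>i\<in>I. lin (f i) t) = lin (\<lambda>p. \<Sum>i\<in>I. f i p) t"
  unfolding lin_def pscale_sum by (rule sum.swap)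

lemma path_word_arcs: "wf_digraph Q \<Longrightarrow> (v, xs, u) \<in> paths Q \<Longrightarrow> set xs \<subseteq> arcs Q"
  by (induction xs arbitrary: v) (auto simp: paths_Cons)

lemma path_split:
  assumes wf: "wf_digraph Q" and p: "(v, xs, u) \<in> paths Q" and i: "i < length xs"
  shows "(v, take i xs, head Q (xs ! i)) \<in> paths Q" "(tail Q (xs ! i), drop (Suc i) xs, u) \<in> paths Q"
proof -
  have "(v, take i xs @ xs ! i # drop (Suc i) xs, u) \<in> paths Q"
    using p i by (simp add: id_take_nth_drop [symmetric])
  then show "(v, take i xs, head Q (xs ! i)) \<in> paths Q" "(tail Q (xs ! i), drop (Suc i) xs, u) \<in> paths Q"
    by (auto simp: paths_append[OF wf] paths_Cons[OF wf])
qed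

lemma sum_list_split:
  "i < length xs \<Longrightarrow> sum_list (map f xs) = sum_list (map f (take i xs)) + f (xs ! i) + (sum_list (map f (drop (Suc i) xs)) :: int)"
  by (subst id_take_nth_drop) auto

text \<open>The occurrence \<open>w = q f\<^sup>* p\<close> of the dual arrow contributes \<open>\<plusminus> p \<otimes> q\<close>; contraction turns
  this back into the summand \<open>q (df\<^sup>*) p\<close> of \<open>dw\<close>.\<close>

definition ham_arrow ::
  "('v, 'e doubled) bigraded_quiver \<Rightarrow> int \<Rightarrow> ('v, 'e doubled, 'k::comm_ring_1) palg \<Rightarrow> 'e doubled \<Rightarrow>
   ('v, 'e doubled, 'k) palg2" where
  "ham_arrow G m x f = lin (\<lambda>(v, xs, u). \<Sum>i<length xs.
     if xs ! i = dual f
     then let pq = ((head (quiver G) f, drop (Suc i) xs, u), (v, take i xs, tail (quiver G) f))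
          in pscale (pair_sign G m (dual f) pq) (Poly_Mapping.single pq 1)
     else 0) x"

lemma d_path_Fn:
  "d_path (v, map Fn xs, u) =
     (\<Sum>i<length xs. basis (v, map Fn (take i xs) @ Dif (xs ! i) # map Fn (drop (Suc i) xs), u))"
  unfolding d_path_def
  by (auto intro!: sum.cong simp: take_map drop_map upd_conv_take_nth_drop comp_def)

text \<open>This is the nondegeneracy of the form. \<open>ham_arrow\<close> provides a solution; two
  solutions agree because, by \<open>lookup_flip_sum\<close>, the contraction displays every
  coefficient on every arrow up to a sign.\<close>

theorem hamiltonian_darboux:
  fixes x :: "('v, 'e doubled, 'k::comm_ring_1) palg"
  assumes wfH: "wf_digraph (quiver H)" and fin: "finite (arcs (quiver H))"
    and G: "G = double_quiver N H" and x: "x \<in> homogeneous G m 0"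
  shows "hamiltonian G N (darboux_form N H) m x \<in> double_derivations G (m - N) 0" (is ?A)
    and "f \<in> arcs (quiver G) \<Longrightarrow>
      hamiltonian G N (darboux_form N H) m x (arrow (quiver G) f) = ham_arrow G (m - N) x f" (is "_ \<Longrightarrow> ?B")
proof -
  have wf: "wf_digraph (quiver G)" unfolding G by (rule wf_double_quiver[OF wfH])
  have finG: "finite (arcs (quiver G))" using fin by (simp add: G)
  let ?\<theta> = "ham_arrow G (m - N) x"
  have xk: "p \<in> paths (quiver G)" "path_weight G p = m" if "p \<in> Poly_Mapping.keys x" for p
    using that x by (auto simp: homogeneous_def path_algebra_def)
  have \<theta>: "Poly_Mapping.keys (?\<theta> f) \<subseteq>
      corners G (head (quiver G) f) (tail (quiver G) f) (weight G f + (m - N)) (form_degree G f + 0)"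
    if f: "f \<in> arcs (quiver G)" for f
    unfolding ham_arrow_def
  proof (intro keys_lin, clarify del: subsetI)
    fix v xs u assume k: "(v, xs, u) \<in> Poly_Mapping.keys x"
    have "((head (quiver G) f, drop (Suc i) xs, u), (v, take i xs, tail (quiver G) f)) \<in>
        corners G (head (quiver G) f) (tail (quiver G) f) (weight G f + (m - N)) (form_degree G f + 0)"
      if i: "i < length xs" "xs ! i = dual f" for i
    proof -
      have "sum_list (map (weight G) xs) = m" using xk(2)[OF k] by (simp add: path_weight_def)
      then show ?thesis
        using path_split[OF wf xk(1)[OF k] i(1)] sum_list_split[OF i(1), of "weight G"] i(2)
        by (simp add: G corners_def path_weight_def path_form_degree_def comp_def)
    qed
    then show "Poly_Mapping.keys (\<Sum>i<length xs.
         if xs ! i = dual f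
         then let pq = ((head (quiver G) f, drop (Suc i) xs, u), (v, take i xs, tail (quiver G) f))
              in pscale (pair_sign G (m - N) (dual f) pq) (Poly_Mapping.single pq 1)
         else 0) \<subseteq> corners G (head (quiver G) f) (tail (quiver G) f) (weight G f + (m - N)) (form_degree G f + 0)"
      by (intro keys_sum_subset) (auto simp: Let_def intro!: order.trans[OF keys_pscale])
  qed
  let ?H = "derivation_ext G (m - N) 0 ?\<theta>"
  have H: "?H \<in> double_derivations G (m - N) 0"
    by (rule derivation_ext_double_derivation[OF wf \<theta>])
  have arr: "?H (arrow (quiver G) f) = ?\<theta> f" if "f \<in> arcs (quiver G)" for f
    by (rule derivation_ext_arrow[where \<theta> = ?\<theta>, OF wf that \<theta>[OF that]])
  have "contraction G (m - N) ?H (darboux_form N H) =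
      (\<Sum>f\<in>arcs (quiver G). flip_lin G (m - N) f (?\<theta> (dual f)))"
    unfolding contraction_darboux_form[OF wfH fin G H]
    by (intro sum.cong refl, subst arr) (auto simp: G)
  \<comment> \<open>The sign put into \<open>ham_arrow\<close> meets the equal sign from the
    contraction, and \<open>pair_sign\<close> squares to 1.\<close>
  also have "\<dots> = (\<Sum>f\<in>arcs (quiver G). lin (\<lambda>(v, xs, u). \<Sum>i<length xs.
     if xs ! i = f then basis (v, map Fn (take i xs) @ Dif (xs ! i) # map Fn (drop (Suc i) xs), u) else 0) x)"
    unfolding ham_arrow_def flip_lin_def lin_lin
    by (intro sum.cong lin_cong refl)
      (auto simp: lin_sum Let_def flip_def lin_pscale split: if_splits intro!: sum.cong)
  also have "\<dots> = lin (\<lambda>(v, xs, u). d_path (v, map Fn xs, u)) x"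
    unfolding lin_sum_fun
  proof (intro lin_cong, clarify)
    fix v xs u assume k: "(v, xs, u) \<in> Poly_Mapping.keys x"
    have "set xs \<subseteq> arcs (quiver G)" by (rule path_word_arcs[OF wf xk(1)[OF k]])
    then have "xs ! i \<in> arcs (quiver G)" if "i < length xs" for i using that nth_mem by blast
    \<comment> \<open>Every position of the word carries exactly one arrow, so the sum over f
      collapses.\<close>
    then show "(\<Sum>f\<in>arcs (quiver G). \<Sum>i<length xs.
       if xs ! i = f then basis (v, map Fn (take i xs) @ Dif (xs ! i) # map Fn (drop (Suc i) xs), u) else 0) =
       d_path (v, map Fn xs, u)"
      unfolding d_path_Fn by (subst sum.swap) (auto intro!: sum.cong simp: finG)
  qed
  also have "\<dots> = d_form (function_form x)"
    unfolding d_form_def relabel_def lin_lin by (intro lin_cong) auto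
  finally have con: "contraction G (m - N) ?H (darboux_form N H) = d_form (function_form x)" .
  have "H' = ?H" if H': "H' \<in> double_derivations G (m - N) 0"
    and con': "contraction G (m - N) H' (darboux_form N H) = d_form (function_form x)" for H'
  proof -
    have "H' (arrow (quiver G) g) = ?H (arrow (quiver G) g)" if g: "g \<in> arcs (quiver G)" for g
    proof (rule poly_mapping_eqI)
      fix pq :: "('v, 'e doubled) path \<times> ('v, 'e doubled) path"
      define f where "f = dual g"
      have f: "f \<in> arcs (quiver G)" using g by (auto simp: f_def G)
      obtain p q where pq: "pq = (p, q)" by (cases pq)
      have t: "Poly_Mapping.keys (h (arrow (quiver G) (dual f))) \<subseteq> corners G (tail (quiver G) f) (head (quiver G) f)
          (weight G (dual f) + (m - N)) (form_degree G (dual f) + 0)"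
        if h: "h \<in> double_derivations G (m - N) 0" and f: "f \<in> arcs (quiver G)"
        for f and h :: "('v, 'e doubled, 'k) palg \<Rightarrow> ('v, 'e doubled, 'k) palg2"
        using double_derivation_arrow_corners[OF wf h, of "dual f"] f by (auto simp: G)
      show "Poly_Mapping.lookup (H' (arrow (quiver G) g)) pq = Poly_Mapping.lookup (?H (arrow (quiver G) g)) pq"
      proof (cases "path_head p = tail (quiver G) f \<and> path_tail q = head (quiver G) f")
        case True
        have "pair_sign G (m - N) f (p, q) * Poly_Mapping.lookup (h (arrow (quiver G) (dual f))) (p, q) =
           Poly_Mapping.lookup (contraction G (m - N) h (darboux_form N H)) (flip f (p, q))"
          if h: "h \<in> double_derivations G (m - N) 0" for h :: "('v, 'e doubled, 'k) palg \<Rightarrow> ('v, 'e doubled, 'k) palg2"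
          unfolding contraction_darboux_form[OF wfH fin G h]
          by (rule lookup_flip_sum[OF finG f t[OF h], symmetric]) (use True in simp_all)
        from this[OF H'] this[OF H]
        have "pair_sign G (m - N) f (p, q) * Poly_Mapping.lookup (H' (arrow (quiver G) (dual f))) (p, q) =
          pair_sign G (m - N) f (p, q) * Poly_Mapping.lookup (?H (arrow (quiver G) (dual f))) (p, q)"
          by (simp add: con con')
        \<comment> \<open>The coefficient ring may have zero divisors; the sign is removed by
          multiplying with it once more.\<close>
        then have "pair_sign G (m - N) f (p, q) * (pair_sign G (m - N) f (p, q) * Poly_Mapping.lookup (H' (arrow (quiver G) (dual f))) (p, q)) =
          pair_sign G (m - N) f (p, q) * (pair_sign G (m - N) f (p, q) * Poly_Mapping.lookup (?H (arrow (quiver G) (dual f))) (p, q))"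
          by simp
        then show ?thesis unfolding mult.assoc[symmetric] pair_sign_self by (simp add: f_def pq)
      next
        case False
        then have "(p, q) \<notin> Poly_Mapping.keys (H' (arrow (quiver G) (dual f)))"
          "(p, q) \<notin> Poly_Mapping.keys (?H (arrow (quiver G) (dual f)))"
          using t[OF H' f] t[OF H f] by (auto simp: corners_def)
        then show ?thesis by (simp add: f_def pq in_keys_iff)
      qed
    qed
    then show ?thesis
      by (subst double_derivation_eq_ext[OF wf H'], subst double_derivation_eq_ext[OF wf H])
        (rule derivation_ext_cong[OF wf])
  qed
  then have eq: "hamiltonian G N (darboux_form N H) m x = ?H"
    unfolding hamiltonian_def using H con by (intro the_equality) blast+
  show ?A using H eq by simp
  show ?B if "f \<in> arcs (quiver G)" using arr[OF that] eq by simp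
qed


section \<open>Commutators\<close>

lemma commutator_space_0: "0 \<in> commutator_space G"
  and commutator_space_add: "x \<in> commutator_space G \<Longrightarrow> y \<in> commutator_space G \<Longrightarrow> x + y \<in> commutator_space G"
  and commutator_space_diff: "x \<in> commutator_space G \<Longrightarrow> y \<in> commutator_space G \<Longrightarrow> x - y \<in> commutator_space G"
  and commutator_space_pscale: "x \<in> commutator_space G \<Longrightarrow> pscale c x \<in> commutator_space G"
  and commutator_space_sum: "(\<And>i. i \<in> I \<Longrightarrow> f i \<in> commutator_space G) \<Longrightarrow> (\<Sum>i\<in>I. f i) \<in> commutator_space G"
  unfolding commutator_space_def
  by (rule pm.span_zero pm.span_add pm.span_diff pm.span_scale pm.span_sum; assumption?)+

lemma commutator_in:
  "u \<in> homogeneous G i j \<Longrightarrow> v \<in> homogeneous G i' j' \<Longrightarrow>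
   u \<star> v - pscale (koszul (i * i' + j * j')) (v \<star> u) \<in> commutator_space G"
  unfolding commutator_space_def by (rule pm.span_base) blast

lemma linear_commutator_space:
  fixes x :: "('v, 'e, 'k::comm_ring_1) palg"
  assumes "x \<in> commutator_space G"
    and "\<And>x y. f (x + y) = f x + f y" and "\<And>c x. f (pscale c x) = pscale c (f x)"
    and "\<And>u v i j i' j'. u \<in> homogeneous G i j \<Longrightarrow> v \<in> homogeneous G i' j' \<Longrightarrow>
       f (u \<star> v - pscale (koszul (i * i' + j * j')) (v \<star> u)) \<in> commutator_space G'"
  shows "f x \<in> commutator_space G'"
  using assms(1) unfolding commutator_space_def[of G]
proof (rule pm.span_induct)
  have f0: "f 0 = 0" using assms(3)[of 0 0] by simp
  show "pm.subspace {x. f x \<in> commutator_space G'}"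
    by (rule pm.subspaceI)
      (simp_all only: mem_Collect_eq f0 assms(2,3) commutator_space_0 commutator_space_add commutator_space_pscale)
next
  fix x :: "('v, 'e, 'k) palg"
  assume "x \<in> {u \<star> v - pscale (koszul (i * i' + j * j')) (v \<star> u) | u v i j i' j'.
      u \<in> homogeneous G i j \<and> v \<in> homogeneous G i' j'}"
  then show "f x \<in> commutator_space G'" using assms(4) by blast
qed

section \<open>Classes in the Karoubi-de Rham complex and the induced differential\<close>

lemma DR_class_eq_0_iff: "DR_class G \<alpha> = DR_class G 0 \<longleftrightarrow> \<alpha> \<in> commutator_space (forms G)"
proof
  assume eq: "DR_class G \<alpha> = DR_class G 0"
  have "0 \<in> DR_class G \<alpha>" unfolding eq by (simp add: DR_class_def commutator_space_0)
  then have "0 - \<alpha> \<in> commutator_space (forms G)" by (simp add: DR_class_def)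
  from commutator_space_diff[OF commutator_space_0 this] show "\<alpha> \<in> commutator_space (forms G)" by simp
next
  assume a: "\<alpha> \<in> commutator_space (forms G)"
  have "\<beta> - \<alpha> \<in> commutator_space (forms G) \<longleftrightarrow> \<beta> \<in> commutator_space (forms G)" for \<beta>
    using commutator_space_diff[OF _ a, of \<beta>] commutator_space_add[OF _ a, of "\<beta> - \<alpha>"]
    by (metis diff_add_cancel)
  then show "DR_class G \<alpha> = DR_class G 0" by (simp add: DR_class_def)
qed

lemma d_form_homogeneous:
  assumes wf: "wf_digraph (quiver G)" and x: "x \<in> homogeneous (forms G) i j"
  shows "d_form x \<in> homogeneous (forms G) i (j + 1)"
proof -
  have xk: "Poly_Mapping.keys x \<subseteq> {p \<in> paths (form_quiver (quiver G)). path_weight (forms G) p = i \<and> path_form_degree (forms G) p = j}"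
    using x by (auto simp: homogeneous_def path_algebra_def)
  have "Poly_Mapping.keys (d_form x) \<subseteq> {p \<in> paths (form_quiver (quiver G)). path_weight (forms G) p = i \<and> path_form_degree (forms G) p = j + 1}"
    unfolding d_form_def
  proof (rule keys_lin_subset[OF xk], clarify del: subsetI)
    fix v xs u
    assume p: "(v, xs, u) \<in> paths (form_quiver (quiver G))"
      and i: "i = path_weight (forms G) (v, xs, u)" and j: "j = path_form_degree (forms G) (v, xs, u)"
    have "(v, xs[k := Dif y], u) \<in> paths (form_quiver (quiver G)) \<and>
        path_weight (forms G) (v, xs[k := Dif y], u) = path_weight (forms G) (v, xs, u) \<and>
        path_form_degree (forms G) (v, xs[k := Dif y], u) = path_form_degree (forms G) (v, xs, u) + 1"
      if k: "k < length xs" "xs ! k = Fn y" for k y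
    proof -
      have m: "map form_arrow (xs[k := Dif y]) = map form_arrow xs"
        using k by (simp add: map_update list_update_same_conv)
      have w: "path_weight (forms G) (v', zs, u') = sum_list (map (weight G) (map form_arrow zs))" for v' zs u'
        by (simp add: path_weight_def forms_def comp_assoc)
      have "sum_list (map dif_count (xs[k := Dif y])) = sum_list (map dif_count xs) + 1"
        using sum_list_split[OF k(1), of dif_count] k by (simp add: upd_conv_take_nth_drop)
      then show ?thesis using p paths_form_quiver[OF wf] unfolding w m
        by (simp add: path_form_degree_def m cong: map_cong)
    qed
    then show "Poly_Mapping.keys (d_path (v, xs, u)) \<subseteq> {p \<in> paths (form_quiver (quiver G)).
        path_weight (forms G) p = path_weight (forms G) (v, xs, u) \<and>
        path_form_degree (forms G) p = path_form_degree (forms G) (v, xs, u) + 1}"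
      unfolding d_path_def
      by (intro keys_sum_subset) (auto split: form.split simp: basis_def intro!: order.trans[OF keys_pscale])
  qed
  then show ?thesis by (auto simp: homogeneous_def path_algebra_def)
qed

text \<open>For u of form degree j, d[u, v] = [du, v] + \<open>koszul j\<close> [u, dv] with graded
  commutators, where du and dv have form degree raised by one.\<close>

lemma d_form_commutator_space:
  assumes wf: "wf_digraph (quiver G)" and x: "x \<in> commutator_space (forms G)"
  shows "d_form x \<in> commutator_space (forms G)"
  using x
proof (rule linear_commutator_space)
  fix u v :: "('a, 'b form, 'c) palg" and i j i' j'
  assume u: "u \<in> homogeneous (forms G) i j" and v: "v \<in> homogeneous (forms G) i' j'"
  have leib: "d_form (x \<star> y) = d_form x \<star> y + pscale (koszul j) (x \<star> d_form y)"
    if "x \<in> homogeneous (forms G) i j" for i j and x y :: "('a, 'b form, 'c) palg"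
    using that by (intro d_form_leibniz) (auto simp: homogeneous_def path_form_degree_def forms_def)
  note du = d_form_homogeneous[OF wf u] and dv = d_form_homogeneous[OF wf v]
  have s: "d_form (x - y) = d_form x - d_form y" for x y :: "('a, 'b form, 'c) palg"
    by (simp add: d_form_def lin_diff)
  have "d_form (u \<star> v - pscale (koszul (i * i' + j * j')) (v \<star> u)) =
      (d_form u \<star> v - pscale (koszul (i * i' + (j + 1) * j')) (v \<star> d_form u)) +
      pscale (koszul j) (u \<star> d_form v - pscale (koszul (i * i' + j * (j' + 1))) (d_form v \<star> u))"
    by (simp add: s d_form_pscale leib[OF u] leib[OF v] pscale_add pm.scale_right_diff_distrib koszul_add
        koszul_mult_self_left algebra_simps)
  also have "\<dots> \<in> commutator_space (forms G)"
    by (intro commutator_space_add commutator_space_pscale commutator_in u v du dv)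
  finally show "d_form (u \<star> v - pscale (koszul (i * i' + j * j')) (v \<star> u)) \<in> commutator_space (forms G)" .
qed (simp_all add: d_form_add d_form_pscale)

text \<open>\<open>d_DR\<close> takes a union over representatives. Since d preserves commutators,
  all representatives give the same coset, and \<alpha> is itself one of them because it lies in the
  algebra of forms.\<close>

lemma d_DR_eq_0_iff:
  assumes wf: "wf_digraph (quiver G)" and \<alpha>: "\<alpha> \<in> path_algebra (quiver (forms G))"
  shows "d_DR G (DR_class G \<alpha>) = DR_class G 0 \<longleftrightarrow> d_form \<alpha> \<in> commutator_space (forms G)"
proof -
  have d: "d_form \<beta> \<in> commutator_space (forms G) \<longleftrightarrow> d_form \<alpha> \<in> commutator_space (forms G)"
    if "\<beta> \<in> DR_class G \<alpha>" for \<beta>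
  proof -
    have "d_form (\<beta> - \<alpha>) \<in> commutator_space (forms G)"
      using that by (intro d_form_commutator_space wf) (simp add: DR_class_def)
    then have "d_form \<beta> - d_form \<alpha> \<in> commutator_space (forms G)" by (simp add: d_form_def lin_diff)
    from commutator_space_add[OF _ this, of "d_form \<alpha>"] commutator_space_diff[OF _ this, of "d_form \<beta>"]
    show ?thesis by auto
  qed
  have \<alpha>': "\<alpha> \<in> DR_class G \<alpha>" using \<alpha> by (simp add: DR_class_def commutator_space_0)
  show ?thesis
  proof
    assume "d_DR G (DR_class G \<alpha>) = DR_class G 0"
    moreover have "0 \<in> DR_class G 0" by (simp add: DR_class_def commutator_space_0)
    ultimately obtain \<beta> where \<beta>: "\<beta> \<in> DR_class G \<alpha>" "0 \<in> DR_class G (d_form \<beta>)"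
      unfolding d_DR_def by blast
    then have "0 - d_form \<beta> \<in> commutator_space (forms G)" by (simp add: DR_class_def)
    from commutator_space_diff[OF commutator_space_0 this] show "d_form \<alpha> \<in> commutator_space (forms G)"
      using d[OF \<beta>(1)] by simp
  next
    assume "d_form \<alpha> \<in> commutator_space (forms G)"
    then show "d_DR G (DR_class G \<alpha>) = DR_class G 0"
      unfolding d_DR_def using d \<alpha>' DR_class_eq_0_iff by blast
  qed
qed

text \<open>Renames the arrows in L and sends all others to 0. A word survives exactly if all its
  letters do, so the map is multiplicative on the whole algebra even when only part of the arrows
  can be renamed.\<close>

definition partial_relabel :: "'e set \<Rightarrow> ('e \<Rightarrow> 'f) \<Rightarrow> ('v, 'e, 'k::comm_ring_1) palg \<Rightarrow> ('v, 'f, 'k) palg" where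
  "partial_relabel L f = lin (\<lambda>(v, xs, u). if set xs \<subseteq> L then basis (v, map f xs, u) else 0)"

lemma partial_relabel_add: "partial_relabel L f (x + y) = partial_relabel L f x + partial_relabel L f y"
  by (simp add: partial_relabel_def lin_add)

lemma partial_relabel_diff: "partial_relabel L f (x - y) = partial_relabel L f x - partial_relabel L f y"
  by (simp add: partial_relabel_def lin_diff)

lemma partial_relabel_pscale: "partial_relabel L f (pscale c x) = pscale c (partial_relabel L f x)"
  by (simp add: partial_relabel_def lin_pscale)

lemma partial_relabel_0 [simp]: "partial_relabel L f 0 = 0"
  by (simp add: partial_relabel_def)

lemma partial_relabel_basis [simp]:
  "partial_relabel L f (basis (v, xs, u)) = (if set xs \<subseteq> L then basis (v, map f xs, u) else 0)"
  by (simp add: partial_relabel_def)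

lemma partial_relabel_mult: "partial_relabel L f (x \<star> y) = partial_relabel L f x \<star> partial_relabel L f y"
proof -
  have *: "partial_relabel L f (basis p \<star> y) = partial_relabel L f (basis p) \<star> partial_relabel L f y" for p
    using subset_UNIV[of "Poly_Mapping.keys y"]
    by (cases p, induction y rule: palg_induct)
       (auto simp: palg_mult_simps partial_relabel_add partial_relabel_pscale path_mult_def)
  show ?thesis
    using subset_UNIV[of "Poly_Mapping.keys x"]
    by (induction x rule: palg_induct)
       (simp_all add: palg_mult_simps partial_relabel_add partial_relabel_pscale *)
qed

text \<open>Weight and form degree enter the Koszul signs symmetrically, so exchanging them preserves
  graded commutators.\<close>

lemma partial_relabel_commutator_space:
  fixes x :: "('v, 'e, 'k::comm_ring_1) palg" and f :: "'e \<Rightarrow> 'f"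
  assumes wf: "wf_digraph (quiver G)" "wf_digraph (quiver G')"
    and L: "\<And>x. x \<in> L \<Longrightarrow> x \<in> arcs (quiver G) \<Longrightarrow> f x \<in> arcs (quiver G') \<and>
      head (quiver G') (f x) = head (quiver G) x \<and> tail (quiver G') (f x) = tail (quiver G) x \<and>
      weight G' (f x) = form_degree G x \<and> form_degree G' (f x) = weight G x"
    and V: "verts (quiver G) \<subseteq> verts (quiver G')"
    and x: "x \<in> commutator_space G"
  shows "partial_relabel L f x \<in> commutator_space G'"
  using x
proof (rule linear_commutator_space)
  have path: "(v, map f xs, u) \<in> paths (quiver G') \<and>
      path_weight G' (v, map f xs, u) = path_form_degree G (v, xs, u) \<and>
      path_form_degree G' (v, map f xs, u) = path_weight G (v, xs, u)"
    if "(v, xs, u) \<in> paths (quiver G)" "set xs \<subseteq> L" for v xs u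
    using that
  proof (induction xs arbitrary: v)
    case Nil
    then show ?case using V by (auto simp: paths_Nil path_weight_def path_form_degree_def)
  next
    case (Cons x xs)
    then have x: "x \<in> arcs (quiver G)" "v = head (quiver G) x" "x \<in> L"
      and xs: "(tail (quiver G) x, xs, u) \<in> paths (quiver G)" "set xs \<subseteq> L"
      by (simp_all add: paths_Cons[OF wf(1)])
    show ?case using L[OF x(3,1)] Cons.IH[OF xs]
      by (simp add: x(2) paths_Cons[OF wf(2)] path_weight_def path_form_degree_def)
  qed
  have hom: "partial_relabel L f u \<in> homogeneous G' j i" if "u \<in> homogeneous G i j" for i j and u :: "('v, 'e, 'k) palg"
  proof -
    have "Poly_Mapping.keys (partial_relabel L f u) \<subseteq>
        {p \<in> paths (quiver G'). path_weight G' p = j \<and> path_form_degree G' p = i}"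
      unfolding partial_relabel_def
    proof (rule keys_lin, clarify del: subsetI)
      fix v xs w assume "(v, xs, w) \<in> Poly_Mapping.keys u"
      then have "(v, xs, w) \<in> paths (quiver G)" "path_weight G (v, xs, w) = i" "path_form_degree G (v, xs, w) = j"
        using that by (auto simp: homogeneous_def path_algebra_def)
      with path[OF this(1)] show "Poly_Mapping.keys (if set xs \<subseteq> L then basis (v, map f xs, w) else 0 :: ('v, 'f, 'k) palg)
          \<subseteq> {p \<in> paths (quiver G'). path_weight G' p = j \<and> path_form_degree G' p = i}"
        by (simp add: basis_def)
    qed
    then show ?thesis by (auto simp: homogeneous_def path_algebra_def)
  qed
  fix i j i' j' and u v :: "('v, 'e, 'k) palg"
  assume "u \<in> homogeneous G i j" "v \<in> homogeneous G i' j'"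
  from commutator_in[OF hom[OF this(1)] hom[OF this(2)]]
  show "partial_relabel L f (u \<star> v - pscale (koszul (i * i' + j * j')) (v \<star> u)) \<in> commutator_space G'"
    by (simp only: partial_relabel_diff partial_relabel_pscale partial_relabel_mult add.commute)
qed (simp_all add: partial_relabel_add partial_relabel_pscale)


section \<open>The bracket of the potential\<close>

lemma hat_quiver_simps [simp]:
  "verts (quiver (hat_quiver Q)) = verts Q"
  "arcs (quiver (hat_quiver Q)) = Plain ` arcs Q \<union> Hat ` arcs Q"
  "tail (quiver (hat_quiver Q)) x = tail Q (unhat x)" "head (quiver (hat_quiver Q)) x = head Q (unhat x)"
  "weight (hat_quiver Q) (Plain e) = 0" "weight (hat_quiver Q) (Hat e) = 1"
  by (simp_all add: hat_quiver_def)

lemma wf_Pbar: "wf_digraph Q \<Longrightarrow> wf_digraph (quiver (Pbar Q))"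
  unfolding Pbar_def by (rule wf_double_quiver) (auto simp: wf_digraph_def)

lemma Pbar_simps [simp]:
  "verts (quiver (Pbar Q)) = verts Q"
  "tail (quiver (Pbar Q)) (Orig x) = tail Q (unhat x)" "tail (quiver (Pbar Q)) (Star x) = head Q (unhat x)"
  "head (quiver (Pbar Q)) (Orig x) = head Q (unhat x)" "head (quiver (Pbar Q)) (Star x) = tail Q (unhat x)"
  "weight (Pbar Q) (Orig x) = weight (hat_quiver Q) x" "weight (Pbar Q) (Star x) = 2 - weight (hat_quiver Q) x"
  "form_degree (Pbar Q) = (\<lambda>_. 0)"
  by (simp_all add: Pbar_def)

lemma arcs_Pbar [simp]:
  "Orig x \<in> arcs (quiver (Pbar Q)) \<longleftrightarrow> unhat x \<in> arcs Q"
  "Star x \<in> arcs (quiver (Pbar Q)) \<longleftrightarrow> unhat x \<in> arcs Q"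
  by (cases x; auto simp: Pbar_def)+

lemma paths_Pbar_Orig:
  assumes "wf_digraph Q"
  shows "(v, map Orig xs, u) \<in> paths (quiver (Pbar Q)) \<longleftrightarrow> (v, map unhat xs, u) \<in> paths Q"
  by (induction xs arbitrary: v)
    (simp_all add: paths_Nil paths_Cons[OF assms] paths_Cons[OF wf_Pbar[OF assms]])

lemma omega_eq_darboux_form:
  assumes "finite (arcs Q)"
  shows "omega Q = darboux_form 2 (hat_quiver Q)"
  unfolding omega_def darboux_form_def Let_def Pbar_def hat_quiver_simps
  by (subst sum.union_disjoint) (auto simp: assms sum.reindex inj_on_def sum.distrib)

text \<open>Multiplication is a bimodule map for the outer structure, so m after \<Theta> is an
  ordinary graded derivation and only the products m(\<Theta>(x)) on arrows matter.\<close>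

lemma mult2_double_derivation_basis:
  assumes wf: "wf_digraph (quiver G)" and \<Theta>: "\<Theta> \<in> double_derivations G m n"
  shows "(v, xs, u) \<in> paths (quiver G) \<Longrightarrow> mult2 (\<Theta> (basis (v, xs, u))) =
     (\<Sum>i<length xs. pscale (bisign G m n (take i xs))
        (basis (v, take i xs, head (quiver G) (xs ! i)) \<star> mult2 (\<Theta> (arrow (quiver G) (xs ! i))) \<star>
         basis (tail (quiver G) (xs ! i), drop (Suc i) xs, u)))"
proof (induction xs arbitrary: v)
  case Nil
  then show ?case by (auto simp: paths_Nil double_derivation_vertex[OF wf \<Theta>])
next
  case (Cons x xs)
  then have x: "x \<in> arcs (quiver G)" "v = head (quiver G) x" "(tail (quiver G) x, xs, u) \<in> paths (quiver G)"
    by (auto simp: paths_Cons[OF wf])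
  let ?\<Theta>x = "\<Theta> (arrow (quiver G) x)"
  have h: "basis (v, [], v) \<star> mult2 ?\<Theta>x = mult2 ?\<Theta>x"
    using outer_left_idem(2)[OF double_derivation_arrow_corners[OF wf \<Theta> x(1)]]
    by (simp add: x(2) flip: mult2_outer_left)
  have b: "arrow (quiver G) x \<star> (basis (tail (quiver G) x, zs, w) \<star> y) = basis (v, x # zs, w) \<star> y" for zs w y
    by (simp add: x(2) basis_Cons palg_mult_assoc del: palg_mult_basis)
  show ?case
    unfolding length_Cons sum.lessThan_Suc_shift x(2)
    unfolding basis_Cons double_derivation_arrow_mult[OF wf \<Theta> x(1) path_algebra_basis[OF x(3)]]
    by (simp add: mult2_add mult2_pscale mult2_outer_left mult2_outer_right Cons.IH[OF x(3)]
        palg_mult_sum_right pscale_sum palg_mult_simps palg_mult_assoc h[unfolded x(2)] b[unfolded x(2)]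
        koszul_add distrib_left mult_ac del: palg_mult_basis)
qed

text \<open>The odd derivation \<open>a \<mapsto> \<^bold>a\<close>, \<open>\<^bold>a \<mapsto> 0\<close>, where \<open>\<^bold>a\<close> is the arrow \<open>Hat a\<close>, applied to a word.\<close>

definition hat_sum ::
  "'v \<Rightarrow> 'a hatted list \<Rightarrow> 'v \<Rightarrow> ('v, 'a) pre_digraph \<Rightarrow> ('v, 'a hatted, 'k::comm_ring_1) palg" where
  "hat_sum v xs u Q = (\<Sum>i<length xs. case xs ! i of
      Plain e \<Rightarrow> pscale (bisign (hat_quiver Q) 1 0 (take i xs)) (basis (v, xs[i := Hat e], u))
    | Hat e \<Rightarrow> 0)"

section \<open>The Hamiltonian derivation of S and the bracket {S, S}\<close>

context
  fixes Q :: "('v, 'a) pre_digraph" and v u :: 'v and xs :: "'a hatted list"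
    and S :: "('v, 'a hatted doubled, 'k::comm_ring_1) palg"
  assumes fin: "fin_digraph Q" and p: "(v, map unhat xs, u) \<in> paths Q"
    and wt: "sum_list (map (weight (hat_quiver Q)) xs) = 3"
    and S: "S = S0 Q + basis (v, map Orig xs, u)"
begin

private abbreviation (input) "G \<equiv> Pbar Q"
private abbreviation (input) "\<Theta> \<equiv> hamiltonian (Pbar Q) 2 (omega Q) 3 S"

private lemma wf: "wf_digraph Q" and wfG: "wf_digraph (quiver G)" and finite_arcs: "finite (arcs Q)"
  using fin wf_Pbar[of Q] by (auto simp: fin_digraph_def fin_digraph_axioms_def)

private lemma pG: "(v, map Orig xs, u) \<in> paths (quiver G)"
  using p by (simp add: paths_Pbar_Orig[OF wf])

private lemma S0_term: "arrow (quiver G) (star_arrow e) \<star> arrow (quiver G) (hat_arrow e) =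
    basis (tail Q e, [star_arrow e, hat_arrow e], tail Q e)"
  by (simp add: arrow_def path_mult_def)

private lemma S_homogeneous: "S \<in> homogeneous G 3 0"
proof -
  have "Poly_Mapping.keys S \<subseteq> {p \<in> paths (quiver G). path_weight G p = 3 \<and> path_form_degree G p = 0}"
    unfolding S S0_def S0_term
    using pG wt wf_digraph.tail_in_verts[OF wf]
    by (intro keys_add_subset keys_sum_subset)
      (auto simp: arrow_def path_mult_def basis_def path_weight_def path_form_degree_def comp_def
        paths_Cons[OF wfG] paths_Nil)
  then show ?thesis by (auto simp: homogeneous_def path_algebra_def)
qed

private lemma \<Theta>_double_derivation: "\<Theta> \<in> double_derivations G 1 0"
  and \<Theta>_arrow: "f \<in> arcs (quiver G) \<Longrightarrow> \<Theta> (arrow (quiver G) f) = ham_arrow G 1 S f"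
proof -
  have "wf_digraph (quiver (hat_quiver Q))" "finite (arcs (quiver (hat_quiver Q)))"
    using wf finite_arcs by (auto simp: wf_digraph_def)
  from hamiltonian_darboux[OF this Pbar_def S_homogeneous]
  show "\<Theta> \<in> double_derivations G 1 0"
    "f \<in> arcs (quiver G) \<Longrightarrow> \<Theta> (arrow (quiver G) f) = ham_arrow G 1 S f"
    by (simp_all add: omega_eq_darboux_form[OF finite_arcs])
qed

text \<open>S is homogeneous, so the sum over weights in \<open>double_bracket\<close> has the
  single term of weight 3. For S = 0 that sum is empty, and both sides vanish.\<close>

private lemma bracket_eq: "bracket G 2 (omega Q) S S = mult2 (\<Theta> S)"
proof -
  have w: "weights G S \<subseteq> {3}" using S_homogeneous by (auto simp: weights_def homogeneous_def)
  have "weight_part G 3 S = lin (\<lambda>p. Poly_Mapping.single p 1) S"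
    unfolding weight_part_def using S_homogeneous
    by (intro lin_cong) (auto simp: homogeneous_def basis_def)
  then have ww: "weight_part G 3 S = S" by (simp add: lin_single_id)
  show ?thesis
  proof (cases "S = 0")
    case True
    then show ?thesis
      using double_derivation_0[OF wfG \<Theta>_double_derivation] by (simp add: bracket_def double_bracket_def weights_def)
  next
    case False
    then have "weights G S \<noteq> {}" by (simp add: weights_def)
    then have "weights G S = {3}" using w by blast
    then show ?thesis by (simp add: bracket_def double_bracket_def ww)
  qed
qed

private lemma ham_arrow_S: "ham_arrow G 1 S f =
    (\<Sum>e\<in>arcs Q. ham_arrow G 1 (basis (tail Q e, [star_arrow e, hat_arrow e], tail Q e)) f) +
    ham_arrow G 1 (basis (v, map Orig xs, u)) f"
  unfolding S S0_def S0_term by (simp only: ham_arrow_def lin_add lin_sum)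

text \<open>The dual a* occurs in S once, as the first letter of a* \<open>Hat a\<close> in
  \<open>S0\<close>. There p has weight 1, q weight 0 and a* weight 2, so the sign is
  \<open>koszul 2\<close> = 1.\<close>

private lemma mult2_\<Theta>_plain: "e \<in> arcs Q \<Longrightarrow> mult2 (\<Theta> (arrow (quiver G) (a_arrow e))) = arrow (quiver G) (hat_arrow e)"
proof -
  assume e: "e \<in> arcs Q"
  have "ham_arrow G 1 (basis (tail Q e', [star_arrow e', hat_arrow e'], tail Q e')) (a_arrow e) =
      (if e' = e then Poly_Mapping.single ((head Q e, [hat_arrow e], tail Q e), (tail Q e, [], tail Q e)) (1::'k) else 0)" for e'
    by (simp add: ham_arrow_def pair_sign_def Let_def path_weight_def lessThan_Suc koszul_def)
  moreover have "ham_arrow G 1 (basis (v, map Orig xs, u)) (a_arrow e) = (0 :: ('v, 'a hatted doubled, 'k) palg2)"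
    by (simp add: ham_arrow_def)
  ultimately have "\<Theta> (arrow (quiver G) (a_arrow e)) =
      Poly_Mapping.single ((head Q e, [hat_arrow e], tail Q e), (tail Q e, [], tail Q e)) 1"
    using e finite_arcs by (simp add: \<Theta>_arrow ham_arrow_S)
  then show ?thesis by (simp add: mult2_single path_mult_def arrow_def)
qed

text \<open>The arrow dual to \<open>Hat e\<close> does not occur in S.\<close>

private lemma \<Theta>_hat: "e \<in> arcs Q \<Longrightarrow> \<Theta> (arrow (quiver G) (hat_arrow e)) = 0"
  by (simp add: \<Theta>_arrow ham_arrow_S) (simp add: ham_arrow_def lessThan_Suc)

text \<open>The words of \<open>S0\<close> contain no plain arrow, so only the occurrences of e in
  the added word contribute. The minus sign is that of \<open>pair_sign\<close> at an
  \<open>Orig\<close> arrow, and e has weight 0.\<close>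

private lemma mult2_\<Theta>_star: "e \<in> arcs Q \<Longrightarrow> mult2 (\<Theta> (arrow (quiver G) (star_arrow e))) =
    (\<Sum>i<length xs. if xs ! i = Plain e then
       pscale (- koszul (path_weight G (tail Q e, map Orig (drop (Suc i) xs), u) * path_weight G (v, map Orig (take i xs), head Q e)))
        (basis (tail Q e, map Orig (drop (Suc i) xs), u) \<star> basis (v, map Orig (take i xs), head Q e)) else 0)"
proof -
  assume e: "e \<in> arcs Q"
  have "ham_arrow G 1 (basis (tail Q e', [star_arrow e', hat_arrow e'], tail Q e')) (star_arrow e) =
      (0 :: ('v, 'a hatted doubled, 'k) palg2)" for e'
    by (simp add: ham_arrow_def lessThan_Suc)
  then have "\<Theta> (arrow (quiver G) (star_arrow e)) = ham_arrow G 1 (basis (v, map Orig xs, u)) (star_arrow e)"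
    using e by (simp add: \<Theta>_arrow ham_arrow_S)
  then show ?thesis
    by (auto simp: ham_arrow_def pair_sign_def Let_def mult2_def lin_sum lin_pscale drop_map take_map
        simp del: palg_mult_basis simp flip: single_eq_pscale intro!: sum.cong)
qed

private lemma xs_arcs: "i < length xs \<Longrightarrow> unhat (xs ! i) \<in> arcs Q"
  using path_word_arcs[OF wf p] nth_mem[of i xs] by auto

private lemma mult2_\<Theta>_word: "mult2 (\<Theta> (basis (v, map Orig xs, u))) = relabel Orig (hat_sum v xs u Q)"
  unfolding mult2_double_derivation_basis[OF wfG \<Theta>_double_derivation pG] hat_sum_def relabel_sum length_map
proof (intro sum.cong refl)
  fix i assume "i \<in> {..<length xs}"
  then have i: "i < length xs" by simp
  then show "pscale (bisign G 1 0 (take i (map Orig xs)))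
      (basis (v, take i (map Orig xs), head (quiver G) (map Orig xs ! i)) \<star>
       mult2 (\<Theta> (arrow (quiver G) (map Orig xs ! i))) \<star>
       basis (tail (quiver G) (map Orig xs ! i), drop (Suc i) (map Orig xs), u)) =
     relabel Orig (case xs ! i of
       Plain e \<Rightarrow> pscale (bisign (hat_quiver Q) 1 0 (take i xs)) (basis (v, xs[i := Hat e], u)) | Hat e \<Rightarrow> 0)"
    using xs_arcs[OF i]
    by (cases "xs ! i")
      (simp_all add: mult2_\<Theta>_plain \<Theta>_hat relabel_pscale take_map drop_map comp_def
        map_update upd_conv_take_nth_drop, simp add: arrow_def path_mult_def)
qed

text \<open>{S, S} is the sum of the images of \<open>S0\<close> and of the added word under m after
  \<Theta>. At each plain letter the first contributes a rotation of the second with the same sign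
  modulo commutators, whence the factor 2.\<close>

lemma bracket_mod_commutators:
  "function_form (bracket G 2 (omega Q) S S) - pscale 2 (function_form (relabel Orig (hat_sum v xs u Q)))
     \<in> commutator_space (forms G)"
proof -
  let ?A = "arrow (quiver G)" and ?pl = "\<lambda>i. xs ! i = Plain (unhat (xs ! i))"
  let ?q = "\<lambda>i. (v, map Orig (take i xs), head Q (unhat (xs ! i)))"
  let ?p = "\<lambda>i. (tail Q (unhat (xs ! i)), map Orig (drop (Suc i) xs), u)"
  let ?c = "\<lambda>i. koszul (path_weight G (?p i) * path_weight G (?q i)) :: 'k"
  let ?h = "\<lambda>i. ?A (hat_arrow (unhat (xs ! i)))"
  have star: "mult2 (\<Theta> (?A (star_arrow e) \<star> ?A (hat_arrow e))) = 
      (\<Sum>i<length xs. if xs ! i = Plain e then pscale (- ?c i) (basis (?p i) \<star> (basis (?q i) \<star> ?h i)) else 0)"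
    if e: "e \<in> arcs Q" for e
  proof -
    \<comment> \<open>The second Leibniz term vanishes by \<open>\<Theta>_hat\<close>.\<close>
    have "mult2 (\<Theta> (?A (star_arrow e) \<star> ?A (hat_arrow e))) = mult2 (\<Theta> (?A (star_arrow e))) \<star> ?A (hat_arrow e)"
      using double_derivation_arrow_mult[OF wfG \<Theta>_double_derivation, of "star_arrow e" "?A (hat_arrow e)"] e
      by (simp add: \<Theta>_hat mult2_outer_right arrow_in[OF wfG])
    then show ?thesis unfolding mult2_\<Theta>_star[OF e] palg_mult_sum_left
      by (auto simp: palg_mult_simps palg_mult_assoc simp del: palg_mult_basis pm.scale_minus_left
          intro!: sum.cong)
  qed
  have SA: "?A (star_arrow e) \<star> ?A (hat_arrow e) \<in> path_algebra (quiver G)" if "e \<in> arcs Q" for e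
    using that by (intro path_algebra_mult wfG arrow_in) simp_all
  have "mult2 (\<Theta> (S0 Q)) = (\<Sum>e\<in>arcs Q. mult2 (\<Theta> (?A (star_arrow e) \<star> ?A (hat_arrow e))))"
    unfolding S0_def by (simp add: double_derivation_sum[OF wfG \<Theta>_double_derivation SA] mult2_sum)
  also have "\<dots> = (\<Sum>e\<in>arcs Q. \<Sum>i<length xs. if xs ! i = Plain e then pscale (- ?c i) (basis (?p i) \<star> (basis (?q i) \<star> ?h i)) else 0)"
    by (intro sum.cong refl star)
  also have "\<dots> = (\<Sum>i<length xs. case xs ! i of
      Plain e \<Rightarrow> pscale (- ?c i) (basis (?p i) \<star> (basis (?q i) \<star> ?h i)) | Hat e \<Rightarrow> 0)"
  proof (subst sum.swap, intro sum.cong refl)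
    fix i assume "i \<in> {..<length xs}"
    then show "(\<Sum>e\<in>arcs Q. if xs ! i = Plain e then pscale (- ?c i) (basis (?p i) \<star> (basis (?q i) \<star> ?h i)) else 0) =
        (case xs ! i of Plain e \<Rightarrow> pscale (- ?c i) (basis (?p i) \<star> (basis (?q i) \<star> ?h i)) | Hat e \<Rightarrow> 0)"
      using xs_arcs[of i] by (cases "xs ! i") (simp_all add: finite_arcs del: palg_mult_basis pm.scale_minus_left)
  qed
  finally have s0: "mult2 (\<Theta> (S0 Q)) = (\<Sum>i<length xs. case xs ! i of
      Plain e \<Rightarrow> pscale (- ?c i) (basis (?p i) \<star> (basis (?q i) \<star> ?h i)) | Hat e \<Rightarrow> 0)" .
  have S0A: "S0 Q \<in> path_algebra (quiver G)"
    unfolding S0_def by (intro path_algebra_sum SA)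
  have "function_form (mult2 (\<Theta> (S0 Q))) - function_form (relabel Orig (hat_sum v xs u Q)) \<in> commutator_space (forms G)"
    unfolding s0 hat_sum_def relabel_sum sum_subtractf[symmetric]
  proof (rule commutator_space_sum)
    fix i assume "i \<in> {..<length xs}"
    then have i: "i < length xs" by simp
    show "function_form (case xs ! i of
        Plain e \<Rightarrow> pscale (- ?c i) (basis (?p i) \<star> (basis (?q i) \<star> ?h i)) | Hat e \<Rightarrow> 0) -
      function_form (relabel Orig (case xs ! i of
        Plain e \<Rightarrow> pscale (bisign (hat_quiver Q) 1 0 (take i xs)) (basis (v, xs[i := Hat e], u)) | Hat e \<Rightarrow> 0))
      \<in> commutator_space (forms G)"
    proof (cases "xs ! i")
      case (Plain e)
      let ?wp = "sum_list (map (weight (hat_quiver Q)) (drop (Suc i) xs))"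
        and ?wq = "sum_list (map (weight (hat_quiver Q)) (take i xs))"
        and ?FQ = "basis (v, map Fn (map Orig (take i xs) @ [hat_arrow e]), tail Q e) :: ('v, 'a hatted doubled form, 'k) palg"
        and ?FP = "basis (tail Q e, map Fn (map Orig (drop (Suc i) xs)), u) :: ('v, 'a hatted doubled form, 'k) palg"
      have e: "e \<in> arcs Q" using xs_arcs[OF i] Plain by simp
      have P: "?p i \<in> paths (quiver G)" "(v, map Orig (take i xs), head Q e) \<in> paths (quiver G)"
        using path_split[OF wf p, of i] i Plain
        by (simp_all add: paths_Pbar_Orig[OF wf] take_map drop_map)
      have ff: "map form_arrow (map Fn zs) = zs" for zs :: "'a hatted doubled list"
        by simp
      have "(v, map Orig (take i xs) @ [hat_arrow e], tail Q e) \<in> paths (quiver G)"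
        using P(2) e by (auto simp: paths_append[OF wfG] paths_single[OF wfG])
      then have "(v, map Fn (map Orig (take i xs) @ [hat_arrow e]), tail Q e) \<in> paths (quiver (forms G))"
        "(tail Q e, map Fn (map Orig (drop (Suc i) xs)), u) \<in> paths (quiver (forms G))"
        using P(1) Plain by (simp_all add: paths_form_quiver[OF wfG] ff del: map_map map_append)
      from this[THEN basis_homogeneous]
      have hom: "?FQ \<in> homogeneous (forms G) (?wq + 1) 0" "?FP \<in> homogeneous (forms G) ?wp 0"
        by (simp_all add: path_weight_def path_form_degree_def comp_def del: map_map map_append)
          (simp_all add: comp_def forms_def)
      have wpq: "?wp + ?wq = 3"
        using sum_list_split[OF i, of "weight (hat_quiver Q)"] wt Plain by simp
      \<comment> \<open>Modulo 2 the exponents add up to \<open>?wp\<close>. As the letter at i has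
        weight 0, \<open>?wp\<close> = 3 - \<open>?wq\<close>, whose parity is opposite to that of
        \<open>?wq\<close>; this minus cancels the one in - \<open>?c i\<close>.\<close>
      have sign: "(koszul (?wp * ?wq) :: 'k) * koszul (?wp * (?wq + 1)) = - koszul ?wq"
      proof -
        have "?wp = 3 - ?wq" using wpq by simp
        then show ?thesis unfolding koszul_def by (simp split: if_split)
      qed
      have c: "?c i = koszul (?wp * ?wq)"
        by (simp add: path_weight_def comp_def)
      have Q: "basis (?q i) \<star> ?h i = basis (v, map Orig (take i xs) @ [hat_arrow e], tail Q e)"
        using Plain by (simp add: arrow_def path_mult_def)
      have "function_form (basis (?p i) \<star> (basis (?q i) \<star> ?h i)) = ?FP \<star> ?FQ"
        unfolding Q relabel_mult using Plain by simp
      moreover have "function_form (relabel Orig (basis (v, xs[i := Hat e], u))) = ?FQ \<star> ?FP"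
        using i by (simp add: path_mult_def upd_conv_take_nth_drop)
      ultimately have "function_form (pscale (- ?c i) (basis (?p i) \<star> (basis (?q i) \<star> ?h i))) -
          function_form (relabel Orig (pscale (bisign (hat_quiver Q) 1 0 (take i xs)) (basis (v, xs[i := Hat e], u)))) =
          pscale (- ?c i) (?FP \<star> ?FQ) - pscale (koszul ?wq) (?FQ \<star> ?FP)"
        by (simp only: relabel_pscale) simp
      also have "\<dots> = pscale (- ?c i) (?FP \<star> ?FQ - pscale (koszul (?wp * (?wq + 1) + 0 * 0)) (?FQ \<star> ?FP))"
        unfolding c pm.scale_right_diff_distrib pscale_pscale
        by (simp add: sign del: palg_mult_basis)
      also have "\<dots> \<in> commutator_space (forms G)"
        by (intro commutator_space_pscale commutator_in hom)
      finally show ?thesis using Plain by simp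
    next
      case (Hat e)
      then show ?thesis by (simp add: commutator_space_0)
    qed
  qed
  moreover have "mult2 (\<Theta> S) = mult2 (\<Theta> (S0 Q)) + relabel Orig (hat_sum v xs u Q)"
    unfolding S by (simp only: double_derivation_add[OF wfG \<Theta>_double_derivation[unfolded S] S0A path_algebra_basis[OF pG]]
      mult2_add mult2_\<Theta>_word[unfolded S])
  moreover have "pscale 2 x = x + x" for x :: "('v, 'a hatted doubled form, 'k) palg"
    using pscale_left_add[of 1 1 x] by simp
  ultimately show ?thesis
    unfolding bracket_eq by (simp add: relabel_add)
qed
end


section \<open>Exchanging the two gradings\<close>

text \<open>\<open>Hat e\<close> has bidegree (1, 0), the differential of e has (0, 1) and e itself
  has (0, 0); the map is an involution.\<close>

fun swap_letter :: "'a hatted doubled form \<Rightarrow> 'a hatted doubled form" where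
  "swap_letter (Fn (Orig (Hat e))) = Dif (Orig (Plain e))"
| "swap_letter (Dif (Orig (Plain e))) = Fn (Orig (Hat e))"
| "swap_letter y = y"

text \<open>The letters on which \<open>swap_letter\<close> exchanges weight and form degree.\<close>

definition swappable :: "'a hatted doubled form set" where
  "swappable = range (\<lambda>e. Fn (Orig (Plain e))) \<union> range (\<lambda>e. Fn (Orig (Hat e))) \<union> range (\<lambda>e. Dif (Orig (Plain e)))"

lemma swap_commutator_space:
  fixes Q :: "('v, 'a) pre_digraph"
  assumes wf: "wf_digraph Q" and x: "x \<in> commutator_space (forms (Pbar Q))"
  shows "partial_relabel swappable swap_letter x \<in> commutator_space (forms (Pbar Q))"
proof (rule partial_relabel_commutator_space[OF _ _ _ _ x])
  show "wf_digraph (quiver (forms (Pbar Q)))" "wf_digraph (quiver (forms (Pbar Q)))"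
    using wf_form_quiver[OF wf_Pbar[OF wf]] by simp_all
  fix y :: "'a hatted doubled form"
  assume "y \<in> swappable" and "y \<in> arcs (quiver (forms (Pbar Q)))"
  then have y: "y \<in> swappable" "form_arrow y \<in> arcs (quiver (Pbar Q))" by auto
  then have "form_arrow (swap_letter y) \<in> arcs (quiver (Pbar Q))" by (auto simp: swappable_def)
  then have "swap_letter y \<in> arcs (quiver (forms (Pbar Q)))"
    by (cases "swap_letter y") auto
  with y show "swap_letter y \<in> arcs (quiver (forms (Pbar Q))) \<and>
     head (quiver (forms (Pbar Q))) (swap_letter y) = head (quiver (forms (Pbar Q))) y \<and>
     tail (quiver (forms (Pbar Q))) (swap_letter y) = tail (quiver (forms (Pbar Q))) y \<and>
     weight (forms (Pbar Q)) (swap_letter y) = form_degree (forms (Pbar Q)) y \<and>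
     form_degree (forms (Pbar Q)) (swap_letter y) = weight (forms (Pbar Q)) y"
    by (auto simp: swappable_def)
qed simp

text \<open>Reads \<open>Hat e\<close> as the differential of e. A single word over
  \<open>hatted\<close> letters thus encodes both the potential (through \<open>Orig\<close>) and
  the differential form.\<close>

primrec dif_letter :: "'a hatted \<Rightarrow> 'a hatted doubled form" where
  "dif_letter (Plain e) = Fn (Orig (Plain e))"
| "dif_letter (Hat e) = Dif (Orig (Plain e))"

lemma partial_relabel_relabel:
  assumes "\<And>x. f x \<in> L" and "\<And>x. g (f x) = h x"
  shows "partial_relabel L g (relabel f y) = relabel h y"
  unfolding partial_relabel_def relabel_def lin_lin
  using assms by (intro lin_cong) (auto simp: comp_def)

text \<open>The same partial relabelling carries either element to the other, since both use
  swappable letters only and \<open>swap_letter\<close> is an involution.\<close>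

lemma commutator_space_hat_dif:
  assumes "wf_digraph Q"
  shows "function_form (relabel Orig y) \<in> commutator_space (forms (Pbar Q)) \<longleftrightarrow>
    relabel dif_letter y \<in> commutator_space (forms (Pbar Q))"
proof -
  have "function_form (relabel Orig y) = relabel (\<lambda>x. Fn (Orig x)) y"
    unfolding relabel_def lin_lin by (intro lin_cong) (auto simp: comp_def)
  moreover have "partial_relabel swappable swap_letter (relabel (\<lambda>x. Fn (Orig x)) y) = relabel dif_letter y"
    by (rule partial_relabel_relabel; case_tac x; auto simp: swappable_def)
  moreover have "partial_relabel swappable swap_letter (relabel dif_letter y) = relabel (\<lambda>x. Fn (Orig x)) y"
    by (rule partial_relabel_relabel; case_tac x; auto simp: swappable_def)
  ultimately show ?thesis using swap_commutator_space[OF assms] by metis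
qed

text \<open>The form degree of \<open>dif_letter x\<close> is the weight of x, so d collects the
  same signs as the odd derivation behind \<open>hat_sum\<close>.\<close>

lemma d_form_dif_word: "d_form (basis (v, map dif_letter xs, u)) = relabel dif_letter (hat_sum v xs u Q)"
  unfolding d_form_basis d_path_def hat_sum_def relabel_sum
proof (intro sum.cong)
  fix i assume "i \<in> {..<length xs}"
  moreover have "dif_count (dif_letter x) = weight (hat_quiver Q) x" for x by (cases x) simp_all
  ultimately show "(case path_word (v, map dif_letter xs, u) ! i of
      Fn x \<Rightarrow> pscale (koszul (sum_list (map dif_count (take i (path_word (v, map dif_letter xs, u))))))
          (basis (path_head (v, map dif_letter xs, u), (path_word (v, map dif_letter xs, u))[i := Dif x],
             path_tail (v, map dif_letter xs, u)))
    | Dif x \<Rightarrow> 0) =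
    relabel dif_letter (case xs ! i of
      Plain e \<Rightarrow> pscale (bisign (hat_quiver Q) 1 0 (take i xs)) (basis (v, xs[i := Hat e], u)) | Hat e \<Rightarrow> 0)"
    by (cases "xs ! i") (simp_all add: relabel_pscale map_update take_map comp_def)
qed simp

theorem lemma8p5:
  fixes Q :: "('v, 'a) pre_digraph"
    and a b c :: 'a
    and p q r s :: "('v, 'a) path"
    and \<phi> :: "('v, 'a form, 'k::field_char_0) palg"
    and \<phi>_hat S :: "('v, 'a hatted doubled, 'k) palg"
    and \<omega> :: "('v, 'a hatted doubled form, 'k) palg"
  assumes "fin_digraph Q" and "arcs Q \<noteq> {}"
    and "a \<in> arcs Q" and "b \<in> arcs Q" and "c \<in> arcs Q"
    and "p \<in> paths Q" and "q \<in> paths Q" and "r \<in> paths Q" and "s \<in> paths Q"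
    and "path_head p = tail Q a" and "head Q a = path_tail q"
    and "path_head q = tail Q b" and "head Q b = path_tail r"
    and "path_head r = tail Q c" and "head Q c = path_tail s"
    and "\<omega> = omega Q"
    and "\<phi> = phi Q s c r b q a p"
    and "\<phi>_hat = phi_hat Q s c r b q a p"
    and "S = S0 Q + \<phi>_hat"
  shows "DR_class (Pbar Q) (function_form (bracket (Pbar Q) 2 \<omega> S S)) = DR_class (Pbar Q) 0 \<longleftrightarrow>
    d_DR (Pbar Q) (DR_class (Pbar Q) (forms_inclusion \<phi>)) = DR_class (Pbar Q) 0"
proof -
  let ?C = "commutator_space (forms (Pbar Q)) :: ('v, 'a hatted doubled form, 'k) palg set"
  have wf: "wf_digraph Q" using assms(1) by (simp add: fin_digraph_def)
  obtain vp xp up where p: "p = (vp, xp, up)" by (cases p)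
  obtain vq xq uq where q: "q = (vq, xq, uq)" by (cases q)
  obtain vr xr ur where r: "r = (vr, xr, ur)" by (cases r)
  obtain vs xs us where s: "s = (vs, xs, us)" by (cases s)
  \<comment> \<open>The common word: \<open>map Orig ys\<close> spells the potential,
    \<open>map dif_letter ys\<close> spells \<phi>.\<close>
  define ys where "ys = map Plain xs @ Hat c # map Plain xr @ Hat b # map Plain xq @ Hat a # map Plain xp"
  have ends: "vp = tail Q a" "head Q a = uq" "vq = tail Q b" "head Q b = ur" "vr = tail Q c" "head Q c = us"
    using assms(10-15) by (simp_all add: p q r s)
  have path: "(vs, map unhat ys, up) \<in> paths Q"
    using assms(3-9) ends
    by (auto simp: ys_def p q r s comp_def paths_append[OF wf] paths_Cons[OF wf])
  have wt: "sum_list (map (weight (hat_quiver Q)) ys) = 3"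
    by (simp add: ys_def comp_def)
  have \<phi>_hat: "\<phi>_hat = basis (vs, map Orig ys, up)"
    using ends by (simp add: assms(18) phi_hat_def Let_def arrow_def path_mult_def ys_def comp_def p q r s)
  have \<phi>: "forms_inclusion \<phi> = basis (vs, map dif_letter ys, up)"
    using ends by (simp add: assms(17) phi_def d_arrow_eq path_mult_def ys_def comp_def p q r s)
  let ?E = "hat_sum vs ys up Q :: ('v, 'a hatted, 'k) palg"
  have "form_arrow (dif_letter x) = Orig (Plain (unhat x))" for x :: "'a hatted" by (cases x) simp_all
  then have "map form_arrow (map dif_letter ys) = map Orig (map Plain (map unhat ys))"
    by (simp add: comp_def)
  then have "(vs, map dif_letter ys, up) \<in> paths (quiver (forms (Pbar Q)))"
    using path by (simp only: quiver_forms(1) paths_form_quiver[OF wf_Pbar[OF wf]] paths_Pbar_Orig[OF wf])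
      (simp add: comp_def)
  then have in_forms: "forms_inclusion \<phi> \<in> path_algebra (quiver (forms (Pbar Q)))"
    unfolding \<phi> by (rule path_algebra_basis)
  have mod: "function_form (bracket (Pbar Q) 2 \<omega> S S) - pscale 2 (function_form (relabel Orig ?E)) \<in> ?C"
    unfolding assms(16) by (rule bracket_mod_commutators[OF assms(1) path wt]) (simp add: assms(19) \<phi>_hat)
  have "function_form (bracket (Pbar Q) 2 \<omega> S S) \<in> ?C \<longleftrightarrow> pscale 2 (function_form (relabel Orig ?E)) \<in> ?C"
    using commutator_space_diff[OF _ mod, of "function_form (bracket (Pbar Q) 2 \<omega> S S)"]
      commutator_space_add[OF _ mod, of "pscale 2 (function_form (relabel Orig ?E))"] by auto
  \<comment> \<open>Characteristic 0 makes the factor 2 invertible.\<close>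
  also have "\<dots> \<longleftrightarrow> function_form (relabel Orig ?E) \<in> ?C"
    using commutator_space_pscale[of "pscale 2 (function_form (relabel Orig ?E))" _ "1 / 2"]
      commutator_space_pscale[of "function_form (relabel Orig ?E)" _ 2] by auto
  also have "\<dots> \<longleftrightarrow> d_form (forms_inclusion \<phi>) \<in> ?C"
    unfolding \<phi> d_form_dif_word[where Q = Q] by (rule commutator_space_hat_dif[OF wf])
  finally show ?thesis
    unfolding DR_class_eq_0_iff d_DR_eq_0_iff[OF wf_Pbar[OF wf] in_forms] .
qed

end
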